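(* There exists a constant $C > 0$ such that for every locally integrable $V \ge 0$ on $\mathbb{R}^2$, $$N_-(\mathcal{E}_V) \le C\left(\|V\|_{\mathcal{B},\mathbb{R}^2} + \int_{\mathbb{R}^2} V(x)\ln(1+|x|)\,dx\right) + 1 .$$
   Context: For a Hermitian form $\mathbf{q}$ with domain $\mathrm{Dom}(\mathbf{q})$ in a Hilbert space, $N_-(\mathbf{q}) := \sup\{\dim\mathcal{L} : \mathcal{L}\subseteq \mathrm{Dom}(\mathbf{q}) \text{ a linear subspace},\ \mathbf{q}[u]<0\ \forall u\in\mathcal{L}\setminus\{0\}\}\in\{0,1,2,\dots\}\cup\{\infty\}$. For locally integrable $V\ge 0$ on $\mathbb{R}^2$, $\mathcal{E}_V[w] := \int_{\mathbb{R}^2}|\nabla w(x)|^2dx - \int_{\mathbb{R}^2}V(x)|w(x)|^2dx$ with $\mathrm{Dom}(\mathcal{E}_V) := W^1_2(\mathbb{R}^2)\cap L_2(\mathbb{R}^2,V(x)dx)$, where $W^1_2$ is the Sobolev space of $L_2$ functions with $L_2$ first-order weak derivatives. $\mathcal{A}(s)=e^{|s|}-1-|s|$ and $\mathcal{B}(s)=(1+|s|)\ln(1+|s|)-|s|$, $s\in\mathbb{R}$, are mutually complementary $N$-functions. The Orlicz norm is $\|f\|_{\mathcal{B},\mathbb{R}^2} := \sup\{|\int_{\mathbb{R}^2} fg\,dx| : g \text{ measurable},\ \int_{\mathbb{R}^2}\mathcal{A}(g)\,dx\le 1\}$, understood as $+\infty$ if $f$ is not in the Orlicz space $L_{\mathcal{B}}(\mathbb{R}^2)$.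 The estimate is trivial if the right-hand side is $+\infty$. *)

theory Defs
  imports "HOL-Analysis.Analysis"
begin

context vector_space
begin

text \<open>The library's \<^term>\<open>dim\<close> is natural-number valued and uninformative for
  infinite-dimensional sets.\<close>

definition edim :: "'b set \<Rightarrow> enat" where
  "edim S = (if \<exists>B. finite B \<and> S \<subseteq> span B then enat (dim S) else \<infinity>)"

text \<open>Here \<^term>\<open>q u\<close> is the value \<open>q[u] = q[u, u]\<close> of a Hermitian form on the diagonal,
  which is real; its values outside the domain \<^term>\<open>D\<close> are irrelevant.\<close>

text \<open>(In the definition, \<open>local.edim\<close> is qualified because the plain name is captured by the
  copy for real vector spaces.)\<close>

definition N_minus :: "'b set \<Rightarrow> ('b \<Rightarrow> real) \<Rightarrow> enat" where
  "N_minus D q = Sup {local.edim L | L. subspace L \<and> L \<subseteq> D \<and> (\<forall>u \<in> L - {0}. q u < 0)}"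

end

definition square_integrable :: "(real^2 \<Rightarrow> complex) \<Rightarrow> bool" where
  "square_integrable f \<longleftrightarrow>
     f \<in> borel_measurable lebesgue \<and> integrable lebesgue (\<lambda>x. (cmod (f x))\<^sup>2)"

definition l2_rel :: "(real^2 \<Rightarrow> complex) \<Rightarrow> (real^2 \<Rightarrow> complex) \<Rightarrow> bool" where
  "l2_rel f g \<longleftrightarrow>
     square_integrable f \<and> square_integrable g \<and> (AE x in lebesgue. f x = g x)"

lemma square_integrable_zero: "square_integrable (\<lambda>x. 0)"
  by (simp add: square_integrable_def)

lemma square_integrable_scale:
  assumes "square_integrable f"
  shows "square_integrable (\<lambda>x. c * f x)"
  using assms by (auto simp: square_integrable_def norm_mult power_mult_distrib)

lemma square_integrable_add:
  assumes "square_integrable f" "square_integrable g"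
  shows "square_integrable (\<lambda>x. f x + g x)"
proof -
  have [measurable]: "f \<in> borel_measurable lebesgue" "g \<in> borel_measurable lebesgue"
    using assms by (auto simp: square_integrable_def)
  have "integrable lebesgue (\<lambda>x. 2 * (cmod (f x))\<^sup>2 + 2 * (cmod (g x))\<^sup>2)"
    using assms by (auto simp: square_integrable_def)
  then have "integrable lebesgue (\<lambda>x. (cmod (f x + g x))\<^sup>2)"
  proof (rule Bochner_Integration.integrable_bound)
    show "AE x in lebesgue. norm ((cmod (f x + g x))\<^sup>2)
            \<le> norm (2 * (cmod (f x))\<^sup>2 + 2 * (cmod (g x))\<^sup>2)"
    proof (rule AE_I2)
      fix x
      have "(cmod (f x + g x))\<^sup>2 \<le> (cmod (f x) + cmod (g x))\<^sup>2"
        by (intro power_mono norm_triangle_ineq) simp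
      also have "\<dots> \<le> 2 * (cmod (f x))\<^sup>2 + 2 * (cmod (g x))\<^sup>2"
        using sum_squares_bound[of "cmod (f x)" "cmod (g x)"] by (simp add: power2_sum)
      finally show "norm ((cmod (f x + g x))\<^sup>2)
            \<le> norm (2 * (cmod (f x))\<^sup>2 + 2 * (cmod (g x))\<^sup>2)" by simp
    qed
  qed measurable
  then show ?thesis by (simp add: square_integrable_def)
qed

quotient_type l2 = "real^2 \<Rightarrow> complex" / partial: l2_rel
proof (rule part_equivpI)
  show "\<exists>f. l2_rel f f"
    using square_integrable_zero by (auto simp: l2_rel_def)
  show "symp l2_rel"
    by (auto intro!: sympI simp: l2_rel_def)
  show "transp l2_rel"
    by (rule transpI) (auto simp: l2_rel_def)
qed

instantiation l2 :: ab_group_add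
begin

lift_definition zero_l2 :: l2 is "\<lambda>x. 0"
  by (simp add: l2_rel_def square_integrable_zero)

lift_definition plus_l2 :: "l2 \<Rightarrow> l2 \<Rightarrow> l2" is "\<lambda>f g x. f x + g x"
  by (auto simp: l2_rel_def square_integrable_add)

lift_definition uminus_l2 :: "l2 \<Rightarrow> l2" is "\<lambda>f x. - f x"
  using square_integrable_scale[of _ "-1"] by (auto simp: l2_rel_def)

definition minus_l2 :: "l2 \<Rightarrow> l2 \<Rightarrow> l2" where
  "minus_l2 u v = u + - v"

instance
proof
  fix u v w :: l2
  show "u + v + w = u + (v + w)"
    by transfer (auto simp: l2_rel_def square_integrable_add add.assoc)
  show "u + v = v + u"
    by transfer (auto simp: l2_rel_def square_integrable_add add.commute)
  show "0 + u = u"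
    by transfer (auto simp: l2_rel_def)
  show "- u + u = 0"
    by transfer (auto simp: l2_rel_def square_integrable_zero)
  show "u - v = u + - v"
    by (rule minus_l2_def)
qed

end

lift_definition l2_scale :: "complex \<Rightarrow> l2 \<Rightarrow> l2" is "\<lambda>c f x. c * f x"
  by (auto simp: l2_rel_def square_integrable_scale)

global_interpretation l2: vector_space l2_scale
proof
  fix a b :: complex and u v :: l2
  show "l2_scale a (u + v) = l2_scale a u + l2_scale a v"
    by transfer (auto simp: l2_rel_def square_integrable_add square_integrable_scale algebra_simps)
  show "l2_scale (a + b) u = l2_scale a u + l2_scale b u"
    by transfer (auto simp: l2_rel_def square_integrable_add square_integrable_scale algebra_simps)
  show "l2_scale a (l2_scale b u) = l2_scale (a * b) u"
    by transfer (auto simp: l2_rel_def square_integrable_scale mult.assoc)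
  show "l2_scale 1 u = u"
    by transfer (auto simp: l2_rel_def)
qed

definition partial :: "2 \<Rightarrow> (real^2 \<Rightarrow> real) \<Rightarrow> real^2 \<Rightarrow> real" where
  "partial i f x = frechet_derivative f (at x) (axis i 1)"

text \<open>Differentiable with all partial derivatives of class \<open>C^k\<close> is the same as class
  \<open>C^(k+1)\<close>, since the partial derivatives are then continuous.\<close>

primrec Ck :: "nat \<Rightarrow> (real^2 \<Rightarrow> real) \<Rightarrow> bool" where
  "Ck 0 f \<longleftrightarrow> continuous_on UNIV f"
| "Ck (Suc k) f \<longleftrightarrow> (\<forall>x. f differentiable (at x)) \<and> (\<forall>i. Ck k (partial i f))"

definition test_functions :: "(real^2 \<Rightarrow> real) set" where
  "test_functions = {\<phi>. (\<forall>k. Ck k \<phi>) \<and> compact (closure {x. \<phi> x \<noteq> 0})}"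

text \<open>\<^term>\<open>rep_l2 u\<close> is some representative of the class \<^term>\<open>u\<close>; no notion below depends on
  the choice.\<close>

definition weak_partial :: "2 \<Rightarrow> l2 \<Rightarrow> l2 \<Rightarrow> bool" where
  "weak_partial i u v \<longleftrightarrow>
     (\<forall>\<phi> \<in> test_functions.
        (LINT x|lebesgue. partial i \<phi> x *\<^sub>R rep_l2 u x) = - (LINT x|lebesgue. \<phi> x *\<^sub>R rep_l2 v x))"

definition W12 :: "l2 set" where
  "W12 = {u. \<forall>i. \<exists>v. weak_partial i u v}"

text \<open>A weak derivative in \<^typ>\<open>l2\<close> is unique, so the description is proper on \<^term>\<open>W12\<close>.\<close>

definition weak_deriv :: "2 \<Rightarrow> l2 \<Rightarrow> l2" where
  "weak_deriv i u = (THE v. weak_partial i u v)"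

definition locally_integrable :: "(real^2 \<Rightarrow> real) \<Rightarrow> bool" where
  "locally_integrable V \<longleftrightarrow> (\<forall>K. compact K \<longrightarrow> set_integrable lebesgue K V)"

definition Dom_E :: "(real^2 \<Rightarrow> real) \<Rightarrow> l2 set" where
  "Dom_E V = W12 \<inter> {w. integrable lebesgue (\<lambda>x. V x * (cmod (rep_l2 w x))\<^sup>2)}"

definition form_E :: "(real^2 \<Rightarrow> real) \<Rightarrow> l2 \<Rightarrow> real" where
  "form_E V w =
     (LINT x|lebesgue. (\<Sum>i\<in>UNIV. (cmod (rep_l2 (weak_deriv i w) x))\<^sup>2))
     - (LINT x|lebesgue. V x * (cmod (rep_l2 w x))\<^sup>2)"

definition N_fun_A :: "real \<Rightarrow> real" where
  "N_fun_A s = exp \<bar>s\<bar> - 1 - \<bar>s\<bar>"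

definition N_fun_B :: "real \<Rightarrow> real" where
  "N_fun_B s = (1 + \<bar>s\<bar>) * ln (1 + \<bar>s\<bar>) - \<bar>s\<bar>"

definition orlicz_space :: "(real \<Rightarrow> real) \<Rightarrow> (real^2 \<Rightarrow> real) set" where
  "orlicz_space \<Phi> = {f \<in> borel_measurable lebesgue.
     \<exists>c>0. (\<integral>\<^sup>+x. ennreal (\<Phi> (f x / c)) \<partial>lebesgue) < \<infinity>}"

text \<open>For \<^term>\<open>f\<close> in the Orlicz space every product \<open>f g\<close> below is integrable by Young's
  inequality. Outside it the Bochner integral may take its default value 0, hence the case
  distinction.\<close>

definition orlicz_norm_B :: "(real^2 \<Rightarrow> real) \<Rightarrow> ennreal" where
  "orlicz_norm_B f =
     (if f \<in> orlicz_space N_fun_B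
      then Sup {ennreal \<bar>LINT x|lebesgue. f x * g x\<bar> | g.
             g \<in> borel_measurable lebesgue \<and> (\<integral>\<^sup>+x. ennreal (N_fun_A (g x)) \<partial>lebesgue) \<le> 1}
      else \<infinity>)"

end

theory Submission
  imports Defs
begin

text \<open>The plane carries the measure \<open>M = w dx\<close> with \<open>w\<close> comparable to \<open>(1 + |x|)^-4\<close>, the area of the
  Riemann sphere, and the Dirichlet integral is conformally invariant; this turns the plane into a
  bounded region. It is partitioned at level \<open>k\<close> into nodes of sphere diameter \<open>2^-k\<close>: the exterior
  of a square around the origin, and dyadic squares. Translating squares along the axes shows that the
  averages of a Sobolev function over a node and over its child differ by at most a multiple of
  \<open>2^k\<close> times the integral of the gradient over the node. If the average over a node vanishes, \<open>|u|\<close>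
  is therefore bounded there by a potential of the gradient whose squared kernel is logarithmic, and
  Schur's test gives \<open>\<integral> V |u|^2 \<le> C c \<integral> |grad u|^2\<close> on every cell (a node minus a smaller node) on which
  the logarithmic potential of \<open>V\<close> is at most \<open>c\<close>.

  Logarithmic functions are exponentially integrable, so testing \<open>V\<close> against them shows that there are
  at most \<open>C (\<parallel>V\<parallel> + \<integral> V ln (1 + |x|)) / c\<close> disjoint heavy cells. Following the chains of nodes along
  which the number of disjoint heavy cells inside the node is constant, one finds a number of nodes
  exceeding this count at most by a factor and \<open>1\<close>, such that the form is nonnegative on all functions
  whose averages over these nodes vanish.\<close>


subsection \<open>Schur's test\<close>

text \<open>The additive constant has to be exactly 1, so a potential without heavy cells may cost a
  single constraint, the average over the root. Subdividing until every node is light does not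
  achieve this: a small concentrated mass makes all nodes around it heavy, and the subdivision then
  costs constraints on every level although there is little room for disjoint heavy pieces. Cells,
  that is nodes with a hole, allow such a chain to be crossed in one step: the constraint at its top
  controls the function everywhere outside the hole, however deep the hole lies. The price is that
  the gradient inside the hole still enters the potential outside of it. An extra quadratic term in
  the induction hypothesis \<open>good\<close> pays for this, and the constants close because a node
  has at least four times the area of each of its children. The logarithmic moment of
  \<open>V\<close> has a separate origin: exponential integrability holds for the sphere area, while
  the Orlicz norm refers to Lebesgue measure, and the logarithm of the density between them is of
  order \<open>ln (1 + norm x)\<close>.\<close>

lemma ennreal_mult_le_weighted_squares:
  fixes g g' h h' :: ennreal
  assumes "0 < h" "h < \<infinity>" "0 < h'" "h' < \<infinity>"
  shows "2 * (g * g') \<le> h * (g'\<^sup>2 / h') + h' * (g\<^sup>2 / h)"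
proof (cases "g = \<infinity> \<or> g' = \<infinity>")
  case True
  then show ?thesis using assms
    by (auto simp: ennreal_mult_eq_top_iff ennreal_divide_eq_top_iff power2_eq_square ennreal_top_mult ennreal_mult_top ennreal_top_divide add_top)
next
  case False
  then obtain a b where ab: "g = ennreal a" "g' = ennreal b" "a \<ge> 0" "b \<ge> 0"
    by (metis ennreal_cases infinity_ennreal_def)
  obtain r s where rs: "h = ennreal r" "h' = ennreal s" "r > 0" "s > 0"
    using assms by (metis ennreal_cases ennreal_less_zero_iff infinity_ennreal_def less_irrefl)
  have "2 * (a * b) \<le> r * (b\<^sup>2 / s) + s * (a\<^sup>2 / r)"
  proof -
    have "0 \<le> (r * b - s * a)\<^sup>2 / (r * s)" using rs by simp
    also have "\<dots> = r * (b\<^sup>2 / s) + s * (a\<^sup>2 / r) - 2 * (a * b)"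
      using rs by (simp add: field_simps power2_eq_square)
    finally show ?thesis by simp
  qed
  then have "ennreal (2 * (a * b)) \<le> ennreal (r * (b\<^sup>2 / s) + s * (a\<^sup>2 / r))"
    by (rule ennreal_leI)
  also have "\<dots> = h * (g'\<^sup>2 / h') + h' * (g\<^sup>2 / h)"
    using ab rs by (simp add: ennreal_mult'' divide_ennreal ennreal_power del: times_divide_eq_right)
  finally show ?thesis using ab by (simp add: ennreal_mult'')
qed

text \<open>Symmetrization: twice the square of the left integral is a double integral, and the
  weighted inequality for \<open>g x * g y\<close> is integrated over both variables. Finiteness of
  the integral of \<open>k * h\<close> makes \<open>h\<close> finite almost everywhere on the set
  where \<open>k\<close> does not vanish.\<close>

lemma weighted_Cauchy_Schwarz:
  fixes k g h :: "'a \<Rightarrow> ennreal"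
  assumes [measurable]: "k \<in> borel_measurable M" "g \<in> borel_measurable M" "h \<in> borel_measurable M"
    and pos: "\<And>y. 0 < h y" and fin: "(\<integral>\<^sup>+y. k y * h y \<partial>M) < \<infinity>"
  shows "(\<integral>\<^sup>+y. k y * g y \<partial>M)\<^sup>2 \<le> (\<integral>\<^sup>+y. k y * h y \<partial>M) * (\<integral>\<^sup>+y. k y * ((g y)\<^sup>2 / h y) \<partial>M)"
    (is "?I\<^sup>2 \<le> ?A * ?B")
proof -
  have ae: "AE y in M. k y * h y \<noteq> \<infinity>"
    by (rule nn_integral_noteq_infinite) (use fin in auto)
  have "2 * ?I\<^sup>2 = (\<integral>\<^sup>+x. (\<integral>\<^sup>+y. 2 * ((k x * g x) * (k y * g y)) \<partial>M) \<partial>M)"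
    by (simp add: nn_integral_cmult nn_integral_multc power2_eq_square)
  also have "\<dots> \<le> (\<integral>\<^sup>+x. (\<integral>\<^sup>+y. (k x * h x) * (k y * ((g y)\<^sup>2 / h y)) + (k y * h y) * (k x * ((g x)\<^sup>2 / h x)) \<partial>M) \<partial>M)"
  proof (rule nn_integral_mono_AE, use ae in eventually_elim)
    fix x assume x: "k x * h x \<noteq> \<infinity>"
    show "(\<integral>\<^sup>+y. 2 * ((k x * g x) * (k y * g y)) \<partial>M) \<le> (\<integral>\<^sup>+y. (k x * h x) * (k y * ((g y)\<^sup>2 / h y)) + (k y * h y) * (k x * ((g x)\<^sup>2 / h x)) \<partial>M)"
    proof (rule nn_integral_mono_AE, use ae in eventually_elim)
      fix y assume y: "k y * h y \<noteq> \<infinity>"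
      show "2 * ((k x * g x) * (k y * g y)) \<le> (k x * h x) * (k y * ((g y)\<^sup>2 / h y)) + (k y * h y) * (k x * ((g x)\<^sup>2 / h x))"
      proof (cases "k x = 0 \<or> k y = 0")
        case True then show ?thesis by auto
      next
        case False
        then have "h x < \<infinity>" "h y < \<infinity>" using x y
          by (auto simp: ennreal_mult_eq_top_iff less_top)
        from ennreal_mult_le_weighted_squares[OF pos this(1) pos this(2), of "g x" "g y"]
        have "(k x * k y) * (2 * (g x * g y)) \<le> (k x * k y) * (h x * ((g y)\<^sup>2 / h y) + h y * ((g x)\<^sup>2 / h x))"
          by (rule mult_left_mono) simp
        then show ?thesis by (simp add: algebra_simps)
      qed
    qed
  qed
  also have "\<dots> = 2 * (?A * ?B)"
    by (simp add: nn_integral_cmult nn_integral_multc nn_integral_add mult_2 mult.commute)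
  finally show ?thesis
    by (simp add: mult_le_cancel_left_pos ennreal_mult_le_mult_iff)
qed

lemma square_integral_le:
  assumes [measurable]: "A \<in> sets M" "g \<in> borel_measurable M" and "emeasure M A < \<infinity>"
  shows "(\<integral>\<^sup>+y\<in>A. g y \<partial>M)\<^sup>2 \<le> emeasure M A * (\<integral>\<^sup>+y\<in>A. (g y)\<^sup>2 \<partial>M)"
  using weighted_Cauchy_Schwarz[of "indicator A" M g "\<lambda>_. 1"] assms(3)
  by (simp add: mult.commute divide_ennreal_def)

text \<open>The weight is 1 on the side of \<open>N\<close> and \<open>h\<close> on the side of
  \<open>M\<close>. When \<open>h\<close> is essentially the column sums of the kernel, the row
  condition concerns the kernel composed with its transpose, so only the composed kernel has to be
  estimated.\<close>

lemma Schur_test: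
  fixes K :: "'a \<Rightarrow> 'b \<Rightarrow> ennreal"
  assumes "sigma_finite_measure M" "sigma_finite_measure N"
    and [measurable]: "(\<lambda>(x, y). K x y) \<in> borel_measurable (N \<Otimes>\<^sub>M M)"
      "g \<in> borel_measurable M" "h \<in> borel_measurable M"
    and pos: "\<And>y. 0 < h y" and A: "A < \<infinity>"
    and row: "\<And>x. x \<in> space N \<Longrightarrow> (\<integral>\<^sup>+y. K x y * h y \<partial>M) \<le> A"
    and col: "\<And>y. y \<in> space M \<Longrightarrow> (\<integral>\<^sup>+x. K x y \<partial>N) \<le> h y"
  shows "(\<integral>\<^sup>+x. (\<integral>\<^sup>+y. K x y * g y \<partial>M)\<^sup>2 \<partial>N) \<le> A * (\<integral>\<^sup>+y. (g y)\<^sup>2 \<partial>M)"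
proof -
  interpret M: sigma_finite_measure M by fact
  interpret N: sigma_finite_measure N by fact
  interpret pair_sigma_finite N M ..
  have Kx[measurable]: "(\<lambda>y. K x y) \<in> borel_measurable M" if "x \<in> space N" for x
    using measurable_Pair2[OF assms(3) that] by simp
  have "(\<integral>\<^sup>+x. (\<integral>\<^sup>+y. K x y * g y \<partial>M)\<^sup>2 \<partial>N) \<le> (\<integral>\<^sup>+x. A * (\<integral>\<^sup>+y. K x y * ((g y)\<^sup>2 / h y) \<partial>M) \<partial>N)"
  proof (rule nn_integral_mono)
    fix x assume x: "x \<in> space N"
    have "(\<integral>\<^sup>+y. K x y * g y \<partial>M)\<^sup>2 \<le> (\<integral>\<^sup>+y. K x y * h y \<partial>M) * (\<integral>\<^sup>+y. K x y * ((g y)\<^sup>2 / h y) \<partial>M)"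
      by (rule weighted_Cauchy_Schwarz)
        (use Kx[OF x] pos le_less_trans[OF row[OF x] A] in auto)
    also have "\<dots> \<le> A * (\<integral>\<^sup>+y. K x y * ((g y)\<^sup>2 / h y) \<partial>M)"
      by (rule mult_right_mono[OF row[OF x]]) simp
    finally show "(\<integral>\<^sup>+y. K x y * g y \<partial>M)\<^sup>2 \<le> A * (\<integral>\<^sup>+y. K x y * ((g y)\<^sup>2 / h y) \<partial>M)" .
  qed
  also have "\<dots> = A * (\<integral>\<^sup>+x. (\<integral>\<^sup>+y. K x y * ((g y)\<^sup>2 / h y) \<partial>M) \<partial>N)"
    by (rule nn_integral_cmult) measurable
  also have "(\<integral>\<^sup>+x. (\<integral>\<^sup>+y. K x y * ((g y)\<^sup>2 / h y) \<partial>M) \<partial>N) = (\<integral>\<^sup>+y. (\<integral>\<^sup>+x. K x y * ((g y)\<^sup>2 / h y) \<partial>N) \<partial>M)"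
    by (rule Fubini'[symmetric]) measurable
  also have "\<dots> \<le> (\<integral>\<^sup>+y. (g y)\<^sup>2 \<partial>M)"
  proof (rule nn_integral_mono)
    fix y assume y: "y \<in> space M"
    have [measurable]: "(\<lambda>x. K x y) \<in> borel_measurable N"
      using measurable_Pair1[OF assms(3) y] by simp
    have "(\<integral>\<^sup>+x. K x y * ((g y)\<^sup>2 / h y) \<partial>N) = (\<integral>\<^sup>+x. K x y \<partial>N) * ((g y)\<^sup>2 / h y)"
      by (rule nn_integral_multc) measurable
    also have "\<dots> \<le> h y * ((g y)\<^sup>2 / h y)"
      by (rule mult_right_mono[OF col[OF y]]) simp
    also have "\<dots> \<le> (g y)\<^sup>2"
    proof (cases "h y = \<infinity>")
      \<comment> \<open>A quotient by infinity is 0, also for an infinite numerator; hence only an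
        inequality.\<close>
      case True then show ?thesis by simp
    next
      case False
      then show ?thesis using pos[of y]
        by (simp add: ennreal_times_divide mult.commute[of "h y"] mult_divide_eq_ennreal)
    qed
    finally show "(\<integral>\<^sup>+x. K x y * ((g y)\<^sup>2 / h y) \<partial>N) \<le> (g y)\<^sup>2" .
  qed
  finally show ?thesis by (simp add: mult_left_mono)
qed

lemma suminf_swap_ennreal:
  fixes f :: "nat \<Rightarrow> nat \<Rightarrow> ennreal"
  shows "(\<Sum>i. \<Sum>j. f i j) = (\<Sum>j. \<Sum>i. f i j)"
proof -
  have "(\<Sum>i. \<Sum>j. f i j) = (\<integral>\<^sup>+i. (\<Sum>j. f i j) \<partial>count_space UNIV)"
    by (simp add: nn_integral_count_space_nat)
  also have "\<dots> = (\<Sum>j. \<integral>\<^sup>+i. f i j \<partial>count_space UNIV)"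
    by (rule nn_integral_suminf) simp
  finally show ?thesis by (simp add: nn_integral_count_space_nat)
qed

lemma suminf_half_from:
  "(\<Sum>l. if k \<le> l then ennreal ((1/2)^(l - k)) else 0) = 2"
proof -
  have "(\<lambda>l. (1/2::real)^l) sums 2"
    using geometric_sums[of "1/2::real"] by simp
  then have "(\<lambda>l. if k \<le> l then (1/2::real)^(l - k) else 0) sums 2"
    by (subst sums_iff_shift'[of _ k, symmetric]) (auto simp: sum.neutral)
  then have "(\<Sum>l. ennreal (if k \<le> l then (1/2::real)^(l - k) else 0)) = ennreal 2"
    by (intro suminf_ennreal_eq) auto
  then show ?thesis by (simp add: if_distrib cong: if_cong)
qed

subsection \<open>Trees of nested partitions\<close>

text \<open>The first measure is the area that carries the geometry, the second one will be
  \<open>V dx\<close>. The factor 5 is the total area, required by the root; 17 counts the children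
  of an exterior node, namely 16 squares and the next exterior node.\<close>

locale dyadic_tree =
  M: sigma_finite_measure M + N: sigma_finite_measure N
  for M N :: "'a measure" +
  fixes code :: "nat \<Rightarrow> 'a \<Rightarrow> 'b::countable"
  assumes space_M[simp]: "space M = UNIV"
    and sets_N[measurable_cong, simp]: "sets N = sets M"
    and code_measurable[measurable]: "\<And>k. code k \<in> M \<rightarrow>\<^sub>M count_space UNIV"
    and code_root: "\<And>x y. code 0 x = code 0 y"
    and code_refine: "\<And>k x y. code (Suc k) x = code (Suc k) y \<Longrightarrow> code k x = code k y"
    and null_N: "\<And>A. A \<in> null_sets M \<Longrightarrow> A \<in> null_sets N"
    and measure_lower: "\<And>k x. ennreal (1 / 4 ^ k) \<le> emeasure M {y. code k y = code k x}"
    and measure_upper: "\<And>k x. emeasure M {y. code k y = code k x} \<le> 5 * ennreal (1 / 4 ^ k)"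
    and measure_ratio: "\<And>k x. 4 * emeasure M {y. code (Suc k) y = code (Suc k) x}
          \<le> emeasure M {y. code k y = code k x}"
    and children: "\<And>k x. \<exists>S. finite S \<and> card S \<le> 17 \<and> (\<forall>y. code k y = code k x \<longrightarrow> code (Suc k) y \<in> S)"
begin

definition node :: "nat \<Rightarrow> 'a \<Rightarrow> 'a set" where
  "node k x = {y. code k y = code k x}"

lemma space_N[simp]: "space N = UNIV"
  using sets_eq_imp_space_eq[OF sets_N] by simp

lemma node_sets[measurable]: "node k x \<in> sets M"
proof -
  have "code k -` {code k x} \<inter> space M \<in> sets M"
    by (rule measurable_sets[OF code_measurable]) simp
  then show ?thesis by (simp add: node_def vimage_def)
qed

lemma self_in_node[simp]: "x \<in> node k x"
  by (simp add: node_def)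

lemma node_eq: "y \<in> node k x \<Longrightarrow> node k y = node k x"
  by (auto simp: node_def)

lemma node_0[simp]: "node 0 x = UNIV"
  using code_root by (auto simp: node_def)

lemma code_refine_le:
  assumes "code k x = code k y" "l \<le> k"
  shows "code l x = code l y"
  using assms(2,1) by (induction rule: inc_induct) (auto intro: code_refine)

lemma node_mono: "l \<le> k \<Longrightarrow> node k x \<subseteq> node l x"
  by (auto simp: node_def intro: code_refine_le)

lemma node_nested: "l \<le> k \<Longrightarrow> node k y \<inter> node l x \<noteq> {} \<Longrightarrow> node k y \<subseteq> node l x"
  by (metis disjoint_iff node_eq node_mono)

lemma node_lower: "ennreal (1 / 4 ^ k) \<le> emeasure M (node k x)"
  and node_upper: "emeasure M (node k x) \<le> 5 * ennreal (1 / 4 ^ k)"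
  and node_ratio: "4 * emeasure M (node (Suc k) x) \<le> emeasure M (node k x)"
  using measure_lower measure_upper measure_ratio by (simp_all add: node_def)

text \<open>A discrete Riesz kernel: the sum is comparable to its last term, which is
  \<open>1 / d\<close> for the size \<open>d\<close> of the smallest common node. The number of
  common levels, \<open>overlap\<close>, is the corresponding \<open>log (1 / d)\<close>.\<close>

definition kern :: "nat \<Rightarrow> 'a \<Rightarrow> 'a \<Rightarrow> ennreal" where
  "kern t x y = (\<Sum>k. if t \<le> k \<and> code k x = code k y then 2 ^ k else 0)"

definition overlap :: "nat \<Rightarrow> 'a \<Rightarrow> 'a \<Rightarrow> ennreal" where
  "overlap t x y = (\<Sum>k. if t \<le> k \<and> code k x = code k y then 1 else 0)"

text \<open>The sum over nodes is the form in which telescoped averages arrive; as an integral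
  operator it has the kernel \<open>kern t\<close>.\<close>

definition pot :: "nat \<Rightarrow> ('a \<Rightarrow> ennreal) \<Rightarrow> 'a \<Rightarrow> ennreal" where
  "pot t g x = (\<Sum>k. if t \<le> k then 2 ^ k * (\<integral>\<^sup>+y\<in>node k x. g y \<partial>M) else 0)"

lemma code_eq_measurable[measurable]:
  "Measurable.pred (N \<Otimes>\<^sub>M M) (\<lambda>(x, y). code k x = code k y)"
  "Measurable.pred M (\<lambda>y. code k x = code k y)"
  "Measurable.pred N (\<lambda>x. code k x = code k y)"
proof -
  have c[measurable]: "code k \<in> N \<rightarrow>\<^sub>M count_space UNIV"
    using code_measurable[of k] by simp
  show "Measurable.pred (N \<Otimes>\<^sub>M M) (\<lambda>(x, y). code k x = code k y)" 
    "Measurable.pred M (\<lambda>y. code k x = code k y)"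
  "Measurable.pred N (\<lambda>x. code k x = code k y)"
    by measurable
qed

lemma kern_measurable[measurable]:
  "(\<lambda>(x, y). kern t x y) \<in> borel_measurable (N \<Otimes>\<^sub>M M)"
  "kern t x \<in> borel_measurable M"
  "(\<lambda>x. kern t x y) \<in> borel_measurable N"
  unfolding kern_def by measurable

lemma overlap_measurable[measurable]:
  "(\<lambda>(x, y). overlap t x y) \<in> borel_measurable (N \<Otimes>\<^sub>M M)"
  "overlap t x \<in> borel_measurable M"
  "overlap t x \<in> borel_measurable N"
  unfolding overlap_def by measurable

lemma pot_eq:
  assumes [measurable]: "g \<in> borel_measurable M"
  shows "pot t g x = (\<integral>\<^sup>+y. kern t x y * g y \<partial>M)"
proof -
  have "(\<integral>\<^sup>+y. kern t x y * g y \<partial>M) = (\<integral>\<^sup>+y. (\<Sum>k. (if t \<le> k \<and> code k x = code k y then 2 ^ k else 0) * g y) \<partial>M)"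
    by (simp add: kern_def)
  also have "\<dots> = (\<Sum>k. (\<integral>\<^sup>+y. (if t \<le> k \<and> code k x = code k y then 2 ^ k else 0) * g y \<partial>M))"
    by (rule nn_integral_suminf) measurable
  also have "\<dots> = pot t g x"
    unfolding pot_def
  proof (rule suminf_cong)
    fix k
    have "(\<integral>\<^sup>+y. (if t \<le> k \<and> code k x = code k y then 2 ^ k else 0) * g y \<partial>M)
      = (\<integral>\<^sup>+y. (if t \<le> k then 2 ^ k else 0) * (g y * indicator (node k x) y) \<partial>M)"
      by (intro nn_integral_cong) (auto simp: node_def indicator_def)
    also have "\<dots> = (if t \<le> k then 2 ^ k * (\<integral>\<^sup>+y\<in>node k x. g y \<partial>M) else 0)"
      by (simp add: nn_integral_cmult)
    finally show "(\<integral>\<^sup>+y. (if t \<le> k \<and> code k x = code k y then 2 ^ k else 0) * g y \<partial>M)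
      = (if t \<le> k then 2 ^ k * (\<integral>\<^sup>+y\<in>node k x. g y \<partial>M) else 0)" .
  qed
  finally show ?thesis ..
qed

lemma two_power_ennreal: "(2::ennreal) ^ k = ennreal (2 ^ k)"
  by (simp flip: ennreal_power)

text \<open>A node of level \<open>k\<close> contributes at most \<open>2 ^ k * 5 / 4 ^ k\<close>,
  which is a geometric series from \<open>t\<close> on.\<close>

lemma kern_integral_le: "(\<integral>\<^sup>+y. kern t x y \<partial>M) \<le> 10 * ennreal (1 / 2 ^ t)"
proof -
  have "(\<integral>\<^sup>+y. kern t x y \<partial>M) = pot t (\<lambda>_. 1) x"
    by (simp add: pot_eq)
  also have "\<dots> \<le> (\<Sum>k. 5 * ennreal (1 / 2 ^ t) * (if t \<le> k then ennreal ((1/2) ^ (k - t)) else 0))"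
    unfolding pot_def
  proof (intro suminf_le allI)
    fix k
    have "2 ^ k * emeasure M (node k x) \<le> 5 * ennreal (1 / 2 ^ t) * ennreal ((1/2) ^ (k - t))" if "t \<le> k"
    proof -
      have "2 ^ k * emeasure M (node k x) \<le> 2 ^ k * (5 * ennreal (1 / 4 ^ k))"
        by (intro mult_left_mono node_upper) simp
      also have "\<dots> = ennreal (2 ^ k * (5 * (1 / 4 ^ k)))"
        by (simp add: two_power_ennreal ennreal_mult del: times_divide_eq_right)
      also have "2 ^ k * (5 * (1 / 4 ^ k)) = 5 * (1 / 2 ^ t) * ((1/2) ^ (k - t) :: real)"
      proof -
        have "(4::real) ^ k = 2 ^ k * 2 ^ k" by (simp flip: power_mult_distrib)
        moreover have "(2::real) ^ k = 2 ^ t * 2 ^ (k - t)" using that by (simp flip: power_add)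
        ultimately show ?thesis by (simp add: power_one_over)
      qed
      also have "ennreal (5 * (1 / 2 ^ t) * ((1/2) ^ (k - t) :: real)) = 5 * ennreal (1 / 2 ^ t) * ennreal ((1/2) ^ (k - t))"
        by (simp add: ennreal_mult del: times_divide_eq_right)
      finally show ?thesis .
    qed
    then show "(if t \<le> k then 2 ^ k * (\<integral>\<^sup>+y\<in>node k x. 1 \<partial>M) else 0)
        \<le> 5 * ennreal (1 / 2 ^ t) * (if t \<le> k then ennreal ((1/2) ^ (k - t)) else 0)"
      by simp
  qed auto
  also have "\<dots> = 10 * ennreal (1 / 2 ^ t)"
    by (simp only: ennreal_suminf_cmult suminf_half_from) (simp add: mult.commute mult.left_commute)
  finally show ?thesis .
qed

text \<open>Nodes of levels \<open>k\<close> and \<open>l\<close> around the two points meet only if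
  the points share a node at level \<open>min k l\<close>, and the intersection has area at most
  \<open>5 / 4 ^ max k l\<close>. The product of the kernel values thus contributes
  \<open>5 / 2 ^ (max k l - min k l)\<close>, and summation over the larger level leaves a constant
  for each common level: in two dimensions the composition of \<open>1 / d\<close> with itself is a
  logarithm.\<close>

lemma kern_product_le:
  "(\<integral>\<^sup>+y. kern t x y * kern t x' y \<partial>M) \<le> 20 * overlap t x x'"
proof -
  define d where "d k = (if t \<le> k \<and> code k x = code k x' then 1 else 0 :: ennreal)" for k
  define r where "r k l = (if k \<le> l then ennreal ((1/2) ^ (l - k)) else 0)" for k l :: nat
  \<comment> \<open>The first summand on the right serves \<open>k \<le> l\<close>, the second one
    \<open>l \<le> k\<close>; \<open>d\<close> is always taken at the smaller level.\<close>
  have term_le: "(if t \<le> k then 2 ^ k * (\<integral>\<^sup>+y\<in>node k x. (if t \<le> l \<and> code l x' = code l y then 2 ^ l else 0) \<partial>M) else 0)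
      \<le> 5 * (d k * r k l) + 5 * (d l * r l k)" (is "?T k l \<le> _") for k l
  proof (cases "t \<le> k \<and> t \<le> l \<and> node k x \<inter> node l x' \<noteq> {}")
    case True
    define j where "j = min k l"
    define i where "i = max k l"
    have tj: "t \<le> j" using True by (simp add: j_def)
    have eq: "code j x = code j x'"
    proof -
      obtain y where "code k y = code k x" "code l y = code l x'"
        using True by (auto simp: node_def)
      then show ?thesis
        by (metis code_refine_le j_def min.cobounded1 min.cobounded2)
    qed
    have "?T k l = 2 ^ k * (2 ^ l * emeasure M (node k x \<inter> node l x'))"
    proof -
      have "(\<integral>\<^sup>+y\<in>node k x. (if t \<le> l \<and> code l x' = code l y then 2 ^ l else 0) \<partial>M)
          = (\<integral>\<^sup>+y. 2 ^ l * indicator (node k x \<inter> node l x') y \<partial>M)"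
        using True by (intro nn_integral_cong) (auto simp: node_def indicator_def)
      also have "\<dots> = 2 ^ l * emeasure M (node k x \<inter> node l x')"
        by (simp add: nn_integral_cmult_indicator)
      finally show ?thesis using True by simp
    qed
    also have "\<dots> \<le> 2 ^ k * (2 ^ l * (5 * ennreal (1 / 4 ^ i)))"
    proof -
      have "emeasure M (node k x \<inter> node l x') \<le> 5 * ennreal (1 / 4 ^ i)"
      proof (cases "k \<le> l")
        case True
        then have "emeasure M (node k x \<inter> node l x') \<le> emeasure M (node l x')"
          by (intro emeasure_mono) auto
        then show ?thesis using node_upper[of l x'] True by (auto simp: i_def max_def)
      next
        case False
        then have "emeasure M (node k x \<inter> node l x') \<le> emeasure M (node k x)"
          by (intro emeasure_mono) auto
        then show ?thesis using node_upper[of k x] False by (auto simp: i_def max_def)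
      qed
      then show ?thesis by (intro mult_left_mono) auto
    qed
    also have "\<dots> = 5 * ennreal ((1/2) ^ (i - j))"
    proof -
      have ij: "j \<le> i" "k + l = i + j" by (auto simp: i_def j_def)
      have "2 ^ k * (2 ^ l * (5 * (1 / 4 ^ i))) = 5 * ((1/2) ^ (i - j) :: real)"
      proof -
        have "(2::real) ^ k * 2 ^ l = 2 ^ i * 2 ^ j" by (simp add: ij flip: power_add)
        moreover have "(4::real) ^ i = 2 ^ i * 2 ^ i" by (simp flip: power_mult_distrib)
        moreover have "(2::real) ^ i = 2 ^ j * 2 ^ (i - j)" using ij by (simp flip: power_add)
        ultimately have "(2 ^ k * 2 ^ l) / 4 ^ i = (1/2 :: real) ^ (i - j)"
          by (simp add: power_one_over)
        moreover have "2 ^ k * (2 ^ l * (5 * (1 / 4 ^ i))) = 5 * ((2 ^ k * 2 ^ l) / 4 ^ i :: real)"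
          by simp
        ultimately show ?thesis by metis
      qed
      then have "ennreal (2 ^ k * (2 ^ l * (5 * (1 / 4 ^ i)))) = ennreal (5 * ((1/2) ^ (i - j)))"
        by simp
      then show ?thesis
        by (simp add: two_power_ennreal ennreal_mult del: times_divide_eq_right)
    qed
    also have "\<dots> \<le> 5 * (d k * r k l) + 5 * (d l * r l k)"
      using tj eq by (cases "k \<le> l") (auto simp: i_def j_def d_def r_def max_def min_def)
    finally show ?thesis .
  next
    case False
    then have "t \<le> k \<Longrightarrow> (\<integral>\<^sup>+y\<in>node k x. (if t \<le> l \<and> code l x' = code l y then 2 ^ l else 0) \<partial>M) = (\<integral>\<^sup>+y. 0 \<partial>M)"
      by (intro nn_integral_cong) (auto simp: node_def indicator_def)
    then have "?T k l = 0" by auto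
    then show ?thesis by (simp only: zero_le)
  qed
  have "(\<integral>\<^sup>+y. kern t x y * kern t x' y \<partial>M) = pot t (kern t x') x"
    by (simp add: pot_eq)
  also have "\<dots> = (\<Sum>k. \<Sum>l. ?T k l)"
    unfolding pot_def
  proof (rule suminf_cong)
    fix k
    have "(\<integral>\<^sup>+y\<in>node k x. kern t x' y \<partial>M) = (\<integral>\<^sup>+y. (\<Sum>l. (if t \<le> l \<and> code l x' = code l y then 2 ^ l else 0) * indicator (node k x) y) \<partial>M)"
      by (simp add: kern_def)
    also have "\<dots> = (\<Sum>l. \<integral>\<^sup>+y\<in>node k x. (if t \<le> l \<and> code l x' = code l y then 2 ^ l else 0) \<partial>M)"
      by (rule nn_integral_suminf) measurable
    finally show "(if t \<le> k then 2 ^ k * (\<integral>\<^sup>+y\<in>node k x. kern t x' y \<partial>M) else 0) = (\<Sum>l. ?T k l)"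
      by (simp add: ennreal_suminf_cmult)
  qed
  also have "\<dots> \<le> (\<Sum>k. \<Sum>l. 5 * (d k * r k l) + 5 * (d l * r l k))"
    by (intro suminf_le allI term_le) auto
  also have "\<dots> = (\<Sum>k. \<Sum>l. 5 * (d k * r k l)) + (\<Sum>k. \<Sum>l. 5 * (d l * r l k))"
    by (simp add: suminf_add[symmetric])
  also have "(\<Sum>k. \<Sum>l. 5 * (d l * r l k)) = (\<Sum>k. \<Sum>l. 5 * (d k * r k l))"
    by (rule suminf_swap_ennreal)
  also have "(\<Sum>k. \<Sum>l. 5 * (d k * r k l)) = (\<Sum>k. 10 * d k)"
  proof (rule suminf_cong)
    fix k
    have "(\<Sum>l. 5 * (d k * r k l)) = 5 * (d k * (\<Sum>l. r k l))"
      by (simp only: ennreal_suminf_cmult)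
    also have "(\<Sum>l. r k l) = 2" unfolding r_def by (rule suminf_half_from)
    finally show "(\<Sum>l. 5 * (d k * r k l)) = 10 * d k"
      by (simp add: mult.commute mult.left_commute)
  qed
  also have "\<dots> = 10 * overlap t x x'"
    by (simp only: ennreal_suminf_cmult d_def overlap_def)
  finally show ?thesis by (simp flip: distrib_right)
qed

end

section \<open>Weighted estimates on light cells\<close>

context dyadic_tree
begin

text \<open>The sum below is the integral over \<open>R\<close> of the number of levels in \<open>{t..<n}\<close> at which \<open>x\<close> and \<open>y\<close>
  lie in the same node, a truncated logarithmic potential of \<open>N\<close>.\<close>

definition heavy :: "ennreal \<Rightarrow> nat \<Rightarrow> 'a set \<Rightarrow> bool" where
  "heavy c t R \<longleftrightarrow> (\<exists>x\<in>R. \<exists>n. c < (\<Sum>k=t..<n. emeasure N (R \<inter> node k x)))"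

text \<open>Without a witness of heaviness every partial sum over levels is at most
  \<open>c\<close>, and the full potential is their supremum.\<close>

lemma overlap_integral_le:
  assumes "\<not> heavy c t R" "x \<in> R" and [measurable]: "R \<in> sets M"
  shows "(\<integral>\<^sup>+y\<in>R. overlap t x y \<partial>N) \<le> c"
proof -
  have "(\<integral>\<^sup>+y\<in>R. overlap t x y \<partial>N) = (\<integral>\<^sup>+y. (\<Sum>k. (if t \<le> k \<and> code k x = code k y then 1 else 0) * indicator R y) \<partial>N)"
    by (simp add: overlap_def)
  also have "\<dots> = (\<Sum>k. \<integral>\<^sup>+y\<in>R. (if t \<le> k \<and> code k x = code k y then 1 else 0) \<partial>N)"
    by (rule nn_integral_suminf) measurable
  also have "\<dots> = (\<Sum>k. if t \<le> k then emeasure N (R \<inter> node k x) else 0)"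
  proof (rule suminf_cong)
    fix k
    have "(\<integral>\<^sup>+y\<in>R. (if t \<le> k \<and> code k x = code k y then 1 else 0) \<partial>N)
      = (\<integral>\<^sup>+y. (if t \<le> k then 1 else 0) * indicator (R \<inter> node k x) y \<partial>N)"
      by (intro nn_integral_cong) (auto simp: node_def indicator_def)
    then show "(\<integral>\<^sup>+y\<in>R. (if t \<le> k \<and> code k x = code k y then 1 else 0) \<partial>N)
      = (if t \<le> k then emeasure N (R \<inter> node k x) else 0)"
      by (simp add: nn_integral_cmult_indicator)
  qed
  also have "\<dots> \<le> c"
    unfolding suminf_eq_SUP
  proof (rule SUP_least)
    fix n
    have "(\<Sum>k<n. if t \<le> k then emeasure N (R \<inter> node k x) else 0) = (\<Sum>k=t..<n. emeasure N (R \<inter> node k x))"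
      by (rule sum.mono_neutral_cong_right) auto
    also have "\<dots> \<le> c" using assms by (auto simp: heavy_def not_less)
    finally show "(\<Sum>k<n. if t \<le> k then emeasure N (R \<inter> node k x) else 0) \<le> c" .
  qed
  finally show ?thesis .
qed

text \<open>Schur's test for the kernel restricted to \<open>R\<close>, weighted by its column sums.
  The row sums are then those of the composed kernel, at most 20 times the logarithmic potential of
  \<open>N\<close> on \<open>R\<close>, and lightness bounds that potential by
  \<open>c\<close>.\<close>

lemma pot_cell_estimate:
  assumes c: "0 < c" "c < \<infinity>" and light: "\<not> heavy c t R"
    and [measurable]: "R \<in> sets M" "g \<in> borel_measurable M"
  shows "(\<integral>\<^sup>+x\<in>R. (pot t (\<lambda>y. g y * indicator R y) x)\<^sup>2 \<partial>N) \<le> 30 * c * (\<integral>\<^sup>+y\<in>R. (g y)\<^sup>2 \<partial>M)"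
proof -
  define K where "K x y = kern t x y * indicator R x * indicator R y" for x y
  \<comment> \<open>The summand \<open>c * 2 ^ t\<close> makes the weight positive. It adds only
    \<open>10 * c\<close> to the row sums, because \<open>kern t x\<close> has integral at most
    \<open>10 / 2 ^ t\<close>.\<close>
  define h where "h y = c * 2 ^ t + (\<integral>\<^sup>+x. K x y \<partial>N)" for y
  interpret pair_sigma_finite N M ..
  interpret P: pair_sigma_finite M N ..
  have Km[measurable]: "(\<lambda>(x, y). K x y) \<in> borel_measurable (N \<Otimes>\<^sub>M M)"
    unfolding K_def by measurable
  have [measurable]: "K x \<in> borel_measurable M" for x
    unfolding K_def by measurable
  have [measurable]: "(\<lambda>x. K x y) \<in> borel_measurable N" for y
    unfolding K_def by measurable
  have Ks[measurable]: "(\<lambda>(y, x). K x y) \<in> borel_measurable (M \<Otimes>\<^sub>M N)"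
    using Km by (subst measurable_pair_swap_iff) (simp add: case_prod_beta')
  have hm[measurable]: "h \<in> borel_measurable M"
    unfolding h_def by measurable
  have "(\<integral>\<^sup>+x. (\<integral>\<^sup>+y. K x y * g y \<partial>M)\<^sup>2 \<partial>N) \<le> (30 * c) * (\<integral>\<^sup>+y. (g y * indicator R y)\<^sup>2 \<partial>M)"
  proof -
    have "(\<integral>\<^sup>+x. (\<integral>\<^sup>+y. K x y * (g y * indicator R y) \<partial>M)\<^sup>2 \<partial>N) \<le> (30 * c) * (\<integral>\<^sup>+y. (g y * indicator R y)\<^sup>2 \<partial>M)"
    proof (rule Schur_test[where h = h])
      show "sigma_finite_measure M" "sigma_finite_measure N" by unfold_locales
      show "0 < h y" for y using c unfolding h_def by (intro add_pos_nonneg) (simp_all add: ennreal_zero_less_mult_iff two_power_ennreal)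
      show "30 * c < \<infinity>" using c by (simp add: ennreal_mult_less_top)
      show "(\<integral>\<^sup>+x. K x y \<partial>N) \<le> h y" for y by (simp add: h_def)
      fix x
      show "(\<integral>\<^sup>+y. K x y * h y \<partial>M) \<le> 30 * c"
      proof (cases "x \<in> R")
        case False
        then show ?thesis by (simp add: K_def)
      next
        case True
        have "(\<integral>\<^sup>+y. K x y * h y \<partial>M) = (\<integral>\<^sup>+y. c * 2 ^ t * K x y + (\<integral>\<^sup>+x'. K x y * K x' y \<partial>N) \<partial>M)"
          by (intro nn_integral_cong) (simp add: h_def distrib_left nn_integral_cmult mult.commute[of "c * 2 ^ t"])
        also have "\<dots> = c * 2 ^ t * (\<integral>\<^sup>+y. K x y \<partial>M) + (\<integral>\<^sup>+y. (\<integral>\<^sup>+x'. K x y * K x' y \<partial>N) \<partial>M)"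
          by (simp add: nn_integral_add nn_integral_cmult)
        also have "(\<integral>\<^sup>+y. (\<integral>\<^sup>+x'. K x y * K x' y \<partial>N) \<partial>M) = (\<integral>\<^sup>+x'. (\<integral>\<^sup>+y. K x y * K x' y \<partial>M) \<partial>N)"
          by (rule Fubini') measurable
        also have "\<dots> \<le> (\<integral>\<^sup>+x'. 20 * (overlap t x x' * indicator R x') \<partial>N)"
        proof (rule nn_integral_mono)
          fix x'
          have "(\<integral>\<^sup>+y. K x y * K x' y \<partial>M) \<le> (\<integral>\<^sup>+y. kern t x y * kern t x' y * indicator R x' \<partial>M)"
            by (intro nn_integral_mono) (auto simp: K_def indicator_def)
          also have "\<dots> = (\<integral>\<^sup>+y. kern t x y * kern t x' y \<partial>M) * indicator R x'"
            by (rule nn_integral_multc) measurable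
          also have "\<dots> \<le> 20 * overlap t x x' * indicator R x'"
            by (intro mult_right_mono kern_product_le) auto
          finally show "(\<integral>\<^sup>+y. K x y * K x' y \<partial>M) \<le> 20 * (overlap t x x' * indicator R x')"
            by (simp add: mult.assoc)
        qed
        also have "\<dots> = 20 * (\<integral>\<^sup>+x'\<in>R. overlap t x x' \<partial>N)"
          by (rule nn_integral_cmult) measurable
        also have "\<dots> \<le> 20 * c"
          by (intro mult_left_mono overlap_integral_le light True) auto
        also have "(\<integral>\<^sup>+y. K x y \<partial>M) \<le> (\<integral>\<^sup>+y. kern t x y \<partial>M)"
          by (intro nn_integral_mono) (auto simp: K_def indicator_def)
        also have "\<dots> \<le> 10 * ennreal (1 / 2 ^ t)" by (rule kern_integral_le)
        also have "c * 2 ^ t * (10 * ennreal (1 / 2 ^ t)) = 10 * c"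
        proof -
          have "(2::ennreal) ^ t * ennreal (1 / 2 ^ t) = 1"
            by (simp add: two_power_ennreal flip: ennreal_mult)
          then have "10 * c * ((2::ennreal) ^ t * ennreal (1 / 2 ^ t)) = 10 * c" by simp
          then show ?thesis by (simp add: ac_simps)
        qed
        also have "10 * c + 20 * c = 30 * c" by (simp flip: distrib_right)
        finally show ?thesis by (simp add: add_mono mult_left_mono)
      qed
    qed measurable
    moreover have "K x y * (g y * indicator R y) = K x y * g y" for x y
      by (auto simp: K_def indicator_def)
    ultimately show ?thesis by simp
  qed
  moreover have "(\<integral>\<^sup>+y. K x y * g y \<partial>M)\<^sup>2 = (pot t (\<lambda>y. g y * indicator R y) x)\<^sup>2 * indicator R x" for x
  proof -
    have "(\<integral>\<^sup>+y. K x y * g y \<partial>M) = (\<integral>\<^sup>+y. indicator R x * (kern t x y * (g y * indicator R y)) \<partial>M)"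
      by (intro nn_integral_cong) (simp add: K_def ac_simps)
    also have "\<dots> = indicator R x * pot t (\<lambda>y. g y * indicator R y) x"
      by (simp add: pot_eq nn_integral_cmult)
    finally show ?thesis by (auto simp: indicator_def)
  qed
  moreover have "(g y * indicator R y)\<^sup>2 = (g y)\<^sup>2 * indicator R y" for y
    by (auto simp: indicator_def)
  ultimately show ?thesis by simp
qed

lemma sum_two_power_less: "(\<Sum>k<e. (2::ennreal) ^ k) \<le> 2 ^ e"
proof (induction e)
  case (Suc e)
  then have "(\<Sum>k<Suc e. (2::ennreal) ^ k) \<le> 2 ^ e + 2 ^ e" by (simp add: add_mono)
  then show ?case by (simp add: mult_2)
qed simp

text \<open>A node of level at least \<open>e\<close> around a point outside \<open>H\<close> does
  not meet \<open>H\<close>. Hence the values of \<open>g\<close> on \<open>H\<close> enter only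
  through the levels below \<open>e\<close>, whose factors add up to at most
  \<open>2 ^ e\<close>.\<close>

lemma pot_le_split:
  assumes H: "t < e" "H = {} \<or> (\<exists>z\<in>node t x0. H = node e z)"
    and R: "R = node t x0 - H" and x: "x \<in> R"
    and [measurable]: "g \<in> borel_measurable M"
  shows "pot t g x \<le> pot t (\<lambda>y. g y * indicator R y) x + 2 ^ e * (\<integral>\<^sup>+y\<in>H. g y \<partial>M)"
proof -
  have [measurable]: "H \<in> sets M" "R \<in> sets M" using H R by auto
  define G where "G = (\<integral>\<^sup>+y\<in>H. g y \<partial>M)"
  have term_le: "(if t \<le> k then 2 ^ k * (\<integral>\<^sup>+y\<in>node k x. g y \<partial>M) else 0)
     \<le> (if t \<le> k then 2 ^ k * (\<integral>\<^sup>+y\<in>node k x. g y * indicator R y \<partial>M) else 0) + (if k < e then 2 ^ k else 0) * G"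
    (is "?a \<le> ?b + ?d") for k
  proof (cases "t \<le> k")
    case True
    have sub: "node k x \<subseteq> R \<union> H"
    proof -
      have "x \<in> node t x0" using x R by auto
      then have "node k x \<subseteq> node t x0" using node_mono[OF True, of x] node_eq by auto
      then show ?thesis using R by auto
    qed
    have "(\<integral>\<^sup>+y\<in>node k x. g y \<partial>M) = (\<integral>\<^sup>+y\<in>node k x. g y * indicator R y \<partial>M) + (\<integral>\<^sup>+y\<in>node k x \<inter> H. g y \<partial>M)"
      using sub R by (subst nn_integral_add[symmetric]) (auto intro!: nn_integral_cong simp: indicator_def)
    also have "(\<integral>\<^sup>+y\<in>node k x \<inter> H. g y \<partial>M) \<le> (if k < e then G else 0)"
    proof (cases "k < e")
      case True
      then show ?thesis unfolding G_def by (auto intro!: nn_integral_mono simp: indicator_def)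
    next
      case False
      then have "node k x \<inter> H = {}"
      proof (cases "H = {}")
        case nonempty: False
        then obtain z where "H = node e z" using H by auto
        then show ?thesis using node_nested[of e k x z] self_in_node[of x k] False x R by fastforce
      qed simp
      then show ?thesis by simp
    qed
    finally have "(\<integral>\<^sup>+y\<in>node k x. g y \<partial>M) \<le> (\<integral>\<^sup>+y\<in>node k x. g y * indicator R y \<partial>M) + (if k < e then G else 0)"
      by (simp add: add_mono)
    then have "2 ^ k * (\<integral>\<^sup>+y\<in>node k x. g y \<partial>M) \<le> 2 ^ k * ((\<integral>\<^sup>+y\<in>node k x. g y * indicator R y \<partial>M) + (if k < e then G else 0))"
      by (rule mult_left_mono) simp
    then show ?thesis using True by (simp add: distrib_left split: if_splits)
  qed simp
  have "pot t g x \<le> (\<Sum>k. (if t \<le> k then 2 ^ k * (\<integral>\<^sup>+y\<in>node k x. g y * indicator R y \<partial>M) else 0) + (if k < e then 2 ^ k else 0) * G)"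
    unfolding pot_def by (intro suminf_le allI term_le) auto
  also have "\<dots> = pot t (\<lambda>y. g y * indicator R y) x + (\<Sum>k. (if k < e then 2 ^ k else 0) * G)"
    unfolding pot_def by (rule suminf_add[symmetric]) auto
  also have "(\<Sum>k. (if k < e then 2 ^ k else 0) * G) = (\<Sum>k<e. 2 ^ k) * G"
    by (subst suminf_finite[of "{..<e}"]) (auto simp: sum_distrib_right)
  also have "\<dots> \<le> 2 ^ e * G" by (intro mult_right_mono sum_two_power_less) simp
  finally show ?thesis by (simp add: G_def add_mono)
qed

text \<open>Instead of subtracting in \<open>ennreal\<close>, the larger number is written as the
  smaller one plus a remainder.\<close>

lemma square_sum_le_ennreal: "((a::ennreal) + b)\<^sup>2 \<le> 2 * a\<^sup>2 + 2 * b\<^sup>2"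
proof -
  have "2 * (a * b) \<le> a\<^sup>2 + b\<^sup>2" 
  proof (cases "a \<le> b")
    case True
    then obtain d where "b = a + d" by (metis le_iff_add)
    then have "a\<^sup>2 + b\<^sup>2 = 2 * (a * b) + d\<^sup>2"
      by (simp add: power2_eq_square distrib_left distrib_right mult_2 mult_2_right ac_simps)
    then show ?thesis by simp
  next
    case False
    then obtain d where "a = b + d" by (metis le_iff_add linear)
    then have "a\<^sup>2 + b\<^sup>2 = 2 * (a * b) + d\<^sup>2"
      by (simp add: power2_eq_square distrib_left distrib_right mult_2 mult_2_right ac_simps)
    then show ?thesis by simp
  qed
  then have "a\<^sup>2 + b\<^sup>2 + 2 * (a * b) \<le> a\<^sup>2 + b\<^sup>2 + (a\<^sup>2 + b\<^sup>2)" by (rule add_left_mono)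
  also have "\<dots> = 2 * a\<^sup>2 + 2 * b\<^sup>2" by (simp add: mult_2 mult_2_right ac_simps)
  also have "a\<^sup>2 + b\<^sup>2 + 2 * (a * b) = (a + b)\<^sup>2"
    by (simp add: power2_eq_square distrib_left distrib_right mult_2 mult_2_right ac_simps)
  finally show ?thesis .
qed

text \<open>The part of the potential that comes from the cell itself is left to Schur's test. The
  part from the hole is bounded by a constant on the cell, so its square is multiplied by the
  \<open>N\<close>-mass of the cell only.\<close>

lemma cell_estimate:
  assumes H: "t < e" "H = {} \<or> (\<exists>z\<in>node t x0. H = node e z)"
    and R: "R = node t x0 - H" and c: "0 < c" "c < \<infinity>" and light: "\<not> heavy c t R"
    and [measurable]: "g \<in> borel_measurable M"
    and U: "AE x in N. x \<in> R \<longrightarrow> U x \<le> pot t g x"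
  shows "(\<integral>\<^sup>+x\<in>R. (U x)\<^sup>2 \<partial>N) \<le> 60 * c * (\<integral>\<^sup>+y\<in>R. (g y)\<^sup>2 \<partial>M) + 2 * c * 4 ^ e * (\<integral>\<^sup>+y\<in>H. g y \<partial>M)\<^sup>2"
proof -
  have [measurable]: "H \<in> sets M" "R \<in> sets M" using H R by auto
  define G where "G = (\<integral>\<^sup>+y\<in>H. g y \<partial>M)"
  let ?p = "pot t (\<lambda>y. g y * indicator R y)"
  have [measurable]: "?p \<in> borel_measurable N"
  proof -
    have "(\<lambda>x. \<integral>\<^sup>+y. kern t x y * (g y * indicator R y) \<partial>M) \<in> borel_measurable N"
      by measurable
    moreover have "?p = (\<lambda>x. \<integral>\<^sup>+y. kern t x y * (g y * indicator R y) \<partial>M)"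
      by (rule ext, rule pot_eq) measurable
    ultimately show ?thesis by simp
  qed
  have "(\<integral>\<^sup>+x\<in>R. (U x)\<^sup>2 \<partial>N) \<le> (\<integral>\<^sup>+x. 2 * ((?p x)\<^sup>2 * indicator R x) + 2 * 4 ^ e * G\<^sup>2 * indicator R x \<partial>N)"
  proof (rule nn_integral_mono_AE, use U in eventually_elim)
    fix x assume U: "x \<in> R \<longrightarrow> U x \<le> pot t g x"
    show "(U x)\<^sup>2 * indicator R x \<le> 2 * ((?p x)\<^sup>2 * indicator R x) + 2 * 4 ^ e * G\<^sup>2 * indicator R x"
    proof (cases "x \<in> R")
      case True
      have "(U x)\<^sup>2 \<le> (?p x + 2 ^ e * G)\<^sup>2"
        using U True pot_le_split[OF H R True, of g] by (intro power_mono) (auto simp: G_def)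
      also have "\<dots> \<le> 2 * (?p x)\<^sup>2 + 2 * (2 ^ e * G)\<^sup>2" by (rule square_sum_le_ennreal)
      also have "(2 ^ e * G)\<^sup>2 = 4 ^ e * G\<^sup>2"
      proof -
        have "(2 ^ e)\<^sup>2 = (4 ^ e :: ennreal)" by (simp add: power_mult[symmetric] mult.commute[of e] power_mult)
        then show ?thesis by (simp add: power_mult_distrib)
      qed
      finally show ?thesis using True by (simp add: mult.assoc)
    qed simp
  qed
  also have "\<dots> = 2 * (\<integral>\<^sup>+x\<in>R. (?p x)\<^sup>2 \<partial>N) + 2 * 4 ^ e * G\<^sup>2 * emeasure N R"
    by (simp add: nn_integral_add nn_integral_cmult nn_integral_cmult_indicator)
  also have "\<dots> \<le> 2 * (30 * c * (\<integral>\<^sup>+y\<in>R. (g y)\<^sup>2 \<partial>M)) + 2 * 4 ^ e * G\<^sup>2 * c"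
  proof (intro add_mono mult_left_mono pot_cell_estimate c light)
    \<comment> \<open>Lightness tested with the single level \<open>t\<close>, where the node of any
      point of \<open>R\<close> contains all of \<open>R\<close>.\<close>
    show "emeasure N R \<le> c"
    proof (cases "R = {}")
      case False
      then obtain x where x: "x \<in> R" by auto
      then have "x \<in> node t x0" using R by auto
      then have "R \<inter> node t x = R" using R node_eq by auto
      moreover have "(\<Sum>k=t..<Suc t. emeasure N (R \<inter> node k x)) \<le> c"
        using light x unfolding heavy_def by (meson not_le)
      ultimately show ?thesis by simp
    qed simp
  qed auto
  also have "\<dots> = 60 * c * (\<integral>\<^sup>+y\<in>R. (g y)\<^sup>2 \<partial>M) + 2 * c * 4 ^ e * G\<^sup>2"
    by (simp add: ac_simps)
  finally show ?thesis by (simp add: G_def)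
qed

end

subsection \<open>Packing numbers and the choice of constraints\<close>

text \<open>With two or more positive values the subtracted units already amount to 2; with a single
  one the strict bound by \<open>j\<close> gives the same. Subtraction truncates, so vanishing
  values contribute nothing.\<close>

lemma sum_double_minus_one_le:
  fixes a :: "'a \<Rightarrow> nat"
  assumes "finite Z" "\<And>z. z \<in> Z \<Longrightarrow> a z < j" "sum a Z \<le> j"
  shows "(\<Sum>z\<in>Z. 2 * a z - 1) \<le> 2 * j - 2"
proof -
  define P where "P = {z\<in>Z. a z > 0}"
  have P: "finite P" "P \<subseteq> Z" using assms(1) by (auto simp: P_def)
  have eq: "(\<Sum>z\<in>Z. 2 * a z - 1) = (\<Sum>z\<in>P. 2 * a z - 1)"
    using assms(1) by (intro sum.mono_neutral_right) (auto simp: P_def)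
  have "(\<Sum>z\<in>P. 2 * a z - 1) + card P = (\<Sum>z\<in>P. (2 * a z - 1) + 1)"
    by (subst sum.distrib) simp
  also have "\<dots> = (\<Sum>z\<in>P. 2 * a z)" by (rule sum.cong) (auto simp: P_def)
  also have "\<dots> \<le> 2 * j"
  proof -
    have "sum a P \<le> sum a Z" using assms(1) P by (intro sum_mono2) auto
    then show ?thesis using assms(3) by (simp flip: sum_distrib_left)
  qed
  finally have le: "(\<Sum>z\<in>P. 2 * a z - 1) + card P \<le> 2 * j" .
  consider "card P = 0" | "card P = 1" | "card P \<ge> 2" by linarith
  then show ?thesis
  proof cases
    case 1
    then have "P = {}" using P by simp
    then show ?thesis unfolding eq by simp
  next
    case 2
    then obtain z where "P = {z}" by (metis card_1_singletonE)
    moreover have "a z < j" using calculation P assms(2) by auto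
    ultimately show ?thesis unfolding eq by simp
  next
    case 3
    then show ?thesis using le unfolding eq by simp
  qed
qed

context dyadic_tree
begin

definition cell :: "nat \<Rightarrow> nat \<Rightarrow> 'a \<Rightarrow> 'a set \<Rightarrow> 'a set \<Rightarrow> bool" where
  "cell t e x H R \<longleftrightarrow> t < e \<and> (H = {} \<or> (\<exists>z\<in>node t x. H = node e z)) \<and> R = node t x - H"

definition heavy_cell :: "ennreal \<Rightarrow> 'a set \<Rightarrow> bool" where
  "heavy_cell c R \<longleftrightarrow> (\<exists>t e x H. cell t e x H R \<and> heavy c t R)"

definition packing :: "ennreal \<Rightarrow> 'a set \<Rightarrow> 'a set set \<Rightarrow> bool" where
  "packing c X \<C> \<longleftrightarrow> finite \<C> \<and> disjoint \<C> \<and> (\<forall>R\<in>\<C>. heavy_cell c R \<and> R \<subseteq> X)"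

lemma heavy_cell_nonempty: "heavy_cell c R \<Longrightarrow> R \<noteq> {}"
  by (auto simp: heavy_cell_def heavy_def)

lemma node_finite: "emeasure M (node k x) < \<infinity>"
  by (rule le_less_trans[OF node_upper]) (simp add: ennreal_mult_less_top)

lemma node_pos: "0 < emeasure M (node k x)"
  by (rule less_le_trans[OF _ node_lower]) simp

end

locale bounded_packing = dyadic_tree +
  fixes c :: ennreal and K :: nat
  assumes c_pos: "0 < c" and c_finite: "c < \<infinity>"
    and packing_bound: "\<And>\<C>. packing c UNIV \<C> \<Longrightarrow> card \<C> \<le> K"
begin

text \<open>The packing number of \<open>X\<close>. Being an integer and superadditive over disjoint
  sets, it can drive an induction on nodes, which the logarithmic potential itself cannot.\<close>

definition nn :: "'a set \<Rightarrow> nat" where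
  "nn X = Max {card \<C> |\<C>. packing c X \<C>}"

lemma packing_cards: "finite {card \<C> |\<C>. packing c X \<C>}" "{card \<C> |\<C>. packing c X \<C>} \<noteq> {}"
proof -
  have "{card \<C> |\<C>. packing c X \<C>} \<subseteq> {..K}"
    using packing_bound by (fastforce simp: packing_def)
  then show "finite {card \<C> |\<C>. packing c X \<C>}" by (rule finite_subset) simp
  have "packing c X {}" by (simp add: packing_def)
  then show "{card \<C> |\<C>. packing c X \<C>} \<noteq> {}" by blast
qed

lemma nn_ge: "packing c X \<C> \<Longrightarrow> card \<C> \<le> nn X"
  unfolding nn_def using packing_cards by (intro Max_ge) auto

lemma nn_witness: obtains \<C> where "packing c X \<C>" "card \<C> = nn X"
  using Max_in[OF packing_cards, of X] unfolding nn_def by auto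

lemma nn_le_K: "nn X \<le> K"
proof -
  obtain \<C> where "packing c X \<C>" "card \<C> = nn X" by (rule nn_witness)
  moreover have "packing c UNIV \<C>" using calculation(1) by (auto simp: packing_def)
  ultimately show ?thesis using packing_bound by metis
qed

text \<open>Packings inside disjoint sets have no common member because heavy cells are nonempty, so
  the union of the two packings counts both.\<close>

lemma nn_superadditive:
  assumes "A \<inter> B = {}" "A \<subseteq> X" "B \<subseteq> X"
  shows "nn A + nn B \<le> nn X"
proof -
  obtain \<C> where C: "packing c A \<C>" "card \<C> = nn A" by (rule nn_witness)
  obtain \<D> where D: "packing c B \<D>" "card \<D> = nn B" by (rule nn_witness)
  have sub: "R \<subseteq> A \<and> heavy_cell c R" if "R \<in> \<C>" for R
    using C(1) that by (simp add: packing_def)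
  have sub': "R \<subseteq> B \<and> heavy_cell c R" if "R \<in> \<D>" for R
    using D(1) that by (simp add: packing_def)
  have AB: "P \<inter> R = {}" if "P \<in> \<C>" "R \<in> \<D>" for P R
    using sub[OF that(1)] sub'[OF that(2)] assms(1) by blast
  have disj: "\<C> \<inter> \<D> = {}"
  proof (rule equals0I)
    fix R assume "R \<in> \<C> \<inter> \<D>"
    then show False using AB[of R R] sub[of R] heavy_cell_nonempty[of c R] by simp
  qed
  have "disjoint (\<C> \<union> \<D>)"
  proof (rule disjointI)
    fix P R assume PR: "P \<in> \<C> \<union> \<D>" "R \<in> \<C> \<union> \<D>" "P \<noteq> R"
    have "disjoint \<C>" "disjoint \<D>" using C D by (simp_all add: packing_def)
    then show "P \<inter> R = {}"
      using PR AB[of P R] AB[of R P] disjointD[of \<C> P R] disjointD[of \<D> P R] by (auto simp: Int_commute)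
  qed
  moreover have "R \<subseteq> X \<and> heavy_cell c R" if "R \<in> \<C> \<union> \<D>" for R
    using that sub[of R] sub'[of R] assms(2,3) by auto
  ultimately have "packing c X (\<C> \<union> \<D>)"
    using C(1) D(1) by (simp add: packing_def)
  then have "card (\<C> \<union> \<D>) \<le> nn X" by (rule nn_ge)
  then show ?thesis using C D disj by (simp add: card_Un_disjoint packing_def)
qed

lemma nn_mono: "A \<subseteq> X \<Longrightarrow> nn A \<le> nn X"
  using nn_superadditive[of A "{}" X] by simp

lemma nn_sum_le:
  assumes "finite Z" "disjoint_family_on A Z" "\<And>z. z \<in> Z \<Longrightarrow> A z \<subseteq> X"
  shows "(\<Sum>z\<in>Z. nn (A z)) \<le> nn X"
proof -
  have "(\<Sum>z\<in>Z. nn (A z)) \<le> nn (\<Union>z\<in>Z. A z)"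
    using assms(1,2)
  proof (induction Z rule: finite_induct)
    case (insert z Z)
    have "nn (A z) + nn (\<Union>z\<in>Z. A z) \<le> nn (\<Union>z\<in>insert z Z. A z)"
      using insert by (intro nn_superadditive) (auto simp: disjoint_family_on_def)
    moreover have "disjoint_family_on A Z"
      using insert by (auto simp: disjoint_family_on_def)
    ultimately show ?case using insert by simp
  qed simp
  also have "\<dots> \<le> nn X" using assms by (intro nn_mono) auto
  finally show ?thesis .
qed

lemma nn_pos:
  assumes "cell t e x H R" "heavy c t R"
  shows "0 < nn R"
proof -
  have "packing c R {R}" using assms by (auto simp: packing_def heavy_cell_def)
  from nn_ge[OF this] show ?thesis by simp
qed

text \<open>A heavy cell alone is a packing, so packing number 0 implies lightness. The factor
  \<open>4 ^ e\<close> is replaced by \<open>5 / emeasure M H\<close>, which turns the contribution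
  of the hole into the quotient that adds up over nodes.\<close>

lemma cell_estimate':
  assumes cell: "cell t e x H R" and 0: "nn R = 0"
    and [measurable]: "g \<in> borel_measurable M"
    and U: "AE y in N. y \<in> node t x \<longrightarrow> U y \<le> pot t g y"
  shows "(\<integral>\<^sup>+y\<in>R. (U y)\<^sup>2 \<partial>N) \<le> 60 * c * (\<integral>\<^sup>+y\<in>R. (g y)\<^sup>2 \<partial>M)
    + 10 * c * ((\<integral>\<^sup>+y\<in>H. g y \<partial>M)\<^sup>2 / emeasure M H)"
proof -
  have "\<not> heavy c t R" using nn_pos[OF cell] 0 by auto
  moreover have "AE y in N. y \<in> R \<longrightarrow> U y \<le> pot t g y"
    using U by eventually_elim (use cell in \<open>auto simp: cell_def\<close>)
  ultimately have "(\<integral>\<^sup>+y\<in>R. (U y)\<^sup>2 \<partial>N) \<le> 60 * c * (\<integral>\<^sup>+y\<in>R. (g y)\<^sup>2 \<partial>M) + 2 * c * 4 ^ e * (\<integral>\<^sup>+y\<in>H. g y \<partial>M)\<^sup>2"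
    using cell c_pos c_finite unfolding cell_def by (intro cell_estimate) auto
  also have "2 * c * 4 ^ e * (\<integral>\<^sup>+y\<in>H. g y \<partial>M)\<^sup>2 \<le> 10 * c * ((\<integral>\<^sup>+y\<in>H. g y \<partial>M)\<^sup>2 / emeasure M H)"
  proof (cases "H = {}")
    case False
    then obtain z where H: "H = node e z" using cell by (auto simp: cell_def)
    have fin: "emeasure M H \<noteq> \<infinity>" "emeasure M H \<noteq> 0" using node_finite[of e z] node_pos[of e z] H by auto
    have "4 ^ e * emeasure M H \<le> 4 ^ e * (5 * ennreal (1 / 4 ^ e))"
      unfolding H by (intro mult_left_mono node_upper) simp
    also have "\<dots> = 5"
    proof -
      have "(4::ennreal) ^ e = ennreal (4 ^ e)" by (simp flip: ennreal_power)
      then have "(4::ennreal) ^ e * ennreal (1 / 4 ^ e) = 1" by (simp flip: ennreal_mult)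
      then have "5 * ((4::ennreal) ^ e * ennreal (1 / 4 ^ e)) = 5" by simp
      then show ?thesis by (simp add: ac_simps)
    qed
    finally have le: "4 ^ e * emeasure M H \<le> 5" .
    have "4 ^ e * G \<le> 5 * (G / emeasure M H)" for G
    proof -
      have "4 ^ e * G = (4 ^ e * G) * emeasure M H / emeasure M H"
        using fin by (intro mult_divide_eq_ennreal[symmetric]) auto
      also have "\<dots> = (4 ^ e * emeasure M H) * G / emeasure M H" by (simp add: ac_simps)
      also have "\<dots> \<le> 5 * G / emeasure M H"
        using le by (intro divide_right_mono_ennreal mult_right_mono) auto
      finally show ?thesis by (simp add: ennreal_times_divide)
    qed
    then have "2 * c * (4 ^ e * (\<integral>\<^sup>+y\<in>H. g y \<partial>M)\<^sup>2) \<le> 2 * c * (5 * ((\<integral>\<^sup>+y\<in>H. g y \<partial>M)\<^sup>2 / emeasure M H))"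
      by (intro mult_left_mono) auto
    then show ?thesis by (simp add: ac_simps)
  qed simp
  finally show ?thesis by (simp add: add_mono)
qed

text \<open>The second term on the left makes the estimate pass from the children of a node up a chain of
  nodes: by the Cauchy--Schwarz inequality it is superadditive over disjoint nodes, and it absorbs the
  contribution of the gradient inside the smaller node to the potential outside of it.\<close>

definition good :: "nat \<Rightarrow> 'a \<Rightarrow> (nat \<times> 'a) set \<Rightarrow> bool" where
  "good t x F \<longleftrightarrow> (\<forall>U g. U \<in> borel_measurable M \<longrightarrow> g \<in> borel_measurable M \<longrightarrow>
     (\<forall>(k, z)\<in>F. AE y in N. y \<in> node k z \<longrightarrow> U y \<le> pot k g y) \<longrightarrow>
     (\<integral>\<^sup>+y\<in>node t x. (U y)\<^sup>2 \<partial>N) + 20 * c * ((\<integral>\<^sup>+y\<in>node t x. g y \<partial>M)\<^sup>2 / emeasure M (node t x))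
       \<le> 100 * c * (\<integral>\<^sup>+y\<in>node t x. (g y)\<^sup>2 \<partial>M))"

lemma square_quotient_le:
  assumes [measurable]: "g \<in> borel_measurable M"
  shows "(\<integral>\<^sup>+y\<in>node t x. g y \<partial>M)\<^sup>2 / emeasure M (node t x) \<le> (\<integral>\<^sup>+y\<in>node t x. (g y)\<^sup>2 \<partial>M)"
proof -
  have "(\<integral>\<^sup>+y\<in>node t x. g y \<partial>M)\<^sup>2 / emeasure M (node t x)
     \<le> emeasure M (node t x) * (\<integral>\<^sup>+y\<in>node t x. (g y)\<^sup>2 \<partial>M) / emeasure M (node t x)"
    by (intro divide_right_mono_ennreal square_integral_le node_finite) auto
  also have "\<dots> = (\<integral>\<^sup>+y\<in>node t x. (g y)\<^sup>2 \<partial>M)"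
    using node_finite[of t x] node_pos[of t x]
    by (subst mult.commute) (simp add: mult_divide_eq_ennreal less_top)
  finally show ?thesis .
qed

text \<open>The constraints of the children are united, and none is added for the node itself. A
  child of packing number \<open>a\<close> brings at most \<open>1 + 17 * (2 * a - 1)\<close>; since
  every child has a smaller packing number than \<open>j\<close>, the last terms sum to at most
  \<open>17 * (2 * j - 2)\<close>, which leaves room for one further constraint for each of the 17
  children.\<close>

lemma good_Suc:
  assumes j: "nn (node e y) = j" and less: "\<And>z. z \<in> node e y \<Longrightarrow> nn (node (Suc e) z) < j"
    and IH: "\<And>z. z \<in> node e y \<Longrightarrow>
      \<exists>F. finite F \<and> card F \<le> 1 + 17 * (2 * nn (node (Suc e) z) - 1) \<and> good (Suc e) z F"
  shows "\<exists>F. finite F \<and> card F \<le> 17 * (2 * j - 1) \<and> good e y F"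
proof -
  obtain S where S: "finite S" "card S \<le> 17" "\<And>z. code e z = code e y \<Longrightarrow> code (Suc e) z \<in> S"
    using children by blast
  \<comment> \<open>Nodes are indexed by points, so one point is selected in each child.\<close>
  define rep where "rep s = (SOME z. z \<in> node e y \<and> code (Suc e) z = s)" for s
  define S' where "S' = code (Suc e) ` node e y"
  have S': "S' \<subseteq> S" using S(3) by (auto simp: S'_def node_def)
  have rep: "rep s \<in> node e y" "code (Suc e) (rep s) = s" if "s \<in> S'" for s
    using someI_ex[of "\<lambda>z. z \<in> node e y \<and> code (Suc e) z = s"] that by (auto simp: rep_def S'_def)
  define Z where "Z = rep ` S'"
  have finS': "finite S'" using S' S(1) by (rule finite_subset)
  have Z: "finite Z" "card Z \<le> 17" "Z \<subseteq> node e y"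
    using card_mono[OF S(1) S'] card_image_le[OF finS', of rep] S(2) finS' rep by (auto simp: Z_def)
  have disj: "disjoint_family_on (node (Suc e)) Z"
    using rep by (auto simp: disjoint_family_on_def Z_def node_def)
  have Un: "(\<Union>z\<in>Z. node (Suc e) z) = node e y"
  proof
    show "(\<Union>z\<in>Z. node (Suc e) z) \<subseteq> node e y"
      using Z(3) node_mono[of e "Suc e"] node_eq by fastforce
    show "node e y \<subseteq> (\<Union>z\<in>Z. node (Suc e) z)"
    proof
      fix z assume "z \<in> node e y"
      then have "code (Suc e) z \<in> S'" by (simp add: S'_def)
      then show "z \<in> (\<Union>z\<in>Z. node (Suc e) z)" using rep(2) by (auto simp: Z_def node_def)
    qed
  qed
  define F where "F z = (SOME F. finite F \<and> card F \<le> 1 + 17 * (2 * nn (node (Suc e) z) - 1) \<and> good (Suc e) z F)" for z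
  have F: "finite (F z)" "card (F z) \<le> 1 + 17 * (2 * nn (node (Suc e) z) - 1)" "good (Suc e) z (F z)" if "z \<in> Z" for z
    using someI_ex[OF IH, of z] that Z(3) by (auto simp: F_def)
  have "card (\<Union>z\<in>Z. F z) \<le> (\<Sum>z\<in>Z. card (F z))" by (rule card_UN_le) (rule Z)
  also have "\<dots> \<le> (\<Sum>z\<in>Z. 1 + 17 * (2 * nn (node (Suc e) z) - 1))" by (intro sum_mono F)
  also have "\<dots> = card Z + 17 * (\<Sum>z\<in>Z. 2 * nn (node (Suc e) z) - 1)"
    by (simp only: sum.distrib sum_distrib_left) simp
  also have "\<dots> \<le> 17 + 17 * (2 * j - 2)"
  proof (intro add_mono mult_left_mono sum_double_minus_one_le)
    show "(\<Sum>z\<in>Z. nn (node (Suc e) z)) \<le> j"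
      using Un Z(1) unfolding j[symmetric] by (intro nn_sum_le disj) auto
  qed (use Z less in auto)
  also have "\<dots> = 17 * (2 * j - 1)" using less[of y] by simp
  finally have card: "card (\<Union>z\<in>Z. F z) \<le> 17 * (2 * j - 1)" .
  have "good e y (\<Union>z\<in>Z. F z)"
    unfolding good_def
  proof (intro allI impI)
    fix U g :: "'a \<Rightarrow> ennreal"
    assume [measurable]: "U \<in> borel_measurable M" "g \<in> borel_measurable M"
      and *: "\<forall>(k, z)\<in>(\<Union>z\<in>Z. F z). AE y in N. y \<in> node k z \<longrightarrow> U y \<le> pot k g y"
    have [measurable]: "U \<in> borel_measurable N" by simp
    have ind: "indicator (node e y) w = (\<Sum>z\<in>Z. indicator (node (Suc e) z) w :: ennreal)" for w
      using indicator_UN_disjoint[OF Z(1) disj, of w] by (simp add: Un)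
    have split: "(\<integral>\<^sup>+w\<in>node e y. f w \<partial>L) = (\<Sum>z\<in>Z. \<integral>\<^sup>+w\<in>node (Suc e) z. f w \<partial>L)"
      if "f \<in> borel_measurable M" "L = M \<or> L = N" for f L
    proof -
      have [measurable]: "f \<in> borel_measurable L" "node k z \<in> sets L" for k z using that by auto
      show ?thesis by (simp add: ind sum_distrib_left nn_integral_sum)
    qed
    let ?m = "\<lambda>z. emeasure M (node (Suc e) z)" and ?G = "\<lambda>z. \<integral>\<^sup>+w\<in>node (Suc e) z. g w \<partial>M"
    have "(\<integral>\<^sup>+w\<in>node e y. g w \<partial>M)\<^sup>2 / emeasure M (node e y) \<le> (\<Sum>z\<in>Z. (?G z)\<^sup>2 / ?m z)"
    proof -
      have m: "emeasure M (node e y) = (\<Sum>z\<in>Z. ?m z)"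
        unfolding Un[symmetric] using disj Z by (intro sum_emeasure[symmetric]) auto
      \<comment> \<open>The Cauchy-Schwarz inequality for finite sums, with counting measure and the
        areas of the children as weights.\<close>
      have "(\<Sum>z\<in>Z. ?G z)\<^sup>2 \<le> (\<Sum>z\<in>Z. ?m z) * (\<Sum>z\<in>Z. (?G z)\<^sup>2 / ?m z)"
        using weighted_Cauchy_Schwarz[of "\<lambda>_. 1" "count_space Z" ?G ?m] node_pos node_finite[of e y] Z(1)
        by (simp add: nn_integral_count_space_finite m[symmetric])
      then have "(\<integral>\<^sup>+w\<in>node e y. g w \<partial>M)\<^sup>2 / emeasure M (node e y)
        \<le> (emeasure M (node e y) * (\<Sum>z\<in>Z. (?G z)\<^sup>2 / ?m z)) / emeasure M (node e y)"
        by (intro divide_right_mono_ennreal) (simp add: split m[symmetric])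
      also have "\<dots> = (\<Sum>z\<in>Z. (?G z)\<^sup>2 / ?m z)"
        using node_finite[of e y] node_pos[of e y]
        by (subst mult.commute) (simp add: mult_divide_eq_ennreal less_top)
      finally show ?thesis .
    qed
    then have "(\<integral>\<^sup>+w\<in>node e y. (U w)\<^sup>2 \<partial>N) + 20 * c * ((\<integral>\<^sup>+w\<in>node e y. g w \<partial>M)\<^sup>2 / emeasure M (node e y))
      \<le> (\<integral>\<^sup>+w\<in>node e y. (U w)\<^sup>2 \<partial>N) + 20 * c * (\<Sum>z\<in>Z. (?G z)\<^sup>2 / ?m z)"
      by (intro add_left_mono mult_left_mono) auto
    also have "\<dots> = (\<Sum>z\<in>Z. (\<integral>\<^sup>+w\<in>node (Suc e) z. (U w)\<^sup>2 \<partial>N) + 20 * c * ((?G z)\<^sup>2 / ?m z))"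
      by (simp add: split sum.distrib sum_distrib_left)
    also have "\<dots> \<le> (\<Sum>z\<in>Z. 100 * c * (\<integral>\<^sup>+w\<in>node (Suc e) z. (g w)\<^sup>2 \<partial>M))"
    proof (rule sum_mono)
      fix z assume z: "z \<in> Z"
      show "(\<integral>\<^sup>+w\<in>node (Suc e) z. (U w)\<^sup>2 \<partial>N) + 20 * c * ((?G z)\<^sup>2 / ?m z) \<le> 100 * c * (\<integral>\<^sup>+w\<in>node (Suc e) z. (g w)\<^sup>2 \<partial>M)"
        using F(3)[OF z] * z unfolding good_def by (auto simp: case_prod_beta')
    qed
    also have "\<dots> = 100 * c * (\<integral>\<^sup>+w\<in>node e y. (g w)\<^sup>2 \<partial>M)"
      by (simp add: split sum_distrib_left)
    finally show "(\<integral>\<^sup>+w\<in>node e y. (U w)\<^sup>2 \<partial>N) + 20 * c * ((\<integral>\<^sup>+w\<in>node e y. g w \<partial>M)\<^sup>2 / emeasure M (node e y))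
       \<le> 100 * c * (\<integral>\<^sup>+w\<in>node e y. (g w)\<^sup>2 \<partial>M)" .
  qed
  then show ?thesis using card Z(1) F(1) by (intro exI[of _ "\<Union>z\<in>Z. F z"]) auto
qed

end

lemma ennreal_square_quotient_mono:
  fixes a m q :: ennreal
  assumes "4 * m \<le> q" "0 < m" "q < \<infinity>"
  shows "4 * (a / q) \<le> a / m"
proof -
  have "m \<le> 4 * m" using mult_right_mono[of 1 "4::ennreal" m] by simp
  then have m: "m < \<infinity>" "0 < q" using assms by (auto intro: le_less_trans less_le_trans)
  have "4 * a = 4 * (a / m * m)"
    using m assms by (simp add: ennreal_divide_times mult_divide_eq_ennreal less_top)
  also have "\<dots> = a / m * (4 * m)" by (simp add: ac_simps)
  also have "\<dots> \<le> a / m * q" by (intro mult_left_mono assms) simp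
  finally have "4 * a / q \<le> a / m * q / q" by (rule divide_right_mono_ennreal)
  also have "\<dots> = a / m" using m assms by (simp add: mult_divide_eq_ennreal less_top)
  finally show ?thesis by (simp add: ennreal_times_divide)
qed

section \<open>Chains of nodes with constant packing number\<close>

context bounded_packing
begin

text \<open>By the Cauchy-Schwarz inequality the quotient term takes up 20 of the 100, hence the 80
  in the hypothesis.\<close>

lemma good_leaf:
  assumes bound: "\<And>U g. U \<in> borel_measurable M \<Longrightarrow> g \<in> borel_measurable M \<Longrightarrow>
      (AE y in N. y \<in> node t x \<longrightarrow> U y \<le> pot t g y) \<Longrightarrow>
      (\<integral>\<^sup>+y\<in>node t x. (U y)\<^sup>2 \<partial>N) \<le> 80 * c * (\<integral>\<^sup>+y\<in>node t x. (g y)\<^sup>2 \<partial>M)"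
  shows "good t x {(t, x)}"
  unfolding good_def
proof (intro allI impI)
  fix U g :: "'a \<Rightarrow> ennreal"
  assume m: "U \<in> borel_measurable M" "g \<in> borel_measurable M"
    and *: "\<forall>(k, z)\<in>{(t, x)}. AE y in N. y \<in> node k z \<longrightarrow> U y \<le> pot k g y"
  have "(\<integral>\<^sup>+y\<in>node t x. (U y)\<^sup>2 \<partial>N) + 20 * c * ((\<integral>\<^sup>+y\<in>node t x. g y \<partial>M)\<^sup>2 / emeasure M (node t x))
     \<le> 80 * c * (\<integral>\<^sup>+y\<in>node t x. (g y)\<^sup>2 \<partial>M) + 20 * c * (\<integral>\<^sup>+y\<in>node t x. (g y)\<^sup>2 \<partial>M)"
    using * m by (intro add_mono bound mult_left_mono square_quotient_le) auto
  also have "\<dots> = 100 * c * (\<integral>\<^sup>+y\<in>node t x. (g y)\<^sup>2 \<partial>M)"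
    by (simp flip: distrib_right)
  finally show "(\<integral>\<^sup>+y\<in>node t x. (U y)\<^sup>2 \<partial>N) + 20 * c * ((\<integral>\<^sup>+y\<in>node t x. g y \<partial>M)\<^sup>2 / emeasure M (node t x))
     \<le> 100 * c * (\<integral>\<^sup>+y\<in>node t x. (g y)\<^sup>2 \<partial>M)" .
qed

text \<open>The balance of constants: the cell needs 60 for its own gradient and 10 for the hole. In
  the quotient term of the large node the square of the sum costs a factor 2; the part from the cell
  takes the remaining 40, and the part from the hole is 40 divided by the area ratio 4, which is 10.
  The two tens are exactly the 20 supplied by \<open>good e y F\<close> on the hole.\<close>

lemma good_chain:
  assumes e: "t < e" "y \<in> node t x" and 0: "nn (node t x - node e y) = 0"
    and good: "good e y F"
  shows "good t x (insert (t, x) F)"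
  unfolding good_def
proof (intro allI impI)
  fix U g :: "'a \<Rightarrow> ennreal"
  assume [measurable]: "U \<in> borel_measurable M" "g \<in> borel_measurable M"
    and *: "\<forall>(k, z)\<in>insert (t, x) F. AE y in N. y \<in> node k z \<longrightarrow> U y \<le> pot k g y"
  have [measurable]: "U \<in> borel_measurable N" by simp
  define H where "H = node e y"
  define R where "R = node t x - H"
  have HQ: "H \<subseteq> node t x"
    unfolding H_def using node_mono[of t e y] node_eq[OF e(2)] e(1) by simp
  have [measurable]: "H \<in> sets M" "R \<in> sets M" by (auto simp: H_def R_def)
  let ?mH = "emeasure M H" and ?mQ = "emeasure M (node t x)"
  let ?G = "\<integral>\<^sup>+w\<in>H. g w \<partial>M" and ?Gr = "\<integral>\<^sup>+w\<in>R. g w \<partial>M"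
  let ?SR = "\<integral>\<^sup>+w\<in>R. (g w)\<^sup>2 \<partial>M" and ?SH = "\<integral>\<^sup>+w\<in>H. (g w)\<^sup>2 \<partial>M"
  have split: "(\<integral>\<^sup>+w\<in>node t x. f w \<partial>L) = (\<integral>\<^sup>+w\<in>R. f w \<partial>L) + (\<integral>\<^sup>+w\<in>H. f w \<partial>L)"
    if "f \<in> borel_measurable M" "L = M \<or> L = N" for f L
  proof -
    have [measurable]: "f \<in> borel_measurable L" "H \<in> sets L" "R \<in> sets L" using that by auto
    have "(\<integral>\<^sup>+w\<in>node t x. f w \<partial>L) = (\<integral>\<^sup>+w. f w * indicator R w + f w * indicator H w \<partial>L)"
      using HQ by (intro nn_integral_cong) (auto simp: R_def indicator_def)
    then show ?thesis by (simp add: nn_integral_add)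
  qed
  have "cell t e x H R" using e HQ by (auto simp: cell_def H_def R_def)
  then have R: "(\<integral>\<^sup>+w\<in>R. (U w)\<^sup>2 \<partial>N) \<le> 60 * c * ?SR + 10 * c * (?G\<^sup>2 / ?mH)"
    using 0 * by (intro cell_estimate') (auto simp: R_def H_def)
  have H: "(\<integral>\<^sup>+w\<in>H. (U w)\<^sup>2 \<partial>N) + 20 * c * (?G\<^sup>2 / ?mH) \<le> 100 * c * ?SH"
    using good * unfolding good_def H_def by auto
  have ratio: "4 * ?mH \<le> ?mQ"
  proof -
    have "?mH \<le> emeasure M (node (Suc t) y)"
      unfolding H_def using e by (intro emeasure_mono node_mono) auto
    then have "4 * ?mH \<le> 4 * emeasure M (node (Suc t) y)" by (rule mult_left_mono) simp
    also have "\<dots> \<le> emeasure M (node t y)" by (rule node_ratio)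
    finally show ?thesis using node_eq[OF e(2)] by simp
  qed
  have G4: "4 * (?G\<^sup>2 / ?mQ) \<le> ?G\<^sup>2 / ?mH"
    using ratio node_pos[of e y] node_finite[of t x] by (intro ennreal_square_quotient_mono) (auto simp: H_def)
  have "?Gr\<^sup>2 / ?mQ \<le> ?SR"
  proof -
    have Rm: "emeasure M R \<le> ?mQ" by (intro emeasure_mono) (auto simp: R_def)
    have "?Gr\<^sup>2 \<le> emeasure M R * ?SR"
      using le_less_trans[OF Rm node_finite] by (intro square_integral_le) auto
    also have "\<dots> \<le> ?SR * ?mQ" by (subst mult.commute) (intro mult_left_mono Rm, simp)
    finally have "?Gr\<^sup>2 / ?mQ \<le> ?SR * ?mQ / ?mQ" by (rule divide_right_mono_ennreal)
    also have "\<dots> = ?SR" using node_pos[of t x] node_finite[of t x] by (simp add: mult_divide_eq_ennreal less_top)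
    finally show ?thesis .
  qed
  then have "20 * c * ((?Gr + ?G)\<^sup>2 / ?mQ) \<le> 40 * c * ?SR + 10 * c * (?G\<^sup>2 / ?mH)"
  proof -
    have "(?Gr + ?G)\<^sup>2 / ?mQ \<le> (2 * ?Gr\<^sup>2 + 2 * ?G\<^sup>2) / ?mQ"
      by (intro divide_right_mono_ennreal square_sum_le_ennreal)
    also have "\<dots> = 2 * (?Gr\<^sup>2 / ?mQ) + 2 * (?G\<^sup>2 / ?mQ)"
      by (simp add: add_divide_distrib_ennreal ennreal_times_divide)
    finally have "20 * c * ((?Gr + ?G)\<^sup>2 / ?mQ) \<le> 20 * c * (2 * (?Gr\<^sup>2 / ?mQ) + 2 * (?G\<^sup>2 / ?mQ))"
      by (rule mult_left_mono) simp
    also have "\<dots> = 40 * c * (?Gr\<^sup>2 / ?mQ) + 10 * c * (4 * (?G\<^sup>2 / ?mQ))"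
    proof -
      have "20 * c * (2 * a + 2 * b) = 40 * c * a + 10 * c * (4 * b)" for a b :: ennreal
      proof -
        have "20 * c * (2 * a + 2 * b) = (20 * 2) * c * a + 10 * c * ((2 * 2) * b)"
        proof -
          have "20 * c * (2 * b) = (10 * 2) * c * (2 * b)" by simp
          also have "\<dots> = 10 * c * ((2 * 2) * b)" by (simp only: ac_simps)
          finally have "20 * c * (2 * b) = 10 * c * ((2 * 2) * b)" .
          moreover have "20 * c * (2 * a) = (20 * 2) * c * a" by (simp only: ac_simps)
          ultimately show ?thesis by (simp only: distrib_left)
        qed
        then show ?thesis by simp
      qed
      then show ?thesis .
    qed
    also have "\<dots> \<le> 40 * c * ?SR + 10 * c * (?G\<^sup>2 / ?mH)"
      using \<open>?Gr\<^sup>2 / ?mQ \<le> ?SR\<close> G4 by (intro add_mono mult_left_mono) auto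
    finally show ?thesis .
  qed
  then have "(\<integral>\<^sup>+w\<in>R. (U w)\<^sup>2 \<partial>N) + (\<integral>\<^sup>+w\<in>H. (U w)\<^sup>2 \<partial>N) + 20 * c * ((?Gr + ?G)\<^sup>2 / ?mQ)
    \<le> (60 * c * ?SR + 10 * c * (?G\<^sup>2 / ?mH)) + (\<integral>\<^sup>+w\<in>H. (U w)\<^sup>2 \<partial>N) + (40 * c * ?SR + 10 * c * (?G\<^sup>2 / ?mH))"
    using R by (intro add_mono) auto
  also have "\<dots> = 100 * c * ?SR + ((\<integral>\<^sup>+w\<in>H. (U w)\<^sup>2 \<partial>N) + 20 * c * (?G\<^sup>2 / ?mH))"
  proof -
    have "60 * c * a + 10 * c * b + d + (40 * c * a + 10 * c * b) = 100 * c * a + (d + 20 * c * b)" for a b d :: ennreal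
    proof -
      have "60 * c * a + 10 * c * b + d + (40 * c * a + 10 * c * b)
        = (60 * c * a + 40 * c * a) + (d + (10 * c * b + 10 * c * b))" by (simp add: ac_simps)
      then show ?thesis by (simp flip: distrib_right)
    qed
    then show ?thesis .
  qed
  also have "\<dots> \<le> 100 * c * ?SR + 100 * c * ?SH" using H by (rule add_left_mono)
  finally show "(\<integral>\<^sup>+w\<in>node t x. (U w)\<^sup>2 \<partial>N) + 20 * c * ((\<integral>\<^sup>+w\<in>node t x. g w \<partial>M)\<^sup>2 / ?mQ)
     \<le> 100 * c * (\<integral>\<^sup>+w\<in>node t x. (g w)\<^sup>2 \<partial>M)"
    by (simp add: split distrib_left)
qed

text \<open>If the chain never ends, the holes shrink to a set of area 0, which is null for
  \<open>N\<close> as well. On each cell the bound holds with 80, the gradient in the hole being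
  estimated by the Cauchy-Schwarz inequality, and the cells increase to the node up to that null
  set.\<close>

lemma good_infinite_chain:
  assumes y: "\<And>e. t < e \<Longrightarrow> y e \<in> node t x" and 0: "\<And>e. t < e \<Longrightarrow> nn (node t x - node e (y e)) = 0"
    and nest: "\<And>e. t < e \<Longrightarrow> y (Suc e) \<in> node e (y e)"
  shows "good t x {(t, x)}"
proof (rule good_leaf)
  fix U g :: "'a \<Rightarrow> ennreal"
  assume [measurable]: "U \<in> borel_measurable M" "g \<in> borel_measurable M"
    and *: "AE y in N. y \<in> node t x \<longrightarrow> U y \<le> pot t g y"
  have [measurable]: "U \<in> borel_measurable N" by simp
  define H where "H i = node (Suc (t + i)) (y (Suc (t + i)))" for i
  define R where "R i = node t x - H i" for i
  have [measurable]: "H i \<in> sets M" "R i \<in> sets M" for i by (auto simp: H_def R_def)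
  have H_Suc: "H (Suc i) \<subseteq> H i" for i
  proof -
    have "y (Suc (Suc (t + i))) \<in> node (Suc (t + i)) (y (Suc (t + i)))" by (rule nest) simp
    then show ?thesis unfolding H_def
      using node_mono[of "Suc (t + i)" "Suc (Suc (t + i))" "y (Suc (Suc (t + i)))"] node_eq by fastforce
  qed
  have HQ: "H i \<subseteq> node t x" for i
    unfolding H_def using node_mono[of t "Suc (t + i)" "y (Suc (t + i))"] node_eq[OF y[of "Suc (t + i)"]] by simp
  let ?S = "\<integral>\<^sup>+w\<in>node t x. (g w)\<^sup>2 \<partial>M"
  have R: "(\<integral>\<^sup>+w\<in>R i. (U w)\<^sup>2 \<partial>N) \<le> 80 * c * ?S" for i
  proof -
    have "cell t (Suc (t + i)) x (H i) (R i)" using y by (auto simp: cell_def H_def R_def)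
    then have "(\<integral>\<^sup>+w\<in>R i. (U w)\<^sup>2 \<partial>N) \<le> 60 * c * (\<integral>\<^sup>+w\<in>R i. (g w)\<^sup>2 \<partial>M) + 10 * c * ((\<integral>\<^sup>+w\<in>H i. g w \<partial>M)\<^sup>2 / emeasure M (H i))"
      using 0[of "Suc (t + i)"] * by (intro cell_estimate') (auto simp: R_def H_def)
    also have "\<dots> \<le> 60 * c * ?S + 10 * c * (\<integral>\<^sup>+w\<in>H i. (g w)\<^sup>2 \<partial>M)"
      using square_quotient_le[of g "Suc (t + i)" "y (Suc (t + i))"]
      by (intro add_mono mult_left_mono nn_integral_mono) (auto simp: R_def H_def indicator_def)
    also have "\<dots> \<le> 60 * c * ?S + 20 * c * ?S"
    proof (rule add_left_mono, rule mult_mono)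
      show "10 * c \<le> 20 * c" by (intro mult_right_mono) auto
      show "(\<integral>\<^sup>+w\<in>H i. (g w)\<^sup>2 \<partial>M) \<le> ?S"
        using HQ[of i] by (intro nn_integral_mono) (auto simp: indicator_def)
    qed auto
    also have "\<dots> = 80 * c * ?S" by (simp flip: distrib_right)
    finally show ?thesis .
  qed
  have "(\<Inter>i. H i) \<in> null_sets N"
  proof (rule null_N, rule null_setsI)
    have "emeasure M (\<Inter>i. H i) \<le> 0"
    proof (rule ennreal_le_epsilon)
      fix \<epsilon> :: real assume "0 < \<epsilon>"
      then obtain n where n: "5 * (1/4) ^ n < \<epsilon>"
        using real_arch_pow_inv[of "\<epsilon> / 5" "1/4"] by (auto simp: field_simps)
      have "emeasure M (\<Inter>i. H i) \<le> emeasure M (H n)" by (intro emeasure_mono) auto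
      also have "\<dots> \<le> 5 * ennreal (1 / 4 ^ Suc (t + n))" unfolding H_def by (rule node_upper)
      also have "\<dots> = ennreal (5 * (1 / 4 ^ Suc (t + n)))" by (simp add: ennreal_mult del: times_divide_eq_right)
      also have "\<dots> \<le> ennreal \<epsilon>"
      proof (rule ennreal_leI)
        have "(4::real) ^ n \<le> 4 ^ Suc (t + n)" by (rule power_increasing) auto
        then have "1 / (4::real) ^ Suc (t + n) \<le> 1 / 4 ^ n" by (intro divide_left_mono) auto
        then show "5 * (1 / (4::real) ^ Suc (t + n)) \<le> \<epsilon>" using n by (simp add: power_one_over)
      qed
      finally show "emeasure M (\<Inter>i. H i) \<le> 0 + ennreal \<epsilon>" by simp
    qed
    then show "emeasure M (\<Inter>i. H i) = 0" by simp
  qed measurable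
  then have "(\<integral>\<^sup>+w\<in>node t x. (U w)\<^sup>2 \<partial>N) = (\<integral>\<^sup>+w\<in>(\<Union>i. R i). (U w)\<^sup>2 \<partial>N)"
    by (intro nn_integral_cong_AE) (auto simp: R_def indicator_def dest!: AE_not_in elim!: eventually_mono)
  also have "\<dots> = emeasure (density N (\<lambda>w. (U w)\<^sup>2)) (\<Union>i. R i)"
    by (rule emeasure_density[symmetric]) auto
  also have "\<dots> = (SUP i. emeasure (density N (\<lambda>w. (U w)\<^sup>2)) (R i))"
    using H_Suc by (intro SUP_emeasure_incseq[symmetric] incseq_SucI) (auto simp: R_def)
  also have "\<dots> \<le> 80 * c * ?S"
    using R by (intro SUP_least) (simp add: emeasure_density)
  finally show "(\<integral>\<^sup>+w\<in>node t x. (U w)\<^sup>2 \<partial>N) \<le> 80 * c * ?S" .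
qed

text \<open>Let \<open>j > 0\<close> be the packing number of the node. By superadditivity at most
  one node per level inside it carries the full \<open>j\<close>, so these nodes form a chain, and
  outside each of them the packing number is 0. Either the chain has a last member, whose children
  all have smaller packing number so that the induction hypothesis applies, or it is infinite. Only
  the top of the chain costs a constraint of its own.\<close>

lemma ex_good: "\<exists>F. finite F \<and> card F \<le> 1 + 17 * (2 * nn (node t x) - 1) \<and> good t x F"
proof (induction "nn (node t x)" arbitrary: t x rule: less_induct)
  case less
  define j where "j = nn (node t x)"
  show ?case
  proof (cases "j = 0")
    case True
    have "good t x {(t, x)}"
    proof (rule good_leaf)
      fix U g :: "'a \<Rightarrow> ennreal"
      assume m: "U \<in> borel_measurable M" "g \<in> borel_measurable M"
        and *: "AE y in N. y \<in> node t x \<longrightarrow> U y \<le> pot t g y"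
      have "(\<integral>\<^sup>+y\<in>node t x. (U y)\<^sup>2 \<partial>N) \<le> 60 * c * (\<integral>\<^sup>+y\<in>node t x. (g y)\<^sup>2 \<partial>M)
         + 10 * c * ((\<integral>\<^sup>+y\<in>{}. g y \<partial>M)\<^sup>2 / emeasure M {})"
        using True * m(2)
        by (intro cell_estimate'[where e = "Suc t" and x = x]) (auto simp: cell_def j_def)
      also have "\<dots> \<le> 80 * c * (\<integral>\<^sup>+y\<in>node t x. (g y)\<^sup>2 \<partial>M)"
        by (simp add: mult_right_mono)
      finally show "(\<integral>\<^sup>+y\<in>node t x. (U y)\<^sup>2 \<partial>N) \<le> 80 * c * (\<integral>\<^sup>+y\<in>node t x. (g y)\<^sup>2 \<partial>M)" .
    qed
    then show ?thesis by (intro exI[of _ "{(t, x)}"]) auto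
  next
    case False
    define L where "L = {e. t \<le> e \<and> (\<exists>y\<in>node t x. nn (node e y) = j)}"
    have le_j: "nn (node e y) \<le> j" if "t \<le> e" "y \<in> node t x" for e y
      unfolding j_def using that node_mono[of t e y] node_eq[of y t x] by (intro nn_mono) auto
    have down: "nn (node e' y) = j" if "t \<le> e'" "e' \<le> e" "y \<in> node t x" "nn (node e y) = j" for e e' y
      using le_j[of e' y] nn_mono[OF node_mono, of e' e y] that by simp
    have uniq: "y' \<in> node e y" if "t \<le> e" "y \<in> node t x" "y' \<in> node t x" "nn (node e y) = j" "nn (node e y') = j" for e y y'
    proof (rule ccontr)
      assume "y' \<notin> node e y"
      then have "node e y \<inter> node e y' = {}" by (auto simp: node_def)
      moreover have "node e y \<subseteq> node t x" "node e y' \<subseteq> node t x"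
        using that node_mono[of t e y] node_mono[of t e y'] node_eq[of y t x] node_eq[of y' t x] by auto
      ultimately have "nn (node e y) + nn (node e y') \<le> j"
        unfolding j_def by (rule nn_superadditive)
      then show False using that False by simp
    qed
    have tL: "t \<in> L" by (auto simp: L_def j_def)
    have rest0: "nn (node t x - node e y) = 0" if "t \<le> e" "y \<in> node t x" "nn (node e y) = j" for e y
    proof -
      have "nn (node t x - node e y) + nn (node e y) \<le> j"
        unfolding j_def using that node_mono[of t e y] node_eq[of y t x] by (intro nn_superadditive) auto
      then show ?thesis using that by simp
    qed
    show ?thesis
    proof (cases "finite L")
      case True
      define e where "e = Max L"
      have "e \<in> L" unfolding e_def using True tL by (intro Max_in) auto
      then obtain y where y: "t \<le> e" "y \<in> node t x" "nn (node e y) = j" by (auto simp: L_def)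
      have child: "nn (node (Suc e) z) < j" if "z \<in> node e y" for z
      proof -
        have z: "z \<in> node t x" using that node_mono[of t e y] node_eq[of y t x] y by auto
        have "Suc e \<notin> L" using Max_ge[OF True, of "Suc e"] by (auto simp: e_def)
        then have "nn (node (Suc e) z) \<noteq> j" using y z by (auto simp: L_def)
        then show ?thesis using le_j[of "Suc e" z] y z by simp
      qed
      have "\<exists>F. finite F \<and> card F \<le> 17 * (2 * j - 1) \<and> good e y F"
        using less child by (intro good_Suc y(3)) (auto simp: j_def)
      then obtain F where F: "finite F" "card F \<le> 17 * (2 * j - 1)" "good e y F" by auto
      \<comment> \<open>If the chain consists of the node alone, the constraints of the children
        suffice; otherwise the node contributes its own.\<close>
      show ?thesis
      proof (cases "e = t")
        case True
        then have "good t x F" using F(3) node_eq[OF y(2)] by (simp add: good_def)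
        then show ?thesis using F by (intro exI[of _ F]) (auto simp: j_def)
      next
        case False
        then have "good t x (insert (t, x) F)"
          using y F rest0 by (intro good_chain[of t e y]) auto
        then show ?thesis using F
          by (intro exI[of _ "insert (t, x) F"]) (auto simp: j_def card_insert_if)
      qed
    next
      case False
      have "\<exists>y\<in>node t x. nn (node e y) = j" if "t \<le> e" for e
      proof -
        obtain e' where "e' \<in> L" "e \<le> e'"
          using False unfolding finite_nat_set_iff_bounded_le by (meson nle_le)
        then show ?thesis using down[of e e'] that by (auto simp: L_def)
      qed
      then obtain y where y: "\<And>e. t \<le> e \<Longrightarrow> y e \<in> node t x \<and> nn (node e (y e)) = j" by metis
      have "good t x {(t, x)}"
      proof (rule good_infinite_chain[of t y])
        fix e assume "t < e"
        then show "y e \<in> node t x" "nn (node t x - node e (y e)) = 0"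
          using y[of e] rest0[of e "y e"] by auto
        show "y (Suc e) \<in> node e (y e)"
          using \<open>t < e\<close> y[of e] y[of "Suc e"] down[of e "Suc e" "y (Suc e)"] by (intro uniq[of e "y e" "y (Suc e)"]) simp_all
      qed
      then show ?thesis by (intro exI[of _ "{(t, x)}"]) auto
    qed
  qed
qed

text \<open>The case of the root, which is the whole space. For \<open>K = 0\<close> a single
  constraint remains, and this is the additive 1 of the final estimate.\<close>

theorem ex_constraints:
  obtains F where "finite F" "card F \<le> 1 + 34 * K"
    "\<And>U g. U \<in> borel_measurable M \<Longrightarrow> g \<in> borel_measurable M \<Longrightarrow>
      (\<And>k z. (k, z) \<in> F \<Longrightarrow> AE y in N. y \<in> node k z \<longrightarrow> U y \<le> pot k g y) \<Longrightarrow>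
      (\<integral>\<^sup>+y. (U y)\<^sup>2 \<partial>N) \<le> 100 * c * (\<integral>\<^sup>+y. (g y)\<^sup>2 \<partial>M)"
proof -
  fix x :: 'a
  obtain F where F: "finite F" "card F \<le> 1 + 17 * (2 * nn (node 0 x) - 1)" "good 0 x F"
    using ex_good[of 0 x] by blast
  have "(\<integral>\<^sup>+y. (U y)\<^sup>2 \<partial>N) \<le> 100 * c * (\<integral>\<^sup>+y. (g y)\<^sup>2 \<partial>M)"
    if "U \<in> borel_measurable M" "g \<in> borel_measurable M"
      "\<And>k z. (k, z) \<in> F \<Longrightarrow> AE y in N. y \<in> node k z \<longrightarrow> U y \<le> pot k g y" for U g
  proof -
    have "(\<integral>\<^sup>+y\<in>node 0 x. (U y)\<^sup>2 \<partial>N) \<le> (\<integral>\<^sup>+y\<in>node 0 x. (U y)\<^sup>2 \<partial>N)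
      + 20 * c * ((\<integral>\<^sup>+y\<in>node 0 x. g y \<partial>M)\<^sup>2 / emeasure M (node 0 x))" by simp
    also have "\<dots> \<le> 100 * c * (\<integral>\<^sup>+y\<in>node 0 x. (g y)\<^sup>2 \<partial>M)"
      by (rule F(3)[unfolded good_def, rule_format]) (use that in auto)
    finally show ?thesis by simp
  qed
  moreover have "card F \<le> 1 + 34 * K" using F(2) nn_le_K[of "node 0 x"] by simp
  ultimately show ?thesis using F(1) that by blast
qed

end

section \<open>Exponential integrability of the potentials of a packing\<close>

context dyadic_tree
begin

text \<open>The hole lies in a child, which has at most a quarter of the area of the node, so the
  cell keeps more than half of it.\<close>

lemma cell_measure_le:
  assumes "cell t e x H R"
  shows "emeasure M (node t x) \<le> 2 * emeasure M R"
proof (cases "H = {}")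
  case True
  have "emeasure M R \<le> 2 * emeasure M R" using mult_right_mono[of 1 "2::ennreal" "emeasure M R"] by simp
  then show ?thesis using True assms by (simp add: cell_def)
next
  case False
  then obtain z where z: "t < e" "z \<in> node t x" "H = node e z" "R = node t x - H"
    using assms by (auto simp: cell_def)
  let ?q = "emeasure M (node t x)" and ?h = "emeasure M H" and ?r = "emeasure M R"
  have HQ: "H \<subseteq> node t x" using z node_mono[of t e z] node_eq[of z t x] by auto
  have [measurable]: "H \<in> sets M" "R \<in> sets M" using z by auto
  have q: "?q = ?r + ?h"
    using HQ z by (subst plus_emeasure) (auto intro!: arg_cong[where f = "emeasure M"])
  have "?h \<le> emeasure M (node (Suc t) z)"
    using z by (auto intro!: emeasure_mono node_mono)
  then have "4 * ?h \<le> 4 * emeasure M (node (Suc t) z)" by (rule mult_left_mono) simp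
  also have "\<dots> \<le> emeasure M (node t z)" by (rule node_ratio)
  finally have le: "4 * ?h \<le> ?r + ?h" using node_eq[OF z(2)] q by simp
  have fin: "?h < \<infinity>" "?r < \<infinity>" using node_finite[of t x] q by (auto simp: less_top)
  then obtain a b where "?h = ennreal a" "?r = ennreal b" "a \<ge> 0" "b \<ge> 0"
    by (metis ennreal_cases infinity_ennreal_def less_irrefl)
  then show ?thesis using le unfolding q
    by (simp add: ennreal_mult'[symmetric] ennreal_plus[symmetric] ennreal_numeral[symmetric] del: ennreal_plus ennreal_numeral)
qed

text \<open>On a cell \<open>R\<close> of the packing, \<open>h\<close> counts the levels from
  \<open>t R\<close> on at which a point lies in the node of the point \<open>p R\<close> that
  witnesses heaviness; outside the packing it vanishes. Its integral over \<open>R\<close> with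
  respect to \<open>N\<close> is the truncated potential at \<open>p R\<close>, which exceeds
  \<open>c\<close>. Inside \<open>R\<close> the set where \<open>h\<close> is at least
  \<open>i\<close> has area of order \<open>4 ^ -i\<close> times that of the cell, so
  \<open>2 ^ h\<close> has an integral bounded independently of the number of cells.\<close>

lemma packing_test_function:
  assumes "packing c UNIV \<C>"
  obtains h :: "'a \<Rightarrow> nat" and b where
    "h \<in> M \<rightarrow>\<^sub>M count_space UNIV" "\<And>x. h x \<le> b"
    "of_nat (card \<C>) * c \<le> (\<integral>\<^sup>+x. of_nat (h x) \<partial>N)"
    "(\<integral>\<^sup>+x. (if h x = 0 then 0 else 2 ^ h x) \<partial>M) \<le> 200"
proof -
  have fin: "finite \<C>" and disj: "disjoint \<C>" and hc: "\<And>R. R \<in> \<C> \<Longrightarrow> heavy_cell c R"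
    using assms by (auto simp: packing_def)
  have "\<forall>R\<in>\<C>. \<exists>t n p. R \<in> sets M \<and> R \<subseteq> node t p \<and> emeasure M (node t p) \<le> 2 * emeasure M R
      \<and> c < (\<Sum>k=t..<n. emeasure N (R \<inter> node k p))"
  proof
    fix R assume "R \<in> \<C>"
    then obtain t e x H where cell: "cell t e x H R" and hv: "heavy c t R" using hc[of R] unfolding heavy_cell_def by blast
    obtain p n where p: "p \<in> R" "c < (\<Sum>k=t..<n. emeasure N (R \<inter> node k p))" using hv by (auto simp: heavy_def)
    have "node t p = node t x" using p cell by (auto simp: cell_def intro!: node_eq)
    moreover have "R \<in> sets M" using cell by (auto simp: cell_def)
    moreover have "R \<subseteq> node t x" using cell by (auto simp: cell_def)
    ultimately show "\<exists>t n p. R \<in> sets M \<and> R \<subseteq> node t p \<and> emeasure M (node t p) \<le> 2 * emeasure M R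
      \<and> c < (\<Sum>k=t..<n. emeasure N (R \<inter> node k p))"
      using p cell_measure_le[OF cell] by metis
  qed
  then obtain t n p where
    sets: "\<And>R. R \<in> \<C> \<Longrightarrow> R \<in> sets M" and sub: "\<And>R. R \<in> \<C> \<Longrightarrow> R \<subseteq> node (t R) (p R)"
    and m: "\<And>R. R \<in> \<C> \<Longrightarrow> emeasure M (node (t R) (p R)) \<le> 2 * emeasure M R"
    and N: "\<And>R. R \<in> \<C> \<Longrightarrow> c < (\<Sum>k=t R..<n R. emeasure N (R \<inter> node k (p R)))"
    by metis
  define h where "h x = (\<Sum>R\<in>\<C>. \<Sum>k=t R..<n R. if x \<in> R \<inter> node k (p R) then 1 else 0 :: nat)" for x
  \<comment> \<open>A majorant of \<open>2 ^ h\<close> where \<open>h\<close> is positive: if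
    \<open>k\<close> is the last level counted at \<open>x\<close>, then
    \<open>h x \<le> k - t R + 1\<close>, and the summand of level \<open>k\<close> alone is large
    enough.\<close>
  define w where "w x = (\<Sum>R\<in>\<C>. \<Sum>k=t R..<n R. 2 ^ Suc (k - t R) * indicator (R \<inter> node k (p R)) x :: ennreal)" for x
  have Pm: "{x \<in> R. x \<in> node k (p R)} \<in> sets M" if "R \<in> \<C>" for R k
    using sets.Int[OF sets[OF that] node_sets[of k "p R"]] by (simp add: Int_def)
  have hm: "h \<in> M \<rightarrow>\<^sub>M count_space UNIV"
    unfolding h_def using Pm by (intro measurable_sum_nat measurable_If) auto
  have h_one: "h x = (\<Sum>k=t R..<n R. if x \<in> node k (p R) then 1 else 0)" if "R \<in> \<C>" "x \<in> R" for R x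
  proof -
    have "P \<noteq> R \<Longrightarrow> P \<in> \<C> \<Longrightarrow> x \<notin> P" for P using disjointD[OF disj, of P R] that by auto
    then have "h x = (\<Sum>P\<in>{R}. \<Sum>k=t P..<n P. if x \<in> P \<inter> node k (p P) then 1 else 0)"
      unfolding h_def using that fin by (intro sum.mono_neutral_right) (auto intro!: sum.neutral)
    then show ?thesis using that by simp
  qed
  have le_w: "(if h x = 0 then 0 else 2 ^ h x) \<le> w x" for x
  proof (cases "h x = 0")
    case False
    have "\<exists>R\<in>\<C>. x \<in> R"
    proof (rule ccontr)
      assume "\<not> (\<exists>R\<in>\<C>. x \<in> R)"
      then have "h x = 0" unfolding h_def by simp
      then show False using \<open>h x \<noteq> 0\<close> by simp
    qed
    then obtain R where R: "R \<in> \<C>" "x \<in> R" by blast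
    define A where "A = {k\<in>{t R..<n R}. x \<in> node k (p R)}"
    have hA: "h x = card A"
      unfolding h_one[OF R] A_def card_eq_sum by (rule sum.inter_filter[symmetric]) simp
    have ne: "A \<noteq> {}" "finite A" using False hA by (auto simp: A_def)
    define k where "k = Max A"
    have kA: "k \<in> A" unfolding k_def using ne by (intro Max_in)
    have "A \<subseteq> {t R..k}" using Max_ge[OF ne(2)] by (auto simp: A_def k_def)
    then have "card A \<le> card {t R..k}" by (intro card_mono) auto
    then have "h x \<le> Suc (k - t R)" using hA kA by (auto simp: A_def)
    then have "(2::ennreal) ^ h x \<le> 2 ^ Suc (k - t R)" by (intro power_increasing) auto
    also have "\<dots> = 2 ^ Suc (k - t R) * indicator (R \<inter> node k (p R)) x" using kA R by (simp add: A_def)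
    also have "\<dots> \<le> (\<Sum>k=t R..<n R. 2 ^ Suc (k - t R) * indicator (R \<inter> node k (p R)) x)"
      using kA by (intro member_le_sum) (auto simp: A_def)
    also have "\<dots> \<le> w x" unfolding w_def using R fin
      by (intro member_le_sum[where f = "\<lambda>R. \<Sum>k=t R..<n R. 2 ^ Suc (k - t R) * indicator (R \<inter> node k (p R)) x"]) auto
    finally show ?thesis using False by simp
  qed simp
  have "(\<integral>\<^sup>+x. (if h x = 0 then 0 else 2 ^ h x) \<partial>M) \<le> (\<integral>\<^sup>+x. w x \<partial>M)"
    by (intro nn_integral_mono le_w)
  also have "\<dots> = (\<Sum>R\<in>\<C>. \<Sum>k=t R..<n R. 2 ^ Suc (k - t R) * emeasure M (R \<inter> node k (p R)))"
  proof -
    have [measurable]: "R \<inter> node k (p R) \<in> sets M" if "R \<in> \<C>" for R k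
      using sets[OF that] by measurable
    have "(\<integral>\<^sup>+x. w x \<partial>M) = (\<Sum>R\<in>\<C>. \<integral>\<^sup>+x. (\<Sum>k=t R..<n R. 2 ^ Suc (k - t R) * indicator (R \<inter> node k (p R)) x) \<partial>M)"
      unfolding w_def by (rule nn_integral_sum) measurable
    also have "\<dots> = (\<Sum>R\<in>\<C>. \<Sum>k=t R..<n R. \<integral>\<^sup>+x. 2 ^ Suc (k - t R) * indicator (R \<inter> node k (p R)) x \<partial>M)"
      by (intro sum.cong refl nn_integral_sum) measurable
    also have "\<dots> = (\<Sum>R\<in>\<C>. \<Sum>k=t R..<n R. 2 ^ Suc (k - t R) * emeasure M (R \<inter> node k (p R)))"
      by (intro sum.cong refl nn_integral_cmult_indicator) measurable
    finally show ?thesis .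
  qed
  also have "\<dots> \<le> (\<Sum>R\<in>\<C>. 40 * emeasure M R)"
  proof (rule sum_mono)
    fix R assume R: "R \<in> \<C>"
    have "(\<Sum>k=t R..<n R. 2 ^ Suc (k - t R) * emeasure M (R \<inter> node k (p R)))
       \<le> (\<Sum>k=t R..<n R. ennreal (10 * (1/4) ^ t R * (1/2) ^ (k - t R)))"
    proof (rule sum_mono)
      fix k assume k: "k \<in> {t R..<n R}"
      have "emeasure M (R \<inter> node k (p R)) \<le> 5 * ennreal (1 / 4 ^ k)"
        using node_upper by (rule order_trans[rotated]) (auto intro!: emeasure_mono)
      then have "2 ^ Suc (k - t R) * emeasure M (R \<inter> node k (p R)) \<le> 2 ^ Suc (k - t R) * (5 * ennreal (1 / 4 ^ k))"
        by (rule mult_left_mono) simp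
      also have "\<dots> = ennreal (2 ^ Suc (k - t R) * (5 * (1 / 4 ^ k)))"
        by (simp add: two_power_ennreal ennreal_mult del: times_divide_eq_right power_Suc)
      also have "2 ^ Suc (k - t R) * (5 * (1 / 4 ^ k)) = (10 * (1/4) ^ t R * (1/2) ^ (k - t R) :: real)"
      proof -
        have "(4::real) ^ k = 4 ^ t R * 4 ^ (k - t R)" using k by (simp flip: power_add)
        moreover have "(4::real) ^ (k - t R) = 2 ^ (k - t R) * 2 ^ (k - t R)" by (simp flip: power_mult_distrib)
        ultimately show ?thesis by (simp add: power_one_over)
      qed
      finally show "2 ^ Suc (k - t R) * emeasure M (R \<inter> node k (p R)) \<le> ennreal (10 * (1/4) ^ t R * (1/2) ^ (k - t R))" .
    qed
    also have "\<dots> = ennreal (10 * (1/4) ^ t R * (\<Sum>k=t R..<n R. (1/2) ^ (k - t R)))"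
      by (simp add: sum_ennreal sum_distrib_left)
    also have "\<dots> \<le> ennreal (20 * (1/4) ^ t R)"
    proof (rule ennreal_leI)
      have "(\<Sum>k=t R..<n R. (1/2) ^ (k - t R)) = (\<Sum>i<n R - t R. (1/2::real) ^ i)"
        by (rule sum.reindex_bij_witness[of _ "\<lambda>i. i + t R" "\<lambda>k. k - t R"]) auto
      also have "\<dots> \<le> 2" by (simp add: geometric_sum)
      finally have "(\<Sum>k=t R..<n R. (1/2::real) ^ (k - t R)) \<le> 2" .
      then have "10 * (1/4) ^ t R * (\<Sum>k=t R..<n R. (1/2::real) ^ (k - t R)) \<le> 10 * (1/4) ^ t R * 2"
        by (intro mult_left_mono) auto
      then show "10 * (1/4) ^ t R * (\<Sum>k=t R..<n R. (1/2::real) ^ (k - t R)) \<le> 20 * (1/4) ^ t R" by simp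
    qed
    also have "\<dots> = 20 * ennreal (1 / 4 ^ t R)" by (simp only: power_one_over) (simp add: ennreal_mult del: times_divide_eq_right)
    also have "\<dots> \<le> 20 * (2 * emeasure M R)"
      by (intro mult_left_mono order_trans[OF node_lower m[OF R]]) simp
    finally show "(\<Sum>k=t R..<n R. 2 ^ Suc (k - t R) * emeasure M (R \<inter> node k (p R))) \<le> 40 * emeasure M R"
      by (simp add: mult.assoc[symmetric])
  qed
  also have "\<dots> = 40 * emeasure M (\<Union>\<C>)"
  proof -
    have "\<C> \<subseteq> sets M" using sets by auto
    then show ?thesis
      using disj fin sum_emeasure[of "\<lambda>R. R" \<C> M]
      by (simp add: sum_distrib_left[symmetric] disjoint_family_on_def disjoint_def)
  qed
  \<comment> \<open>The cells are disjoint, so their areas add up to at most the area 5 of the root;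
    this yields 200.\<close>
  also have "\<dots> \<le> 40 * (5 * ennreal (1 / 4 ^ 0))"
  proof (intro mult_left_mono)
    have "emeasure M (\<Union>\<C>) \<le> emeasure M (node 0 undefined)"
      by (rule emeasure_mono[OF _ node_sets]) simp
    also have "\<dots> \<le> 5 * ennreal (1 / 4 ^ 0)" by (rule node_upper)
    finally show "emeasure M (\<Union>\<C>) \<le> 5 * ennreal (1 / 4 ^ 0)" .
  qed simp
  finally have w: "(\<integral>\<^sup>+x. (if h x = 0 then 0 else 2 ^ h x) \<partial>M) \<le> 200" by simp
  have "of_nat (card \<C>) * c = (\<Sum>R\<in>\<C>. c)" by simp
  also have "\<dots> \<le> (\<Sum>R\<in>\<C>. \<Sum>k=t R..<n R. emeasure N (R \<inter> node k (p R)))"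
    using N by (intro sum_mono) (simp add: less_imp_le)
  also have "\<dots> = (\<integral>\<^sup>+x. of_nat (h x) \<partial>N)"
  proof -
    have "of_nat (h x) = (\<Sum>R\<in>\<C>. \<Sum>k=t R..<n R. indicator (R \<inter> node k (p R)) x :: ennreal)" for x
      unfolding h_def of_nat_sum by (intro sum.cong) (auto simp: indicator_def)
    then show ?thesis using sets by (simp add: nn_integral_sum)
  qed
  finally have card: "of_nat (card \<C>) * c \<le> (\<integral>\<^sup>+x. of_nat (h x) \<partial>N)" .
  have "h x \<le> (\<Sum>R\<in>\<C>. \<Sum>k=t R..<n R. 1)" for x
    unfolding h_def by (intro sum_mono) auto
  then show ?thesis using that hm card w by blast
qed

end

subsection \<open>Smooth bumps and product test functions\<close>

text \<open>The class \<open>C^k\<close> on the line, with the derivative quantified existentially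
  so that explicit formulas can be supplied.\<close>

primrec diff_times :: "nat \<Rightarrow> (real \<Rightarrow> real) \<Rightarrow> bool" where
  "diff_times 0 f \<longleftrightarrow> continuous_on UNIV f"
| "diff_times (Suc k) f \<longleftrightarrow> (\<exists>f'. (\<forall>x. (f has_real_derivative f' x) (at x)) \<and> diff_times k f')"

lemma diff_times_Suc_D: "diff_times (Suc k) f \<Longrightarrow> diff_times k f"
proof (induction k arbitrary: f)
  case 0
  then show ?case by (auto intro!: continuous_at_imp_continuous_on intro: DERIV_isCont)
next
  case (Suc k)
  from Suc.prems obtain f' where "\<forall>x. (f has_real_derivative f' x) (at x)" "diff_times (Suc k) f'"
    by auto
  then show ?case using Suc.IH[of f'] by auto
qed

lemma diff_times_const: "diff_times k (\<lambda>x. c)"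
  by (induction k arbitrary: c) (auto intro!: exI[of _ "\<lambda>x. 0"])

lemma diff_times_add:
  "diff_times k f \<Longrightarrow> diff_times k g \<Longrightarrow> diff_times k (\<lambda>x. f x + g x)"
proof (induction k arbitrary: f g)
  case (Suc k)
  then obtain f' g' where "\<forall>x. (f has_real_derivative f' x) (at x)" "diff_times k f'"
    "\<forall>x. (g has_real_derivative g' x) (at x)" "diff_times k g'" by auto
  then show ?case using Suc.IH[of f' g'] by (auto intro!: exI[of _ "\<lambda>x. f' x + g' x"] DERIV_add)
qed (auto intro: continuous_on_add)

lemma diff_times_mult:
  "diff_times k f \<Longrightarrow> diff_times k g \<Longrightarrow> diff_times k (\<lambda>x. f x * g x)"
proof (induction k arbitrary: f g)
  case (Suc k)
  then obtain f' g' where *: "\<forall>x. (f has_real_derivative f' x) (at x)" "diff_times k f'"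
    "\<forall>x. (g has_real_derivative g' x) (at x)" "diff_times k g'" by auto
  have "diff_times k (\<lambda>x. f' x * g x + g' x * f x)"
    using * Suc.IH diff_times_Suc_D Suc.prems by (intro diff_times_add Suc.IH) auto
  then show ?case using * by (auto intro!: exI[of _ "\<lambda>x. f' x * g x + g' x * f x"] DERIV_mult)
qed (auto intro: continuous_on_mult)

lemma diff_times_affine: "diff_times k f \<Longrightarrow> diff_times k (\<lambda>x. f (c * x + d))"
proof (induction k arbitrary: f)
  case 0
  then show ?case by (auto intro!: continuous_on_compose2[of UNIV f] continuous_intros)
next
  case (Suc k)
  then obtain f' where f': "\<forall>x. (f has_real_derivative f' x) (at x)" "diff_times k f'" by auto
  have "((\<lambda>x. f (c * x + d)) has_real_derivative c * f' (c * x + d)) (at x)" for x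
  proof -
    have "((\<lambda>x. c * x + d) has_real_derivative c) (at x)"
      by (auto intro!: derivative_eq_intros)
    with f'(1) show ?thesis
      using DERIV_chain2[of f "f' (c * x + d)" "\<lambda>x. c * x + d" x c] by (simp only: mult.commute[of _ c])
  qed
  then show ?case using diff_times_mult[OF diff_times_const[of k c] Suc.IH[OF f'(2)]]
    by (auto intro!: exI[of _ "\<lambda>x. c * f' (c * x + d)"])
qed

text \<open>The quotients by powers make the family closed under differentiation up to linear
  combinations, which reduces smoothness of \<open>exp (- 1 / x)\<close> at 0 to an
  induction.\<close>

definition flat :: "nat \<Rightarrow> real \<Rightarrow> real" where
  "flat j x = (if x > 0 then exp (- 1 / x) / x ^ j else 0)"

lemma flat_has_derivative: "(flat j has_real_derivative flat (j + 2) x - j * flat (j + 1) x) (at x)"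
proof -
  consider "x > 0" | "x < 0" | "x = 0" by linarith
  then show ?thesis
  proof cases
    case 1
    have "((\<lambda>x. exp (- 1 / x) / x ^ j) has_real_derivative
       (exp (- 1 / x) * (1 / x\<^sup>2) * x ^ j - exp (- 1 / x) * (j * x ^ (j - 1))) / (x ^ j * x ^ j)) (at x)"
      using 1 by (auto intro!: derivative_eq_intros simp: power2_eq_square)
    also have "(exp (- 1 / x) * (1 / x\<^sup>2) * x ^ j - exp (- 1 / x) * (j * x ^ (j - 1))) / (x ^ j * x ^ j)
       = flat (j + 2) x - j * flat (j + 1) x"
      using 1 by (cases j) (auto simp: flat_def field_simps power2_eq_square)
    finally show ?thesis
      by (rule has_field_derivative_transform_within_open[where S = "{0<..}"]) (use 1 in \<open>auto simp: flat_def\<close>)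
  next
    case 2
    have "((\<lambda>x. 0) has_real_derivative flat (j + 2) x - j * flat (j + 1) x) (at x)"
      using 2 by (simp add: flat_def)
    then show ?thesis
      by (rule has_field_derivative_transform_within_open[where S = "{..<0}"]) (use 2 in \<open>auto simp: flat_def\<close>)
  next
    case 3
    \<comment> \<open>With \<open>y = 1 / h\<close> the difference quotient is
      \<open>y ^ (j + 1) / exp y\<close>.\<close>
    have "((\<lambda>h. flat j h / h) \<longlongrightarrow> 0) (at_right 0)"
    proof -
      have "filterlim (\<lambda>h::real. inverse h) at_top (at_right 0)" by (rule filterlim_inverse_at_top_right)
      then have "((\<lambda>h. inverse h ^ (j + 1) / exp (inverse h)) \<longlongrightarrow> 0) (at_right (0::real))"
        by (rule filterlim_compose[OF tendsto_power_div_exp_0])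
      then show ?thesis
      proof (rule Lim_transform_eventually)
        show "\<forall>\<^sub>F h in at_right 0. inverse h ^ (j + 1) / exp (inverse h) = flat j h / h"
          unfolding eventually_at_right_field
          by (rule exI[of _ 1]) (auto simp: flat_def field_simps exp_minus)
      qed
    qed
    moreover have "((\<lambda>h. flat j h / h) \<longlongrightarrow> 0) (at_left 0)"
    proof (rule Lim_transform_eventually[OF tendsto_const])
      show "\<forall>\<^sub>F h in at_left 0. 0 = flat j h / h"
        unfolding eventually_at_left_field by (rule exI[of _ "-1"]) (auto simp: flat_def)
    qed
    ultimately have "((\<lambda>h. flat j h / h) \<longlongrightarrow> 0) (at 0)" by (simp add: filterlim_split_at)
    then show ?thesis using 3 by (simp add: DERIV_def flat_def)
  qed
qed

lemma diff_times_flat: "diff_times k (flat j)"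
proof (induction k arbitrary: j)
  case 0
  then show ?case
    by (auto intro!: continuous_at_imp_continuous_on DERIV_isCont[OF flat_has_derivative])
next
  case (Suc k)
  have "diff_times k (\<lambda>x. flat (j + 2) x + - real j * flat (j + 1) x)"
    by (intro diff_times_add diff_times_mult diff_times_const Suc.IH)
  then show ?case using flat_has_derivative[of j]
    by (auto intro!: exI[of _ "\<lambda>x. flat (j + 2) x - j * flat (j + 1) x"])
qed

text \<open>The scaling by \<open>Suc n\<close> steepens both flanks, so that the bumps tend to the
  indicator of the open interval at every point while staying between 0 and 1; by dominated
  convergence they can be replaced by intervals.\<close>

definition bump :: "nat \<Rightarrow> real \<Rightarrow> real \<Rightarrow> real \<Rightarrow> real" where
  "bump n a b x = flat 0 (real (Suc n) * (x - a)) * flat 0 (real (Suc n) * (b - x))"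

lemma diff_times_bump: "diff_times k (bump n a b)"
proof -
  have "diff_times k (\<lambda>x. flat 0 (real (Suc n) * x + - real (Suc n) * a) * flat 0 (- real (Suc n) * x + real (Suc n) * b))"
    by (intro diff_times_mult diff_times_affine diff_times_flat)
  then show ?thesis by (simp add: bump_def[abs_def] algebra_simps)
qed

lemma bump_bounds: "0 \<le> bump n a b x" "bump n a b x \<le> 1"
  unfolding bump_def flat_def by (auto intro!: mult_le_one)

lemma bump_eq_0: "x \<notin> {a<..<b} \<Longrightarrow> bump n a b x = 0"
  unfolding bump_def flat_def by (auto simp: zero_less_mult_iff)

lemma bump_tendsto: "(\<lambda>n. bump n a b x) \<longlonglongrightarrow> indicator {a<..<b} x"
proof (cases "x \<in> {a<..<b}")
  case True
  have "(\<lambda>n. flat 0 (real (Suc n) * d)) \<longlonglongrightarrow> 1" if "d > 0" for d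
  proof -
    have "(\<lambda>n. exp (- inverse (real (Suc n)) / d)) \<longlonglongrightarrow> exp (- 0 / d)"
      by (intro tendsto_intros LIMSEQ_inverse_real_of_nat) (use that in auto)
    moreover have "0 < real (Suc n) * d" for n using that by simp
    ultimately show ?thesis using that by (simp add: flat_def divide_inverse)
  qed
  from tendsto_mult[OF this this, of "x - a" "b - x"] show ?thesis using True
    by (simp add: bump_def)
next
  case False
  then show ?thesis by (simp add: bump_eq_0)
qed

lemma
  fixes x :: "real^2"
  assumes a: "\<And>x. (a has_real_derivative a' x) (at x)"
    and b: "\<And>x. (b has_real_derivative b' x) (at x)"
  shows product_has_derivative: "((\<lambda>x. a (x $ 1) * b (x $ 2)) has_derivative
      (\<lambda>h. a (x $ 1) * (h $ 2 * b' (x $ 2)) + (h $ 1 * a' (x $ 1)) * b (x $ 2))) (at x)"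
    and partial_1_product: "partial 1 (\<lambda>x. a (x $ 1) * b (x $ 2)) x = a' (x $ 1) * b (x $ 2)"
    and partial_2_product: "partial 2 (\<lambda>x. a (x $ 1) * b (x $ 2)) x = a (x $ 1) * b' (x $ 2)"
proof -
  have "((\<lambda>x. x $ i) has_derivative (\<lambda>x. x $ i)) (at x)" for i
    by (intro bounded_linear_imp_has_derivative bounded_linear_vec_nth)
  then show d: "((\<lambda>x. a (x $ 1) * b (x $ 2)) has_derivative
      (\<lambda>h. a (x $ 1) * (h $ 2 * b' (x $ 2)) + (h $ 1 * a' (x $ 1)) * b (x $ 2))) (at x)"
    by (intro has_derivative_mult DERIV_compose_FDERIV a b)
  show "partial 1 (\<lambda>x. a (x $ 1) * b (x $ 2)) x = a' (x $ 1) * b (x $ 2)"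
    and "partial 2 (\<lambda>x. a (x $ 1) * b (x $ 2)) x = a (x $ 1) * b' (x $ 2)"
    by (simp_all add: partial_def frechet_derivative_at[OF d, symmetric] axis_def)
qed

lemma Ck_product:
  assumes "diff_times k a" "diff_times k b"
  shows "Ck k (\<lambda>x. a (x $ 1) * b (x $ 2))"
  using assms
proof (induction k arbitrary: a b)
  case 0
  have "continuous_on UNIV (\<lambda>x::real^2. a (x $ 1))" "continuous_on UNIV (\<lambda>x::real^2. b (x $ 2))"
    using 0 continuous_on_compose2[of UNIV a UNIV "\<lambda>x::real^2. x $ 1"]
      continuous_on_compose2[of UNIV b UNIV "\<lambda>x::real^2. x $ 2"]
    by (simp_all add: continuous_on_component)
  then show ?case by (auto intro: continuous_on_mult)
next
  case (Suc k)
  then obtain a' b' where a': "\<And>x. (a has_real_derivative a' x) (at x)" "diff_times k a'"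
    and b': "\<And>x. (b has_real_derivative b' x) (at x)" "diff_times k b'" by auto
  note p = product_has_derivative[OF a'(1) b'(1)] partial_1_product[OF a'(1) b'(1)] partial_2_product[OF a'(1) b'(1)]
  have "Ck k (\<lambda>x. a' (x $ 1) * b (x $ 2))" "Ck k (\<lambda>x. a (x $ 1) * b' (x $ 2))"
    using a'(2) b'(2) Suc.prems[THEN diff_times_Suc_D] Suc.IH[of a' b] Suc.IH[of a b'] by blast+
  moreover have "partial 1 (\<lambda>x. a (x $ 1) * b (x $ 2)) = (\<lambda>x. a' (x $ 1) * b (x $ 2))"
    "partial 2 (\<lambda>x. a (x $ 1) * b (x $ 2)) = (\<lambda>x. a (x $ 1) * b' (x $ 2))"
    by (intro ext p)+
  ultimately show ?case using p(1) by (auto simp: forall_2 differentiable_def)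
qed

lemma product_test_function:
  assumes "\<And>k. diff_times k a" "\<And>k. diff_times k b"
    and "\<And>x. x \<notin> {l..u} \<Longrightarrow> a x = 0" "\<And>x. x \<notin> {l'..u'} \<Longrightarrow> b x = 0"
  shows "(\<lambda>x. a (x $ 1) * b (x $ 2)) \<in> test_functions"
proof -
  have "{x::real^2. a (x $ 1) * b (x $ 2) \<noteq> 0} \<subseteq> cbox (vector [l, l']) (vector [u, u'])"
    using assms(3,4) by (fastforce simp: mem_box_cart forall_2)
  then have "bounded {x::real^2. a (x $ 1) * b (x $ 2) \<noteq> 0}"
    using bounded_cbox bounded_subset by blast
  then show ?thesis using Ck_product assms(1,2) by (auto simp: test_functions_def compact_closure)
qed

lemma smooth_antiderivative:
  assumes "\<And>k. diff_times k f"
  obtains F where "\<And>x. (F has_real_derivative f x) (at x)" "\<And>k. diff_times k F"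
proof -
  have "continuous_on UNIV f" using assms[of 0] by simp
  then have "\<And>x. isCont f x" by (simp add: continuous_on_eq_continuous_at)
  then obtain F where "\<forall>x. (F has_vector_derivative f x) (at x)"
    using einterval_antiderivative[of "-\<infinity>" "\<infinity>" f] by auto
  then have F: "\<And>x. (F has_real_derivative f x) (at x)"
    by (simp add: has_real_derivative_iff_has_vector_derivative)
  then have "diff_times (Suc k) F" for k using assms by auto
  then have "diff_times k F" for k using diff_times_Suc_D by blast
  with F that show ?thesis by blast
qed

text \<open>\<open>F x - F (x - h)\<close> is the integral of the bump over an interval of length
  \<open>h\<close>. Subtracting the translate gives the derivative total integral 0, so this
  antiderivative has compact support and can serve as a factor of a test function; the mean value
  theorem puts it between 0 and \<open>h\<close>.\<close>

lemma bump_difference_antiderivative: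
  assumes "0 \<le> h"
  obtains \<alpha> where "\<And>x. (\<alpha> has_real_derivative bump n a b x - bump n a b (x - h)) (at x)"
    "\<And>k. diff_times k \<alpha>" "\<And>x. 0 \<le> \<alpha> x \<and> \<alpha> x \<le> h" "\<And>x. x \<notin> {a..b + h} \<Longrightarrow> \<alpha> x = 0"
proof -
  obtain F where F: "\<And>x. (F has_real_derivative bump n a b x) (at x)" "\<And>k. diff_times k F"
    using smooth_antiderivative[of "bump n a b"] diff_times_bump by metis
  define \<alpha> where "\<alpha> x = F x - F (x - h)" for x
  have d: "(\<alpha> has_real_derivative bump n a b x - bump n a b (x - h)) (at x)" for x
    unfolding \<alpha>_def using DERIV_shift[of F "bump n a b (x - h)" x "- h"] F(1)
    by (auto intro!: DERIV_diff)
  have s: "diff_times k \<alpha>" for k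
  proof -
    have "diff_times k (\<lambda>x. F x + (-1) * F (1 * x + - h))"
      by (intro diff_times_add diff_times_mult diff_times_const diff_times_affine F(2))
    then show ?thesis by (simp add: \<alpha>_def[abs_def])
  qed
  have mvt: "\<exists>z. x - h \<le> z \<and> z \<le> x \<and> \<alpha> x = h * bump n a b z" for x
  proof (cases "h = 0")
    case False
    then obtain z where "x - h < z" "z < x" "F x - F (x - h) = (x - (x - h)) * bump n a b z"
      using MVT2[of "x - h" x F "bump n a b"] F(1) assms by auto
    then show ?thesis by (intro exI[of _ z]) (auto simp: \<alpha>_def)
  qed (auto simp: \<alpha>_def)
  have b: "0 \<le> \<alpha> x \<and> \<alpha> x \<le> h" for x
  proof -
    obtain z where "\<alpha> x = h * bump n a b z" using mvt by blast
    then show ?thesis using bump_bounds[of n a b z] assms mult_left_mono[of "bump n a b z" 1 h] by auto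
  qed
  have "\<alpha> x = 0" if "x \<notin> {a..b + h}" for x
  proof -
    obtain z where "x - h \<le> z" "z \<le> x" "\<alpha> x = h * bump n a b z" using mvt by blast
    moreover have "z \<notin> {a<..<b}" using calculation that by auto
    ultimately show ?thesis by (simp add: bump_eq_0)
  qed
  with d s b that show ?thesis by blast
qed

section \<open>Weak derivatives tested on translated boxes\<close>

lemma vec_nth_measurable_lebesgue[measurable]: "(\<lambda>x::real^2. x $ i) \<in> borel_measurable lebesgue"
  by (rule measurable_completion) (simp add: borel_measurable_continuous_onI continuous_on_component)

lemma square_integrable_set_integrable:
  assumes "square_integrable f" "A \<in> sets lebesgue" "emeasure lebesgue A < \<infinity>"
  shows "set_integrable lebesgue A f"
  unfolding set_integrable_def
proof (rule Bochner_Integration.integrable_bound)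
  show "integrable lebesgue (\<lambda>x. indicator A x + (cmod (f x))\<^sup>2)"
    using assms by (intro Bochner_Integration.integrable_add integrable_real_indicator)
      (auto simp: square_integrable_def)
  show "(\<lambda>x. indicat_real A x *\<^sub>R f x) \<in> borel_measurable lebesgue"
    using assms by (auto simp: square_integrable_def intro!: borel_measurable_scaleR)
  have "a \<le> 1 + a\<^sup>2" for a :: real
    using sum_squares_bound[of a 1] by (simp add: power2_eq_square) (smt (verit) zero_le_square)
  then show "AE x in lebesgue. norm (indicat_real A x *\<^sub>R f x) \<le> norm (indicator A x + (cmod (f x))\<^sup>2)"
    by (intro AE_I2) (auto simp: indicator_def)
qed

lemma bounded_emeasure_finite: "bounded A \<Longrightarrow> A \<in> sets lebesgue \<Longrightarrow> emeasure lebesgue A < \<infinity>"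
  using bounded_set_imp_lmeasurable fmeasurableD2 by (metis infinity_ennreal_def less_top)

lemma square_integrable_rep: "square_integrable (rep_l2 u)"
  using Quotient_rep_reflp[OF Quotient_l2] by (simp add: l2_rel_def)

lemma rep_integrable: "bounded A \<Longrightarrow> A \<in> sets lebesgue \<Longrightarrow> set_integrable lebesgue A (rep_l2 u)"
  by (intro square_integrable_set_integrable square_integrable_rep bounded_emeasure_finite)

lemma rep_measurable[measurable]: "rep_l2 u \<in> borel_measurable lebesgue"
  using square_integrable_rep by (simp add: square_integrable_def)

definition bump2 :: "nat \<Rightarrow> real^2 \<Rightarrow> real^2 \<Rightarrow> real^2 \<Rightarrow> real" where
  "bump2 n a b x = bump n (a $ 1) (b $ 1) (x $ 1) * bump n (a $ 2) (b $ 2) (x $ 2)"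

lemma bump_measurable[measurable]: "bump n a b \<in> borel_measurable borel"
  using diff_times_bump[of 0] by (intro borel_measurable_continuous_onI) simp

lemma bump2_measurable[measurable]: "bump2 n a b \<in> borel_measurable lebesgue"
  unfolding bump2_def by measurable

lemma bump2_bounds: "0 \<le> bump2 n a b x" "bump2 n a b x \<le> 1"
  unfolding bump2_def by (auto intro!: mult_le_one mult_nonneg_nonneg bump_bounds)

lemma bump2_le_indicator: "bump2 n a b x \<le> indicator (box a b) x"
  by (auto simp: bump2_bounds indicator_def mem_box_cart forall_2) (auto simp: bump2_def bump_eq_0)

lemma bump2_tendsto: "(\<lambda>n. bump2 n a b x) \<longlonglongrightarrow> indicator (box a b) x"
proof -
  have "indicator (box a b) x = indicator {a $ 1<..<b $ 1} (x $ 1) * (indicator {a $ 2<..<b $ 2} (x $ 2) :: real)"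
    by (auto simp: indicator_def mem_box_cart forall_2)
  then show ?thesis unfolding bump2_def by (auto intro!: tendsto_mult bump_tendsto)
qed

lemma bump2_test_function: "bump2 n a b \<in> test_functions"
proof -
  have "(\<lambda>x::real^2. bump n (a $ 1) (b $ 1) (x $ 1) * bump n (a $ 2) (b $ 2) (x $ 2)) \<in> test_functions"
    by (rule product_test_function[where l = "a $ 1" and u = "b $ 1" and l' = "a $ 2" and u' = "b $ 2"])
      (auto intro: diff_times_bump bump_eq_0)
  then show ?thesis by (simp add: bump2_def[abs_def])
qed

lemma bump2_integral_tendsto:
  fixes f :: "real^2 \<Rightarrow> complex"
  assumes f: "set_integrable lebesgue (box a b) f" and [measurable]: "f \<in> borel_measurable lebesgue"
  shows "integrable lebesgue (\<lambda>x. bump2 n a b x *\<^sub>R f x)"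
    and "(\<lambda>n. LINT x|lebesgue. bump2 n a b x *\<^sub>R f x) \<longlonglongrightarrow> (LINT x:box a b|lebesgue. f x)"
proof -
  have dom: "norm (bump2 n a b x *\<^sub>R f x) \<le> norm (indicat_real (box a b) x *\<^sub>R f x)" for n x
    using bump2_le_indicator[of n a b x] bump2_bounds[of n a b x] by (auto intro!: mult_right_mono)
  show "integrable lebesgue (\<lambda>x. bump2 n a b x *\<^sub>R f x)"
    by (rule Bochner_Integration.integrable_bound[OF f[unfolded set_integrable_def]], measurable)
      (intro AE_I2 dom)
  show "(\<lambda>n. LINT x|lebesgue. bump2 n a b x *\<^sub>R f x) \<longlonglongrightarrow> (LINT x:box a b|lebesgue. f x)"
    unfolding set_lebesgue_integral_def
  proof (rule integral_dominated_convergence[where w = "\<lambda>x. norm (indicat_real (box a b) x *\<^sub>R f x)"])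
    show "integrable lebesgue (\<lambda>x. norm (indicat_real (box a b) x *\<^sub>R f x))"
      using f unfolding set_integrable_def by (rule integrable_norm)
    show "AE x in lebesgue. (\<lambda>n. bump2 n a b x *\<^sub>R f x) \<longlonglongrightarrow> indicat_real (box a b) x *\<^sub>R f x"
      by (intro AE_I2 tendsto_scaleR bump2_tendsto tendsto_const)
    show "AE x in lebesgue. norm (bump2 n a b x *\<^sub>R f x) \<le> norm (indicat_real (box a b) x *\<^sub>R f x)" for n
      by (intro AE_I2 dom)
    show "(\<lambda>x. indicat_real (box a b) x *\<^sub>R f x) \<in> borel_measurable lebesgue"
      using f unfolding set_integrable_def by (rule borel_measurable_integrable)
    show "(\<lambda>x. bump2 n a b x *\<^sub>R f x) \<in> borel_measurable lebesgue" for n by measurable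
  qed
qed

text \<open>A smoothed box indicator minus its translate is the \<open>i\<close>-th partial
  derivative of a test function that takes values between 0 and \<open>h\<close> and vanishes
  outside the region swept by the box. The definition of the weak derivative bounds the integral of
  \<open>u\<close> against it by the integral of \<open>v\<close> over this region, and the bumps
  then tend to the boxes.\<close>

lemma box_translation_le:
  assumes w: "weak_partial i u v" and h: "0 \<le> h"
  shows "cmod ((LINT x:box a b|lebesgue. rep_l2 u x)
      - (LINT x:box (a + axis i h) (b + axis i h)|lebesgue. rep_l2 u x))
    \<le> h * (LINT x:cbox a (b + axis i h)|lebesgue. cmod (rep_l2 v x))"
proof -
  define B where "B n x = bump2 n a b x - bump2 n (a + axis i h) (b + axis i h) x" for n x
  have ex: "\<exists>\<phi>\<in>test_functions. partial i \<phi> = B n \<and> (\<forall>x. 0 \<le> \<phi> x \<and> \<phi> x \<le> h * indicator (cbox a (b + axis i h)) x)" for n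
  proof -
    have shift: "bump n (a $ j + h) (b $ j + h) x = bump n (a $ j) (b $ j) (x - h)" for j x
      by (simp add: bump_def algebra_simps)
    obtain \<alpha> where \<alpha>: "\<And>x. (\<alpha> has_real_derivative bump n (a $ i) (b $ i) x - bump n (a $ i) (b $ i) (x - h)) (at x)"
      "\<And>k. diff_times k \<alpha>" "\<And>x. 0 \<le> \<alpha> x \<and> \<alpha> x \<le> h" "\<And>x. x \<notin> {a $ i..b $ i + h} \<Longrightarrow> \<alpha> x = 0"
      using bump_difference_antiderivative[OF h] by metis
    have "\<exists>f'. \<forall>x. (bump n (a $ j) (b $ j) has_real_derivative f' x) (at x)" for j
      using diff_times_bump[of "Suc 0" n "a $ j" "b $ j"] by auto
    then obtain \<beta> where \<beta>: "\<And>j x. (bump n (a $ j) (b $ j) has_real_derivative \<beta> j x) (at x)"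
      by metis
    have le: "p * q \<le> h" if "0 \<le> p" "p \<le> h" "0 \<le> q" "q \<le> 1" for p q
      using mult_mono[of p h q 1] that by simp
    consider "i = 1" | "i = 2" by (metis exhaust_2)
    then show ?thesis
    proof cases
      case 1
      let ?\<phi> = "\<lambda>x::real^2. \<alpha> (x $ 1) * bump n (a $ 2) (b $ 2) (x $ 2)"
      have "?\<phi> \<in> test_functions"
        by (rule product_test_function[where l = "a $ 1" and u = "b $ 1 + h" and l' = "a $ 2" and u' = "b $ 2"])
          (use \<alpha> 1 in \<open>auto intro: diff_times_bump bump_eq_0\<close>)
      moreover have "partial i ?\<phi> x = B n x" for x
        using partial_1_product[OF \<alpha>(1) \<beta>, of 2 x] 1
        by (simp add: B_def bump2_def axis_def shift[symmetric] algebra_simps)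
      moreover have "0 \<le> ?\<phi> x \<and> ?\<phi> x \<le> h * indicator (cbox a (b + axis i h)) x" for x
      proof (cases "x \<in> cbox a (b + axis i h)")
        case True
        then show ?thesis using \<alpha>(3)[of "x $ 1"] bump_bounds[of n "a $ 2" "b $ 2" "x $ 2"] le by simp
      next
        case False
        then have "x $ 1 \<notin> {a $ 1..b $ 1 + h} \<or> x $ 2 \<notin> {a $ 2<..<b $ 2}"
          using 1 by (auto simp: mem_box_cart forall_2 axis_def)
        then have "?\<phi> x = 0" using \<alpha>(4)[of "x $ 1"] bump_eq_0[of "x $ 2" "a $ 2" "b $ 2" n] 1 by auto
        then show ?thesis using False by auto
      qed
      ultimately show ?thesis by (intro bexI[of _ ?\<phi>]) auto
    next
      case 2
      let ?\<phi> = "\<lambda>x::real^2. bump n (a $ 1) (b $ 1) (x $ 1) * \<alpha> (x $ 2)"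
      have "?\<phi> \<in> test_functions"
        by (rule product_test_function[where l = "a $ 1" and u = "b $ 1" and l' = "a $ 2" and u' = "b $ 2 + h"])
          (use \<alpha> 2 in \<open>auto intro: diff_times_bump bump_eq_0\<close>)
      moreover have "partial i ?\<phi> x = B n x" for x
        using partial_2_product[OF \<beta> \<alpha>(1), of 1 x] 2
        by (simp add: B_def bump2_def axis_def shift[symmetric] algebra_simps)
      moreover have "0 \<le> ?\<phi> x \<and> ?\<phi> x \<le> h * indicator (cbox a (b + axis i h)) x" for x
      proof (cases "x \<in> cbox a (b + axis i h)")
        case True
        then show ?thesis using \<alpha>(3)[of "x $ 2"] bump_bounds[of n "a $ 1" "b $ 1" "x $ 1"]
            le[of "\<alpha> (x $ 2)" "bump n (a $ 1) (b $ 1) (x $ 1)"] by (simp add: mult.commute)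
      next
        case False
        then have "x $ 2 \<notin> {a $ 2..b $ 2 + h} \<or> x $ 1 \<notin> {a $ 1<..<b $ 1}"
          using 2 by (auto simp: mem_box_cart forall_2 axis_def)
        then have "?\<phi> x = 0" using \<alpha>(4)[of "x $ 2"] bump_eq_0[of "x $ 1" "a $ 1" "b $ 1" n] 2 by auto
        then show ?thesis using False by auto
      qed
      ultimately show ?thesis by (intro bexI[of _ ?\<phi>]) auto
    qed
  qed
  let ?R = "cbox a (b + axis i h)"
  have intV: "set_integrable lebesgue ?R (rep_l2 v)"
    by (rule rep_integrable) auto
  have intU: "set_integrable lebesgue (box a b) (rep_l2 u)" for a b
    by (rule rep_integrable) auto
  have "cmod (LINT x|lebesgue. B n x *\<^sub>R rep_l2 u x) \<le> h * (LINT x:?R|lebesgue. cmod (rep_l2 v x))" for n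
  proof -
    obtain \<phi> where \<phi>: "\<phi> \<in> test_functions" "partial i \<phi> = B n"
      "\<And>x. 0 \<le> \<phi> x \<and> \<phi> x \<le> h * indicator ?R x" using ex by blast
    have "(LINT x|lebesgue. B n x *\<^sub>R rep_l2 u x) = - (LINT x|lebesgue. \<phi> x *\<^sub>R rep_l2 v x)"
      using w \<phi>(1,2) unfolding weak_partial_def by metis
    then have "cmod (LINT x|lebesgue. B n x *\<^sub>R rep_l2 u x) = cmod (LINT x|lebesgue. \<phi> x *\<^sub>R rep_l2 v x)"
      by simp
    also have "\<dots> \<le> (LINT x|lebesgue. norm (\<phi> x *\<^sub>R rep_l2 v x))"
      by (rule integral_norm_bound)
    also have "\<dots> \<le> (LINT x|lebesgue. h * (indicator ?R x *\<^sub>R cmod (rep_l2 v x)))"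
    proof (rule integral_mono')
      show "integrable lebesgue (\<lambda>x. h * (indicat_real ?R x *\<^sub>R cmod (rep_l2 v x)))"
        using set_integrable_norm[OF intV] by (auto simp: set_integrable_def)
      show "norm (\<phi> x *\<^sub>R rep_l2 v x) \<le> h * (indicat_real ?R x *\<^sub>R cmod (rep_l2 v x))" for x
        using mult_right_mono[of "\<phi> x" "h * indicat_real ?R x" "cmod (rep_l2 v x)"] \<phi>(3)[of x]
        by (simp add: mult.assoc)
    qed (use h in auto)
    also have "\<dots> = h * (LINT x:?R|lebesgue. cmod (rep_l2 v x))"
      by (simp add: set_lebesgue_integral_def)
    finally show ?thesis .
  qed
  moreover have "(\<lambda>n. cmod (LINT x|lebesgue. B n x *\<^sub>R rep_l2 u x)) \<longlonglongrightarrow>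
     cmod ((LINT x:box a b|lebesgue. rep_l2 u x) - (LINT x:box (a + axis i h) (b + axis i h)|lebesgue. rep_l2 u x))"
  proof (intro tendsto_norm)
    have "(LINT x|lebesgue. B n x *\<^sub>R rep_l2 u x) = (LINT x|lebesgue. bump2 n a b x *\<^sub>R rep_l2 u x)
       - (LINT x|lebesgue. bump2 n (a + axis i h) (b + axis i h) x *\<^sub>R rep_l2 u x)" for n
      unfolding B_def scaleR_diff_left
      by (intro Bochner_Integration.integral_diff bump2_integral_tendsto(1) intU) auto
    then show "(\<lambda>n. LINT x|lebesgue. B n x *\<^sub>R rep_l2 u x) \<longlonglongrightarrow>
      (LINT x:box a b|lebesgue. rep_l2 u x) - (LINT x:box (a + axis i h) (b + axis i h)|lebesgue. rep_l2 u x)"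
      by (auto intro!: tendsto_diff bump2_integral_tendsto(2) intU)
  qed
  ultimately show ?thesis by (intro LIMSEQ_le_const2) auto
qed

subsection \<open>Averages of functions in \<open>W12\<close>\<close>

definition sqint :: "l2 \<Rightarrow> real^2 \<Rightarrow> real \<Rightarrow> complex" where
  "sqint u a s = (LINT x:box a (a + vec s)|lebesgue. rep_l2 u x)"

lemma sqint_eq_integral: "sqint u a s = integral (cbox a (a + vec s)) (rep_l2 u)"
proof -
  have "set_integrable lebesgue (box a (a + vec s)) (rep_l2 u)" by (rule rep_integrable) auto
  then show ?thesis unfolding sqint_def
    by (simp add: set_lebesgue_integral_eq_integral integral_open_interval)
qed

text \<open>Lebesgue's differentiation theorem for squares with their lower left corner at the
  point. All sequences are quantified inside, so that one null set serves them
  simultaneously.\<close>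

lemma rep_differentiation:
  "AE x in lebesgue. \<forall>s. (\<forall>n. 0 < s n) \<longrightarrow> s \<longlonglongrightarrow> 0 \<longrightarrow>
    (\<lambda>n. sqint u x (s n) /\<^sub>R (s n)\<^sup>2) \<longlonglongrightarrow> rep_l2 u x"
proof -
  have "rep_l2 u integrable_on cbox a b" for a b
  proof -
    have "set_integrable lebesgue (cbox a b) (rep_l2 u)" by (rule rep_integrable) auto
    then show ?thesis by (rule set_lebesgue_integral_eq_integral)
  qed
  from integrable_ccontinuous_explicit[OF this] obtain N where N: "negligible N"
    "\<And>x e. \<lbrakk>x \<notin> N; 0 < e\<rbrakk> \<Longrightarrow> \<exists>d>0. \<forall>h. 0 < h \<and> h < d \<longrightarrow>
        norm (integral (cbox x (x + h *\<^sub>R One)) (rep_l2 u) /\<^sub>R h ^ DIM(real^2) - rep_l2 u x) < e"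
    by blast
  have One: "h *\<^sub>R (One :: real^2) = vec h" for h
    by (simp add: vec_eq_iff inner_sum_Basis cart_eq_inner_axis inner_simps) (simp add: inner_axis)
  have "AE x in lebesgue. x \<notin> N"
    using N(1) by (simp add: negligible_iff_null_sets AE_not_in)
  then show ?thesis
  proof eventually_elim
    fix x assume x: "x \<notin> N"
    show "\<forall>s. (\<forall>n. 0 < s n) \<longrightarrow> s \<longlonglongrightarrow> 0 \<longrightarrow> (\<lambda>n. sqint u x (s n) /\<^sub>R (s n)\<^sup>2) \<longlonglongrightarrow> rep_l2 u x"
    proof (intro allI impI)
      fix s :: "nat \<Rightarrow> real" assume s: "\<forall>n. 0 < s n" "s \<longlonglongrightarrow> 0"
      show "(\<lambda>n. sqint u x (s n) /\<^sub>R (s n)\<^sup>2) \<longlonglongrightarrow> rep_l2 u x"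
      proof (rule tendstoI)
        fix e :: real assume "0 < e"
        then obtain d where d: "d > 0" "\<And>h. 0 < h \<Longrightarrow> h < d \<Longrightarrow>
            norm (integral (cbox x (x + h *\<^sub>R One)) (rep_l2 u) /\<^sub>R h ^ DIM(real^2) - rep_l2 u x) < e"
          using N(2)[OF x] by blast
        have "eventually (\<lambda>n. s n < d) sequentially" using order_tendstoD(2)[OF s(2) d(1)] .
        then show "eventually (\<lambda>n. dist (sqint u x (s n) /\<^sub>R (s n)\<^sup>2) (rep_l2 u x) < e) sequentially"
          by eventually_elim (use d(2) s(1) in \<open>simp add: dist_norm sqint_eq_integral One\<close>)
      qed
    qed
  qed
qed

text \<open>Almost every value of a representative is a limit of averages over squares.\<close>

lemma l2_eqI:
  assumes "\<And>a s. 0 < s \<Longrightarrow> sqint u a s = sqint v a s"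
  shows "u = v"
proof -
  have "AE x in lebesgue. rep_l2 u x = rep_l2 v x"
    using rep_differentiation[of u] rep_differentiation[of v]
  proof eventually_elim
    case (elim x)
    let ?s = "\<lambda>n. inverse (real (Suc n))"
    have s: "\<forall>n. 0 < ?s n" "?s \<longlonglongrightarrow> 0" by (simp, rule LIMSEQ_inverse_real_of_nat)
    have "(\<lambda>n. sqint u x (?s n) /\<^sub>R (?s n)\<^sup>2) \<longlonglongrightarrow> rep_l2 u x" by (rule elim(1)[THEN spec, THEN mp, THEN mp, OF s])
    moreover have "(\<lambda>n. sqint v x (?s n) /\<^sub>R (?s n)\<^sup>2) \<longlonglongrightarrow> rep_l2 v x" by (rule elim(2)[THEN spec, THEN mp, THEN mp, OF s])
    moreover have "sqint u x (?s n) = sqint v x (?s n)" for n by (rule assms) simp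
    ultimately show ?case by (simp add: LIMSEQ_unique)
  qed
  then have "l2_rel (rep_l2 u) (rep_l2 v)"
    by (simp add: l2_rel_def square_integrable_rep)
  then show ?thesis using Quotient_rel_rep[OF Quotient_l2] by blast
qed

lemma weak_partial_unique:
  assumes "weak_partial i u v" "weak_partial i u w"
  shows "v = w"
proof (rule l2_eqI)
  fix a :: "real^2" and s :: real
  let ?b = "a + vec s"
  have int: "set_integrable lebesgue (box a ?b) (rep_l2 z)" for z by (rule rep_integrable) auto
  have eq: "(LINT x|lebesgue. bump2 n a ?b x *\<^sub>R rep_l2 v x) = (LINT x|lebesgue. bump2 n a ?b x *\<^sub>R rep_l2 w x)" for n
    using assms(1)[unfolded weak_partial_def, THEN bspec, OF bump2_test_function[of n a ?b]]
      assms(2)[unfolded weak_partial_def, THEN bspec, OF bump2_test_function[of n a ?b]]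
    by simp
  show "sqint v a s = sqint w a s"
    unfolding sqint_def
    by (rule LIMSEQ_unique[OF bump2_integral_tendsto(2)[OF int[of v] rep_measurable, unfolded eq]
      bump2_integral_tendsto(2)[OF int[of w] rep_measurable]])
qed

lemma weak_partial_weak_deriv:
  assumes "u \<in> W12"
  shows "weak_partial i u (weak_deriv i u)"
proof -
  obtain v where "weak_partial i u v" using assms by (auto simp: W12_def)
  then have "\<exists>!v. weak_partial i u v" using weak_partial_unique by blast
  then show ?thesis unfolding weak_deriv_def by (rule theI')
qed

text \<open>The sum of the moduli dominates each partial derivative; its square is at most twice the
  Dirichlet density, which is one of the factors in the final constant.\<close>

definition gradient :: "l2 \<Rightarrow> real^2 \<Rightarrow> ennreal" where
  "gradient u x = ennreal (cmod (rep_l2 (weak_deriv 1 u) x) + cmod (rep_l2 (weak_deriv 2 u) x))"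

lemma gradient_measurable[measurable]: "gradient u \<in> borel_measurable lebesgue"
proof -
  have "(\<lambda>x. cmod (rep_l2 (weak_deriv 1 u) x) + cmod (rep_l2 (weak_deriv 2 u) x)) \<in> borel_measurable lebesgue"
    by (intro borel_measurable_add measurable_compose[OF rep_measurable borel_measurable_norm])
  then show ?thesis unfolding gradient_def[abs_def] by (rule measurable_compose[OF _ measurable_ennreal])
qed

lemma gradient_square_le:
  "(gradient u x)\<^sup>2 \<le> ennreal (2 * (\<Sum>i\<in>UNIV. (cmod (rep_l2 (weak_deriv i u) x))\<^sup>2))"
proof -
  have "(a + b)\<^sup>2 \<le> 2 * (a\<^sup>2 + b\<^sup>2)" for a b :: real
    using sum_squares_bound[of a b] by (simp add: power2_sum)
  note this[of "cmod (rep_l2 (weak_deriv 1 u) x)" "cmod (rep_l2 (weak_deriv 2 u) x)"]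
  then have "(cmod (rep_l2 (weak_deriv 1 u) x) + cmod (rep_l2 (weak_deriv 2 u) x))\<^sup>2
     \<le> 2 * (\<Sum>i\<in>UNIV. (cmod (rep_l2 (weak_deriv i u) x))\<^sup>2)" by (simp add: sum_2)
  moreover have "(gradient u x)\<^sup>2 = ennreal ((cmod (rep_l2 (weak_deriv 1 u) x) + cmod (rep_l2 (weak_deriv 2 u) x))\<^sup>2)"
    unfolding gradient_def by (rule ennreal_power) simp
  ultimately show ?thesis by (metis ennreal_leI)
qed

lemma gradient_square_finite: "(\<integral>\<^sup>+x. (gradient u x)\<^sup>2 \<partial>lebesgue) < \<infinity>"
proof -
  have "(\<integral>\<^sup>+x. (gradient u x)\<^sup>2 \<partial>lebesgue) \<le> (\<integral>\<^sup>+x. ennreal (2 * (\<Sum>i\<in>UNIV. (cmod (rep_l2 (weak_deriv i u) x))\<^sup>2)) \<partial>lebesgue)"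
    by (intro nn_integral_mono gradient_square_le)
  also have "\<dots> < \<infinity>"
  proof -
    have "integrable lebesgue (\<lambda>x. 2 * (\<Sum>i\<in>UNIV. (cmod (rep_l2 (weak_deriv i u) x))\<^sup>2))"
      using square_integrable_rep by (auto simp: square_integrable_def)
    then show ?thesis by (subst nn_integral_eq_integral) (auto intro!: sum_nonneg)
  qed
  finally show ?thesis .
qed

lemma sqint_translate:
  assumes u: "u \<in> W12" and h: "0 \<le> h" and sub: "cbox a (a + vec s + axis i h) \<subseteq> A"
    and [measurable]: "A \<in> sets lebesgue"
  shows "ennreal (cmod (sqint u a s - sqint u (a + axis i h) s)) \<le> ennreal h * (\<integral>\<^sup>+x\<in>A. gradient u x \<partial>lebesgue)"
proof -
  let ?v = "rep_l2 (weak_deriv i u)" and ?R = "cbox a (a + vec s + axis i h)"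
  have "sqint u (a + axis i h) s = (LINT x:box (a + axis i h) (a + vec s + axis i h)|lebesgue. rep_l2 u x)"
    unfolding sqint_def by (simp add: add.commute add.left_commute)
  then have "cmod (sqint u a s - sqint u (a + axis i h) s) \<le> h * (LINT x:?R|lebesgue. cmod (?v x))"
    using box_translation_le[OF weak_partial_weak_deriv[OF u] h, of a "a + vec s"] by (simp add: sqint_def)
  then have "ennreal (cmod (sqint u a s - sqint u (a + axis i h) s)) \<le> ennreal h * ennreal (LINT x:?R|lebesgue. cmod (?v x))"
    using h by (simp add: ennreal_mult'[symmetric] ennreal_leI)
  also have "ennreal (LINT x:?R|lebesgue. cmod (?v x)) = (\<integral>\<^sup>+x. ennreal (indicator ?R x *\<^sub>R cmod (?v x)) \<partial>lebesgue)"
  proof -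
    have "set_integrable lebesgue ?R ?v" by (rule rep_integrable) auto
    then have "set_integrable lebesgue ?R (\<lambda>x. cmod (?v x))" by (rule set_integrable_norm)
    then show ?thesis unfolding set_lebesgue_integral_def set_integrable_def
      by (subst nn_integral_eq_integral) auto
  qed
  also have "\<dots> \<le> (\<integral>\<^sup>+x\<in>A. gradient u x \<partial>lebesgue)"
  proof (rule nn_integral_mono)
    fix x
    have "cmod (?v x) \<le> cmod (rep_l2 (weak_deriv 1 u) x) + cmod (rep_l2 (weak_deriv 2 u) x)"
      using exhaust_2[of i] by auto
    then show "ennreal (indicator ?R x *\<^sub>R cmod (?v x)) \<le> gradient u x * indicator A x"
      using sub ennreal_leI by (auto simp: indicator_def gradient_def simp del: ennreal_plus)
  qed
  finally show ?thesis by (simp add: mult_left_mono)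
qed

lemma square_emeasure: "0 \<le> s \<Longrightarrow> emeasure lebesgue (cbox a (a + vec s :: real^2)) = ennreal (s\<^sup>2)"
proof -
  assume s: "0 \<le> s"
  then have "cbox a (a + vec s :: real^2) \<noteq> {}" by (simp add: interval_ne_empty_cart)
  then have "measure lborel (cbox a (a + vec s)) = s\<^sup>2"
    by (simp add: content_cbox_cart prod_2 power2_eq_square UNIV_2)
  then show ?thesis using emeasure_lborel_cbox_finite[of a "a + vec s"]
    by (simp add: emeasure_eq_ennreal_measure less_top)
qed

text \<open>Absolute continuity of the Dirichlet integral; it holds at every point, not merely
  almost everywhere.\<close>

lemma gradient_concentration:
  assumes "r \<longlonglongrightarrow> 0"
  shows "(\<lambda>n. \<integral>\<^sup>+y\<in>cball x (r n). (gradient u y)\<^sup>2 \<partial>lebesgue) \<longlonglongrightarrow> 0"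
proof -
  have "(\<lambda>n. \<integral>\<^sup>+y\<in>cball x (r n). (gradient u y)\<^sup>2 \<partial>lebesgue) \<longlonglongrightarrow> (\<integral>\<^sup>+y. 0 \<partial>(lebesgue :: (real^2) measure))"
  proof (rule nn_integral_dominated_convergence[where w = "\<lambda>y. (gradient u y)\<^sup>2"])
    have "{x} \<in> null_sets (lebesgue :: (real^2) measure)" by (simp flip: negligible_iff_null_sets)
    then have "AE y in lebesgue. y \<noteq> x" using AE_not_in by fastforce
    then show "AE y in lebesgue. (\<lambda>n. (gradient u y)\<^sup>2 * indicator (cball x (r n)) y) \<longlonglongrightarrow> 0"
    proof eventually_elim
      fix y assume "y \<noteq> x"
      then have "eventually (\<lambda>n. r n < dist x y) sequentially"
        using order_tendstoD(2)[OF assms, of "dist x y"] by simp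
      then have "eventually (\<lambda>n. (gradient u y)\<^sup>2 * indicator (cball x (r n)) y = 0) sequentially"
        by eventually_elim simp
      then show "(\<lambda>n. (gradient u y)\<^sup>2 * indicator (cball x (r n)) y) \<longlonglongrightarrow> 0"
        by (rule tendsto_eventually)
    qed
    show "(\<integral>\<^sup>+y. (gradient u y)\<^sup>2 \<partial>lebesgue) < \<infinity>" by (rule gradient_square_finite)
    show "(\<lambda>y. (gradient u y)\<^sup>2 * indicator (cball x (r n)) y) \<in> borel_measurable lebesgue" for n
      by (intro borel_measurable_times_ennreal borel_measurable_indicator borel_measurable_power) auto
    show "AE y in lebesgue. (gradient u y)\<^sup>2 * indicator (cball x (r n)) y \<le> (gradient u y)\<^sup>2" for n
      by (intro AE_I2) (simp add: indicator_def)
  qed measurable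
  then show ?thesis by simp
qed

text \<open>The square is moved along one axis and then along the other; both sweeps stay in the
  square of twice the side.\<close>

lemma sqint_offset:
  assumes u: "u \<in> W12" and s: "0 \<le> s" and x: "\<And>i. a $ i \<le> x $ i \<and> x $ i \<le> a $ i + s"
  shows "ennreal (cmod (sqint u a s - sqint u x s)) \<le> 2 * ennreal s * (\<integral>\<^sup>+y\<in>cbox a (a + vec (2 * s)). gradient u y \<partial>lebesgue)"
    (is "_ \<le> 2 * ennreal s * ?I")
proof -
  define h where "h i = x $ i - a $ i" for i
  have h: "0 \<le> h i" "h i \<le> s" for i using x[of i] by (auto simp: h_def)
  define b where "b = a + axis 1 (h 1)"
  have xb: "x = b + axis 2 (h 2)"
    by (auto simp: vec_eq_iff forall_2 b_def h_def axis_def)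
  have 1: "ennreal (cmod (sqint u a s - sqint u b s)) \<le> ennreal (h 1) * ?I"
    unfolding b_def using h[of 1] h[of 2] s by (intro sqint_translate u) (auto simp: mem_box_cart forall_2 axis_def)
  have 2: "ennreal (cmod (sqint u b s - sqint u x s)) \<le> ennreal (h 2) * ?I"
    unfolding xb using h[of 1] h[of 2] s by (intro sqint_translate u) (auto simp: mem_box_cart forall_2 axis_def b_def)
  have "cmod (sqint u a s - sqint u x s) \<le> cmod (sqint u a s - sqint u b s) + cmod (sqint u b s - sqint u x s)"
    using norm_triangle_ineq[of "sqint u a s - sqint u b s" "sqint u b s - sqint u x s"] by simp
  then have "ennreal (cmod (sqint u a s - sqint u x s)) \<le> ennreal (cmod (sqint u a s - sqint u b s)) + ennreal (cmod (sqint u b s - sqint u x s))"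
    by (subst ennreal_plus[symmetric]) (simp_all add: ennreal_leI del: ennreal_plus)
  also have "\<dots> \<le> ennreal s * ?I + ennreal s * ?I"
    using h by (intro add_mono order_trans[OF 1] order_trans[OF 2] mult_right_mono ennreal_leI) auto
  also have "\<dots> = 2 * ennreal s * ?I" by (simp only: mult_2 distrib_right)
  finally show ?thesis .
qed

text \<open>The squares contain \<open>x\<close> but need not have it as a corner. Their averages
  differ from those over corner squares by at most \<open>2 / s\<close> times the integral of the
  gradient over a square of side \<open>2 * s\<close>. After the Cauchy-Schwarz inequality the
  powers of \<open>s\<close> cancel, because the Dirichlet integral is scale invariant in the plane,
  and what remains is the Dirichlet integral near \<open>x\<close>, which tends to 0.\<close>

lemma averages_tendsto:
  assumes u: "u \<in> W12"
  shows "AE x in lebesgue. \<forall>a s. (\<forall>n. 0 < s n) \<longrightarrow> s \<longlonglongrightarrow> 0 \<longrightarrow>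
    (\<forall>n i. a n $ i \<le> x $ i \<and> x $ i \<le> a n $ i + s n) \<longrightarrow>
    (\<lambda>n. sqint u (a n) (s n) /\<^sub>R (s n)\<^sup>2) \<longlonglongrightarrow> rep_l2 u x"
  using rep_differentiation[of u]
proof (eventually_elim, intro allI impI)
  fix x and a :: "nat \<Rightarrow> real^2" and s :: "nat \<Rightarrow> real"
  assume lim: "\<forall>s. (\<forall>n. 0 < s n) \<longrightarrow> s \<longlonglongrightarrow> 0 \<longrightarrow> (\<lambda>n. sqint u x (s n) /\<^sub>R (s n)\<^sup>2) \<longlonglongrightarrow> rep_l2 u x"
    and s: "\<forall>n. 0 < s n" "s \<longlonglongrightarrow> 0" and x: "\<forall>n i. a n $ i \<le> x $ i \<and> x $ i \<le> a n $ i + s n"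
  let ?d = "\<lambda>n. cmod ((sqint u (a n) (s n) - sqint u x (s n)) /\<^sub>R (s n)\<^sup>2)"
  have le: "(ennreal (?d n))\<^sup>2 \<le> 16 * (\<integral>\<^sup>+y\<in>cball x (4 * s n). (gradient u y)\<^sup>2 \<partial>lebesgue)" for n
  proof -
    have sn: "0 < s n" using s by simp
    let ?C = "cbox (a n) (a n + vec (2 * s n))"
    let ?G = "\<integral>\<^sup>+y\<in>?C. gradient u y \<partial>lebesgue" and ?S = "\<integral>\<^sup>+y\<in>?C. (gradient u y)\<^sup>2 \<partial>lebesgue"
    have sub: "?C \<subseteq> cball x (4 * s n)"
    proof
      fix y assume y: "y \<in> ?C"
      have "\<bar>(x - y) $ i\<bar> \<le> 2 * s n" for i
        using y x sn by (auto simp: mem_box_cart abs_le_iff) (smt (verit))+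
      then have "(\<Sum>i\<in>UNIV. \<bar>(x - y) $ i\<bar>) \<le> 4 * s n" using sum_mono[of UNIV "\<lambda>i. \<bar>(x - y) $ i\<bar>" "\<lambda>_. 2 * s n"] by simp
      then have "norm (x - y) \<le> 4 * s n" using norm_le_l1_cart[of "x - y"] by simp
      then show "y \<in> cball x (4 * s n)" by (simp add: dist_norm)
    qed
    have "ennreal (?d n) = ennreal (1 / (s n)\<^sup>2) * ennreal (cmod (sqint u (a n) (s n) - sqint u x (s n)))"
      using sn by (simp add: divide_inverse ennreal_mult'')
    also have "\<dots> \<le> ennreal (1 / (s n)\<^sup>2) * (2 * ennreal (s n) * ?G)"
      using sn x by (intro mult_left_mono sqint_offset u) auto
    finally have "(ennreal (?d n))\<^sup>2 \<le> (ennreal (1 / (s n)\<^sup>2) * (2 * ennreal (s n) * ?G))\<^sup>2"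
      by (rule power_mono) simp
    also have "\<dots> = (ennreal (1 / (s n)\<^sup>2) * (2 * ennreal (s n)))\<^sup>2 * ?G\<^sup>2"
      by (simp add: power_mult_distrib mult.assoc)
    also have "?G\<^sup>2 \<le> ennreal ((2 * s n)\<^sup>2) * ?S"
      using square_integral_le[of ?C lebesgue "gradient u"] square_emeasure[of "2 * s n" "a n"] sn by simp
    also have "(ennreal (1 / (s n)\<^sup>2) * (2 * ennreal (s n)))\<^sup>2 * (ennreal ((2 * s n)\<^sup>2) * ?S) = 16 * ?S"
    proof -
      have "(ennreal (1 / (s n)\<^sup>2) * (2 * ennreal (s n)))\<^sup>2 * ennreal ((2 * s n)\<^sup>2)
        = ennreal ((1 / (s n)\<^sup>2 * (2 * s n))\<^sup>2 * (2 * s n)\<^sup>2)"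
        using sn by (simp add: ennreal_mult ennreal_power[symmetric] del: times_divide_eq_left)
      also have "(1 / (s n)\<^sup>2 * (2 * s n))\<^sup>2 * (2 * s n)\<^sup>2 = 16"
        using sn by (simp add: field_simps power2_eq_square)
      finally show ?thesis by (simp add: mult.assoc[symmetric])
    qed
    also have "?S \<le> (\<integral>\<^sup>+y\<in>cball x (4 * s n). (gradient u y)\<^sup>2 \<partial>lebesgue)"
      using sub by (intro nn_integral_mono) (auto simp: indicator_def)
    finally show ?thesis by (simp add: mult_left_mono)
  qed
  have "(\<lambda>n. 16 * (\<integral>\<^sup>+y\<in>cball x (4 * s n). (gradient u y)\<^sup>2 \<partial>lebesgue)) \<longlonglongrightarrow> 16 * 0"
    using tendsto_mult_right[OF s(2), of 4] by (intro ennreal_tendsto_cmult gradient_concentration) auto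
  then have lim0: "(\<lambda>n. 16 * (\<integral>\<^sup>+y\<in>cball x (4 * s n). (gradient u y)\<^sup>2 \<partial>lebesgue)) \<longlonglongrightarrow> 0"
    by simp
  have "(\<lambda>n. (ennreal (?d n))\<^sup>2) \<longlonglongrightarrow> 0"
    by (rule tendsto_sandwich[OF _ _ tendsto_const lim0]) (simp, intro always_eventually allI le)
  then have "(\<lambda>n. ennreal ((?d n)\<^sup>2)) \<longlonglongrightarrow> ennreal 0"
    by (simp add: ennreal_power)
  then have "(\<lambda>n. (?d n)\<^sup>2) \<longlonglongrightarrow> 0"
    by (subst (asm) tendsto_ennreal_iff) auto
  then have "(\<lambda>n. sqrt ((?d n)\<^sup>2)) \<longlonglongrightarrow> sqrt 0" by (rule tendsto_real_sqrt)
  then have "?d \<longlonglongrightarrow> 0" by (simp only: real_sqrt_abs abs_norm_cancel real_sqrt_zero)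
  then have "(\<lambda>n. (sqint u (a n) (s n) - sqint u x (s n)) /\<^sub>R (s n)\<^sup>2) \<longlonglongrightarrow> 0"
    by (rule tendsto_norm_zero_cancel)
  moreover have "(\<lambda>n. sqint u x (s n) /\<^sub>R (s n)\<^sup>2) \<longlonglongrightarrow> rep_l2 u x" using lim s by blast
  ultimately have "(\<lambda>n. (sqint u (a n) (s n) - sqint u x (s n)) /\<^sub>R (s n)\<^sup>2 + sqint u x (s n) /\<^sub>R (s n)\<^sup>2) \<longlonglongrightarrow> 0 + rep_l2 u x"
    by (rule tendsto_add)
  then show "(\<lambda>n. sqint u (a n) (s n) /\<^sub>R (s n)\<^sup>2) \<longlonglongrightarrow> rep_l2 u x"
    by (simp add: scaleR_diff_right)
qed

subsection \<open>The tree of dyadic squares of the Riemann sphere\<close>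

text \<open>Half-open, so that the squares of a grid partition the plane; the open and the closed
  square differ from it by null sets.\<close>

definition hsq :: "real^2 \<Rightarrow> real \<Rightarrow> (real^2) set" where
  "hsq a s = {y. \<forall>i. a $ i \<le> y $ i \<and> y $ i < a $ i + s}"

lemma hsq_sets_borel[measurable]: "hsq a s \<in> sets borel"
proof -
  have "{y::real^2. a $ i \<le> y $ i \<and> y $ i < a $ i + s} \<in> sets borel" for i
  proof -
    have [measurable]: "(\<lambda>y::real^2. y $ i) \<in> borel_measurable borel"
      by (simp add: borel_measurable_continuous_onI continuous_on_component)
    have "{y \<in> space borel. a $ i \<le> y $ i \<and> y $ i < a $ i + s} \<in> sets borel" by measurable
    then show ?thesis by simp
  qed
  then have "{y::real^2. a $ 1 \<le> y $ 1 \<and> y $ 1 < a $ 1 + s} \<inter> {y. a $ 2 \<le> y $ 2 \<and> y $ 2 < a $ 2 + s} \<in> sets borel"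
    by (intro sets.Int)
  moreover have "hsq a s = {y::real^2. a $ 1 \<le> y $ 1 \<and> y $ 1 < a $ 1 + s} \<inter> {y. a $ 2 \<le> y $ 2 \<and> y $ 2 < a $ 2 + s}"
    by (auto simp: hsq_def forall_2)
  ultimately show ?thesis by simp
qed

lemma hsq_sets[measurable]: "hsq a s \<in> sets lebesgue"
  by (rule sets_completionI_sets) simp

lemma box_subset_hsq: "box a (a + vec s) \<subseteq> hsq a s"
  and hsq_subset_cbox: "hsq a s \<subseteq> cbox a (a + vec s)"
  by (auto simp: hsq_def mem_box_cart less_imp_le)

lemma box_cbox_negligible: "cbox a (b::real^2) - box a b \<in> null_sets lebesgue"
  using negligible_frontier_interval[of a b] by (simp add: negligible_iff_null_sets)

lemma AE_hsq_iff: "AE x in lebesgue. x \<in> hsq a s \<longleftrightarrow> x \<in> cbox a (a + vec s)"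
  using AE_not_in[OF box_cbox_negligible[of a "a + vec s"]]
  by eventually_elim (use box_subset_hsq[of a s] hsq_subset_cbox[of a s] in auto)

lemma emeasure_hsq: "0 \<le> s \<Longrightarrow> emeasure lebesgue (hsq a s) = ennreal (s\<^sup>2)"
  using square_emeasure[of s a] AE_hsq_iff[of a s]
  by (subst emeasure_eq_AE[of _ "cbox a (a + vec s)"]) auto

definition sqr :: "nat \<Rightarrow> (real^2) set" where
  "sqr n = hsq (- vec (2 ^ n)) (2 * 2 ^ n)"

lemma mem_sqr: "x \<in> sqr n \<longleftrightarrow> (\<forall>i. - (2 ^ n) \<le> x $ i \<and> x $ i < 2 ^ n)"
  by (simp add: sqr_def hsq_def)

lemma sqr_sets[measurable]: "sqr n \<in> sets lebesgue"
  by (simp add: sqr_def)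

lemma emeasure_sqr: "emeasure lebesgue (sqr n) = ennreal (4 * 4 ^ n)"
proof -
  have "(2 * 2 ^ n)\<^sup>2 = (4 * 4 ^ n :: real)"
    by (simp add: power_mult_distrib power2_eq_square flip: power_mult_distrib)
  then show ?thesis using emeasure_hsq[of "2 * 2 ^ n"] by (simp add: sqr_def)
qed

lemma sqr_mono: "m \<le> n \<Longrightarrow> sqr m \<subseteq> sqr n"
proof
  fix x assume "m \<le> n" "x \<in> sqr m"
  moreover from \<open>m \<le> n\<close> have "(2::real) ^ m \<le> 2 ^ n" by (rule power_increasing) simp
  ultimately show "x \<in> sqr n" unfolding mem_sqr by (meson le_minus_iff less_le_trans minus_le_iff neg_le_iff_le order_trans)
qed

lemma ex_sqr: "\<exists>n. x \<in> sqr n"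
proof -
  obtain n where n: "norm x < 2 ^ n" using real_arch_pow[of 2 "norm x"] by auto
  have "- (2 ^ n) \<le> x $ i \<and> x $ i < 2 ^ n" for i
    using component_le_norm_cart[of x i] n by (auto simp: abs_le_iff)
  then show ?thesis by (auto simp: mem_sqr)
qed

text \<open>A dyadic logarithm: \<open>2 ^ lev x\<close> is comparable to
  \<open>1 + norm x\<close>.\<close>

definition lev :: "real^2 \<Rightarrow> nat" where
  "lev x = (LEAST n. x \<in> sqr n)"

lemma lev_le_iff: "lev x \<le> n \<longleftrightarrow> x \<in> sqr n"
proof
  assume "lev x \<le> n"
  moreover have "x \<in> sqr (lev x)" unfolding lev_def by (rule LeastI_ex) (rule ex_sqr)
  ultimately show "x \<in> sqr n" using sqr_mono by blast
next
  show "x \<in> sqr n \<Longrightarrow> lev x \<le> n" unfolding lev_def by (rule Least_le)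
qed

lemma lev_eq_iff: "lev x = n \<longleftrightarrow> x \<in> sqr n \<and> (n = 0 \<or> x \<notin> sqr (n - 1))"
  unfolding lev_le_iff[symmetric] by auto

lemma lev_measurable[measurable]: "lev \<in> lebesgue \<rightarrow>\<^sub>M count_space UNIV"
proof (subst measurable_count_space_eq_countable, simp, intro conjI ballI)
  fix n
  have "lev -` {n} \<inter> space lebesgue = (if n = 0 then sqr n else sqr n - sqr (n - 1))"
    by (rule set_eqI) (use lev_eq_iff[of _ n] in simp)
  then show "lev -` {n} \<inter> space lebesgue \<in> sets lebesgue" by simp
qed auto

text \<open>At distance \<open>2 ^ m\<close> from the origin the metric of the sphere is about
  \<open>4 ^ -m\<close> times the Euclidean one, so this side has length of order
  \<open>2 ^ -k\<close> on the sphere.\<close>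

definition side :: "nat \<Rightarrow> nat \<Rightarrow> real" where
  "side k m = 4 ^ m / 2 ^ k"

lemma side_pos[simp]: "0 < side k m"
  by (simp add: side_def)

lemma side_Suc: "side (Suc k) m = side k m / 2"
  by (simp add: side_def)

text \<open>\<open>None\<close> stands for the exterior node \<open>{x. k \<le> lev x}\<close>. The side length is such that interior nodes
  have measure \<open>4^-k\<close> with respect to the weight \<open>16^-lev\<close>.\<close>

definition gcode :: "nat \<Rightarrow> real^2 \<Rightarrow> (nat \<times> int \<times> int) option" where
  "gcode k x = (if lev x < k then Some (lev x, \<lfloor>x $ 1 / side k (lev x)\<rfloor>, \<lfloor>x $ 2 / side k (lev x)\<rfloor>) else None)"

lemma gcode_eq_None: "gcode k x = None \<longleftrightarrow> k \<le> lev x"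
  by (auto simp: gcode_def)

lemma gcode_eq_Some: "gcode k x = Some (m, p, q) \<longleftrightarrow>
   m < k \<and> lev x = m \<and> \<lfloor>x $ 1 / side k m\<rfloor> = p \<and> \<lfloor>x $ 2 / side k m\<rfloor> = q"
  by (auto simp: gcode_def)

lemma gcode_measurable: "gcode k \<in> lebesgue \<rightarrow>\<^sub>M count_space UNIV"
proof (subst measurable_count_space_eq_countable, simp, intro conjI ballI)
  fix c :: "(nat \<times> int \<times> int) option"
  show "gcode k -` {c} \<inter> space lebesgue \<in> sets lebesgue"
  proof (cases c)
    case None
    have "{x \<in> space lebesgue. k \<le> lev x} \<in> sets lebesgue" by measurable
    moreover have "gcode k -` {c} \<inter> space lebesgue = {x \<in> space lebesgue. k \<le> lev x}"
      using None by (auto simp: gcode_eq_None)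
    ultimately show ?thesis by simp
  next
    case (Some d)
    obtain m p q where d: "d = (m, p, q)" by (cases d)
    have "{x \<in> space lebesgue. m < k \<and> lev x = m \<and> \<lfloor>x $ 1 / side k m\<rfloor> = p \<and> \<lfloor>x $ 2 / side k m\<rfloor> = q} \<in> sets lebesgue"
      by measurable
    moreover have "gcode k -` {c} \<inter> space lebesgue = {x \<in> space lebesgue. m < k \<and> lev x = m \<and> \<lfloor>x $ 1 / side k m\<rfloor> = p \<and> \<lfloor>x $ 2 / side k m\<rfloor> = q}"
      using Some d by (auto simp: gcode_eq_Some)
    ultimately show ?thesis by (simp only:)
  qed
qed auto

definition corner :: "nat \<Rightarrow> real^2 \<Rightarrow> real^2" where
  "corner k x = (\<chi> i. side k (lev x) * of_int \<lfloor>x $ i / side k (lev x)\<rfloor>)"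

lemma floor_eq_iff_interval: "0 < s \<Longrightarrow> \<lfloor>y / s\<rfloor> = n \<longleftrightarrow> s * of_int n \<le> y \<and> y < s * of_int n + (s::real)"
  by (simp add: floor_eq_iff field_simps)

lemma floor_bounds_iff: "0 < s \<Longrightarrow> - (s * of_int n) \<le> y \<and> y < s * of_int n \<longleftrightarrow> - n \<le> \<lfloor>y / s\<rfloor> \<and> \<lfloor>y / (s::real)\<rfloor> < n"
  by (simp add: le_floor_iff floor_less_iff field_simps)

text \<open>The grid of mesh \<open>side k m\<close> is aligned with the two squares
  \<open>sqr m\<close> and \<open>sqr (m - 1)\<close> that bound the level \<open>m\<close>, since
  \<open>2 ^ n\<close> is the mesh times \<open>2 ^ (n + k - 2 * m)\<close>. Because of
  \<open>m < k\<close> and \<open>m \<le> n + 1\<close> the subtraction in the exponent does not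
  truncate.\<close>

lemma sqr_floor:
  assumes "m < k" "n = m \<or> Suc n = m"
  shows "y \<in> sqr n \<longleftrightarrow> (\<forall>i. - (2 ^ (n + k - 2 * m)) \<le> \<lfloor>y $ i / side k m\<rfloor> \<and> \<lfloor>y $ i / side k m\<rfloor> < 2 ^ (n + k - 2 * m))"
proof -
  have "(2::real) ^ (n + k - 2 * m) * 2 ^ (2 * m) = 2 ^ n * 2 ^ k"
    using assms by (auto simp flip: power_add)
  moreover have "(2::real) ^ (2 * m) = 4 ^ m" by (simp add: power_mult)
  ultimately have "4 ^ m * (2::real) ^ (n + k - 2 * m) = 2 ^ n * 2 ^ k" by (simp only: mult.commute)
  then have "side k m * of_int (2 ^ (n + k - 2 * m)) = 2 ^ n"
    by (simp add: side_def divide_eq_eq)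
  then show ?thesis unfolding mem_sqr
    using floor_bounds_iff[of "side k m" "2 ^ (n + k - 2 * m)"] by simp
qed

text \<open>By this alignment a grid square that meets a level lies entirely in it, so interior
  nodes are full squares.\<close>

lemma same_floor_lev:
  assumes "lev x < k" "\<And>i. \<lfloor>y $ i / side k (lev x)\<rfloor> = \<lfloor>x $ i / side k (lev x)\<rfloor>"
  shows "lev y = lev x"
proof -
  let ?m = "lev x"
  have "y \<in> sqr ?m \<longleftrightarrow> x \<in> sqr ?m"
    using sqr_floor[OF assms(1), of ?m y] sqr_floor[OF assms(1), of ?m x] assms(2) by simp
  moreover have "?m \<noteq> 0 \<Longrightarrow> y \<in> sqr (?m - 1) \<longleftrightarrow> x \<in> sqr (?m - 1)"
    using sqr_floor[OF assms(1), of "?m - 1" y] sqr_floor[OF assms(1), of "?m - 1" x] assms(2) by simp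
  ultimately show ?thesis using lev_eq_iff[of x ?m] lev_eq_iff[of y ?m] by auto
qed

lemma gcode_node_interior:
  assumes "lev x < k"
  shows "{y. gcode k y = gcode k x} = hsq (corner k x) (side k (lev x))"
proof -
  let ?s = "side k (lev x)"
  have "gcode k y = gcode k x \<longleftrightarrow> (\<forall>i. \<lfloor>y $ i / ?s\<rfloor> = \<lfloor>x $ i / ?s\<rfloor>)" for y
  proof
    assume "gcode k y = gcode k x"
    then show "\<forall>i. \<lfloor>y $ i / ?s\<rfloor> = \<lfloor>x $ i / ?s\<rfloor>"
      using assms by (auto simp: gcode_def forall_2 split: if_splits)
  next
    assume *: "\<forall>i. \<lfloor>y $ i / ?s\<rfloor> = \<lfloor>x $ i / ?s\<rfloor>"
    then have "lev y = lev x" using same_floor_lev[OF assms, of y] by simp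
    then show "gcode k y = gcode k x" using * by (simp add: gcode_def)
  qed
  then show ?thesis by (auto simp: hsq_def corner_def floor_eq_iff_interval[OF side_pos])
qed

lemma gcode_node_exterior:
  assumes "k \<le> lev x"
  shows "{y. gcode k y = gcode k x} = {y. k \<le> lev y}"
  using assms by (auto simp: gcode_def)

lemma gcode_refine: "gcode (Suc k) x = gcode (Suc k) y \<Longrightarrow> gcode k x = gcode k y"
proof (cases "lev x < Suc k")
  case True
  assume eq: "gcode (Suc k) x = gcode (Suc k) y"
  then have lev: "lev y = lev x" using True by (auto simp: gcode_def split: if_splits)
  have half: "\<lfloor>z / side k (lev x)\<rfloor> = \<lfloor>z / side (Suc k) (lev x)\<rfloor> div 2" for z
    using floor_divide_real_eq_div[of 2 "z / side (Suc k) (lev x)"] by (simp add: side_Suc)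
  show ?thesis using eq True lev by (auto simp: gcode_def half split: if_splits)
next
  case False
  assume "gcode (Suc k) x = gcode (Suc k) y"
  then show ?thesis using False by (auto simp: gcode_def split: if_splits)
qed

text \<open>A square has four children. The exterior node of level \<open>k\<close> splits into the
  next exterior node and squares of side \<open>2 ^ k / 2\<close> inside \<open>sqr k\<close>, whose
  indices lie in a 4 by 4 grid.\<close>

lemma gcode_children:
  "\<exists>S. finite S \<and> card S \<le> 17 \<and> (\<forall>y. gcode k y = gcode k x \<longrightarrow> gcode (Suc k) y \<in> S)"
proof (cases "lev x < k")
  case True
  define p where "p = \<lfloor>x $ 1 / side k (lev x)\<rfloor>"
  define q where "q = \<lfloor>x $ 2 / side k (lev x)\<rfloor>"
  define S where "S = (\<lambda>(i, j). Some (lev x, i, j)) ` ({2 * p, 2 * p + 1} \<times> {2 * q, 2 * q + 1})"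
  have half: "\<lfloor>z / side k (lev x)\<rfloor> = \<lfloor>z / side (Suc k) (lev x)\<rfloor> div 2" for z
    using floor_divide_real_eq_div[of 2 "z / side (Suc k) (lev x)"] by (simp add: side_Suc)
  have "gcode (Suc k) y \<in> S" if "gcode k y = gcode k x" for y
  proof -
    have "lev y = lev x" "\<lfloor>y $ 1 / side (Suc k) (lev x)\<rfloor> div 2 = p" "\<lfloor>y $ 2 / side (Suc k) (lev x)\<rfloor> div 2 = q"
      using that True by (auto simp: gcode_def p_def q_def half split: if_splits)
    moreover have "i div 2 = j \<Longrightarrow> i = 2 * j \<or> i = 2 * j + 1" for i j :: int by presburger
    ultimately show ?thesis using True by (auto simp: gcode_def S_def)
  qed
  moreover have "card S \<le> card ({2 * p, 2 * p + 1} \<times> {2 * q, 2 * q + 1})" unfolding S_def by (rule card_image_le) simp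
  moreover have "finite S" by (simp add: S_def)
  ultimately show ?thesis by (intro exI[of _ S]) (auto simp: card_cartesian_product)
next
  case False
  define S where "S = insert None ((\<lambda>(i, j). Some (k, i, j)) ` ({-2..1::int} \<times> {-2..1::int}))"
  have "gcode (Suc k) y \<in> S" if "gcode k y = gcode k x" for y
  proof (cases "lev y = k")
    case True
    then have "y \<in> sqr k" using lev_eq_iff by blast
    then have "- 2 \<le> \<lfloor>y $ i / side (Suc k) k\<rfloor> \<and> \<lfloor>y $ i / side (Suc k) k\<rfloor> < 2" for i
      using sqr_floor[of k "Suc k" k y] by simp
    then show ?thesis using True by (force simp: gcode_def S_def)
  next
    case False': False
    have "k \<le> lev y" using that False by (auto simp: gcode_def split: if_splits)
    then show ?thesis using False' by (auto simp: gcode_def S_def)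
  qed
  moreover have "card S \<le> Suc (card ((\<lambda>(i, j). Some (k, i, j)) ` ({-2..1::int} \<times> {-2..1::int})))"
    unfolding S_def by (rule card_insert_le_m1) auto
  moreover have "card ((\<lambda>(i, j). Some (k, i, j)) ` ({-2..1::int} \<times> {-2..1::int})) \<le> card ({-2..1::int} \<times> {-2..1::int})"
    by (rule card_image_le) simp
  moreover have "finite S" by (simp add: S_def)
  ultimately show ?thesis by (intro exI[of _ S]) (auto simp: card_cartesian_product)
qed

section \<open>Areas of the nodes on the sphere\<close>

definition wt :: "real^2 \<Rightarrow> ennreal" where
  "wt x = ennreal (1 / 16 ^ lev x)"

lemma wt_measurable[measurable]: "wt \<in> borel_measurable lebesgue"
  unfolding wt_def[abs_def] by (rule measurable_compose[OF lev_measurable]) simp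

definition Mw :: "(real^2) measure" where
  "Mw = density lebesgue wt"

lemma sets_Mw[simp, measurable_cong]: "sets Mw = sets lebesgue"
  by (simp add: Mw_def)

lemma space_Mw[simp]: "space Mw = UNIV"
  by (simp add: Mw_def)

lemma emeasure_Mw: "A \<in> sets lebesgue \<Longrightarrow> (\<And>x. x \<in> A \<Longrightarrow> lev x = m) \<Longrightarrow>
  emeasure Mw A = ennreal (1 / 16 ^ m) * emeasure lebesgue A"
proof -
  assume A: "A \<in> sets lebesgue" and m: "\<And>x. x \<in> A \<Longrightarrow> lev x = m"
  have "emeasure Mw A = (\<integral>\<^sup>+x. wt x * indicator A x \<partial>lebesgue)"
    unfolding Mw_def using A by (intro emeasure_density) auto
  also have "\<dots> = (\<integral>\<^sup>+x. ennreal (1 / 16 ^ m) * indicator A x \<partial>lebesgue)"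
    using m by (intro nn_integral_cong) (auto simp: wt_def indicator_def)
  finally show ?thesis using A by (simp add: nn_integral_cmult_indicator)
qed

lemma Mw_interior:
  assumes "lev x < k"
  shows "emeasure Mw {y. gcode k y = gcode k x} = ennreal (1 / 4 ^ k)"
proof -
  have "lev y = lev x" if "gcode k y = gcode k x" for y using that assms by (auto simp: gcode_def split: if_splits)
  moreover have S: "{y. gcode k y = gcode k x} \<in> sets lebesgue"
    unfolding gcode_node_interior[OF assms] by (rule hsq_sets)
  ultimately have "emeasure Mw {y. gcode k y = gcode k x} = ennreal (1 / 16 ^ lev x) * emeasure lebesgue {y. gcode k y = gcode k x}"
    by (intro emeasure_Mw[OF S]) blast
  also have "\<dots> = ennreal (1 / 16 ^ lev x * (side k (lev x))\<^sup>2)"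
    unfolding gcode_node_interior[OF assms] emeasure_hsq[OF less_imp_le[OF side_pos]]
    by (rule ennreal_mult[symmetric]) simp_all
  also have "1 / 16 ^ lev x * (side k (lev x))\<^sup>2 = 1 / 4 ^ k"
  proof -
    have "(4 ^ m)\<^sup>2 = (16 ^ m :: real)" "(2 ^ k)\<^sup>2 = (4 ^ k :: real)" for m
      by (simp_all add: power2_eq_square flip: power_mult_distrib)
    then show ?thesis by (simp add: side_def power_divide)
  qed
  finally show ?thesis .
qed

lemma Mw_annulus: "emeasure Mw {y. lev y = Suc m} = ennreal (3 / 4 * (1 / 4 ^ m))"
proof -
  have eq: "{y. lev y = Suc m} = sqr (Suc m) - sqr m" by (rule set_eqI) (simp add: lev_eq_iff)
  have "emeasure lebesgue (sqr (Suc m) - sqr m) = emeasure lebesgue (sqr (Suc m)) - emeasure lebesgue (sqr m)"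
    by (rule emeasure_Diff) (auto simp: emeasure_sqr sqr_mono)
  also have "\<dots> = ennreal (4 * 4 ^ Suc m - 4 * 4 ^ m)"
    by (simp only: emeasure_sqr) (rule ennreal_minus, simp)
  finally have "emeasure Mw {y. lev y = Suc m} = ennreal (1 / 16 ^ Suc m) * ennreal (4 * 4 ^ Suc m - 4 * 4 ^ m)"
    using emeasure_Mw[of "sqr (Suc m) - sqr m" "Suc m"] eq by auto
  also have "\<dots> = ennreal (1 / 16 ^ Suc m * (4 * 4 ^ Suc m - 4 * 4 ^ m))"
    by (rule ennreal_mult[symmetric]) simp_all
  also have "1 / 16 ^ Suc m * (4 * 4 ^ Suc m - 4 * 4 ^ m) = (3 / 4 * (1 / 4 ^ m) :: real)"
  proof -
    have "(16::real) ^ m = 4 ^ m * 4 ^ m" by (simp flip: power_mult_distrib)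
    then show ?thesis by (simp add: field_simps)
  qed
  finally show ?thesis .
qed

lemma lev_sets[measurable]: "{y. k \<le> lev y} \<in> sets lebesgue" "{y. lev y = k} \<in> sets lebesgue"
proof -
  have "{x \<in> space lebesgue. k \<le> lev x} \<in> sets lebesgue" "{x \<in> space lebesgue. lev x = k} \<in> sets lebesgue"
    by measurable
  then show "{y. k \<le> lev y} \<in> sets lebesgue" "{y. lev y = k} \<in> sets lebesgue" by simp_all
qed

lemma Mw_exterior_Suc: "emeasure Mw {y. Suc k \<le> lev y} = ennreal (1 / 4 ^ k)"
proof -
  have "{y. Suc k \<le> lev y} = (\<Union>i. {y. lev y = Suc (k + i)})"
    by (auto simp: le_iff_add)
  then have "emeasure Mw {y. Suc k \<le> lev y} = (\<Sum>i. emeasure Mw {y. lev y = Suc (k + i)})"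
    by (simp only:) (rule suminf_emeasure[symmetric], auto simp: disjoint_family_on_def)
  also have "\<dots> = (\<Sum>i. ennreal (3 / 4 * (1 / 4 ^ k) * (1 / 4) ^ i))"
    by (simp add: Mw_annulus power_add power_one_over mult.assoc)
  also have "\<dots> = ennreal (1 / 4 ^ k)"
  proof (rule suminf_ennreal_eq)
    have "(\<lambda>i. 3 / 4 * (1 / 4 ^ k) * (1 / 4 :: real) ^ i) sums (3 / 4 * (1 / 4 ^ k) * (1 / (1 - 1 / 4)))"
      by (intro sums_mult geometric_sums) simp
    moreover have "3 / 4 * (1 / 4 ^ k) * (1 / (1 - 1 / 4)) = (1 / 4 ^ k :: real)" by simp
    ultimately show "(\<lambda>i. 3 / 4 * (1 / 4 ^ k) * (1 / 4 :: real) ^ i) sums (1 / 4 ^ k)" by (simp only:)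
  qed simp
  finally show ?thesis .
qed

lemma Mw_total: "emeasure Mw UNIV = 5"
proof -
  have "emeasure Mw {y. lev y = 0} = 4"
    using emeasure_Mw[of "{y. lev y = 0}" 0] emeasure_sqr[of 0] by (simp add: lev_eq_iff)
  moreover have "emeasure Mw ({y. lev y = 0} \<union> {y. Suc 0 \<le> lev y}) = emeasure Mw {y. lev y = 0} + emeasure Mw {y. Suc 0 \<le> lev y}"
    by (rule plus_emeasure[symmetric]) auto
  moreover have "{y. lev y = 0} \<union> {y. Suc 0 \<le> lev y} = UNIV" by auto
  ultimately show ?thesis using Mw_exterior_Suc[of 0] by simp
qed

text \<open>From level 1 on the exterior node has area exactly \<open>4 / 4 ^ k\<close>, so
  consecutive ones have ratio exactly 4; the root has area 5.\<close>

lemma Mw_exterior_bounds: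
  "ennreal (1 / 4 ^ k) \<le> emeasure Mw {y. k \<le> lev y}"
  "emeasure Mw {y. k \<le> lev y} \<le> 5 * ennreal (1 / 4 ^ k)"
  "4 * emeasure Mw {y. Suc k \<le> lev y} \<le> emeasure Mw {y. k \<le> lev y}"
proof -
  have "emeasure Mw {y. k \<le> lev y} = (if k = 0 then 5 else ennreal (4 * (1 / 4 ^ k)))"
    using Mw_total Mw_exterior_Suc[of "k - 1"] by (cases k) auto
  moreover have "5 * ennreal (1 / 4 ^ k) = ennreal (5 * (1 / 4 ^ k))" "4 * ennreal (1 / 4 ^ k) = ennreal (4 * (1 / 4 ^ k))"
    by (simp_all add: ennreal_mult del: times_divide_eq_right)
  ultimately show "ennreal (1 / 4 ^ k) \<le> emeasure Mw {y. k \<le> lev y}"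
    "emeasure Mw {y. k \<le> lev y} \<le> 5 * ennreal (1 / 4 ^ k)"
    "4 * emeasure Mw {y. Suc k \<le> lev y} \<le> emeasure Mw {y. k \<le> lev y}"
    by (auto intro!: ennreal_leI simp: Mw_exterior_Suc divide_right_mono simp flip: ennreal_numeral)
qed

definition pot_measure :: "(real^2 \<Rightarrow> real) \<Rightarrow> (real^2) measure" where
  "pot_measure V = density lebesgue (\<lambda>x. ennreal (V x))"

lemma locally_integrable_measurable:
  assumes "locally_integrable V"
  shows "V \<in> borel_measurable lebesgue"
proof (rule borel_measurable_LIMSEQ_real)
  have "set_integrable lebesgue (cball 0 (real n)) V" for n
    using assms by (simp add: locally_integrable_def)
  then show "(\<lambda>x. indicator (cball 0 (real n)) x *\<^sub>R V x) \<in> borel_measurable lebesgue" for n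
    unfolding set_integrable_def by (rule borel_measurable_integrable)
  fix x :: "real^2"
  obtain N where "norm x \<le> real N" using real_arch_simple by blast
  then have "eventually (\<lambda>n. indicator (cball 0 (real n)) x *\<^sub>R V x = V x) sequentially"
    unfolding eventually_sequentially by (intro exI[of _ N]) auto
  then show "(\<lambda>n. indicator (cball 0 (real n)) x *\<^sub>R V x) \<longlonglongrightarrow> V x" by (rule tendsto_eventually)
qed

lemma dyadic_tree_plane:
  assumes V: "locally_integrable V"
  shows "dyadic_tree Mw (pot_measure V) gcode"
proof -
  have [measurable]: "V \<in> borel_measurable lebesgue" using V by (rule locally_integrable_measurable)
  have sfM: "sigma_finite_measure Mw"
    by (intro finite_measure.axioms(1) finite_measureI) (simp add: Mw_total)
  have sfN: "sigma_finite_measure (pot_measure V)"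
  proof
    let ?A = "range (\<lambda>n. cball 0 (real n) :: (real^2) set)"
    have "emeasure (pot_measure V) (cball 0 (real n)) \<noteq> \<infinity>" for n
    proof -
      have "set_integrable lebesgue (cball 0 (real n)) V" using V by (simp add: locally_integrable_def)
      then have i: "integrable lebesgue (\<lambda>x. indicator (cball 0 (real n)) x *\<^sub>R V x)" by (simp add: set_integrable_def)
      have "emeasure (pot_measure V) (cball 0 (real n)) = (\<integral>\<^sup>+x. ennreal (V x) * indicator (cball 0 (real n)) x \<partial>lebesgue)"
        unfolding pot_measure_def by (rule emeasure_density) auto
      also have "\<dots> \<le> (\<integral>\<^sup>+x. ennreal (norm (indicator (cball 0 (real n)) x *\<^sub>R V x)) \<partial>lebesgue)"
        by (intro nn_integral_mono) (auto simp: indicator_def intro!: ennreal_leI)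
      also have "\<dots> < \<infinity>" using i by (simp add: integrable_iff_bounded)
      finally show ?thesis by simp
    qed
    moreover have "\<Union> ?A = space (pot_measure V)"
      using real_arch_simple by (auto simp: pot_measure_def)
    ultimately show "\<exists>A. countable A \<and> A \<subseteq> sets (pot_measure V) \<and> \<Union> A = space (pot_measure V) \<and> (\<forall>a\<in>A. emeasure (pot_measure V) a \<noteq> \<infinity>)"
      by (intro exI[of _ ?A]) (auto simp: pot_measure_def)
  qed
  interpret M: sigma_finite_measure Mw by fact
  interpret N: sigma_finite_measure "pot_measure V" by fact
  show ?thesis
  proof
    show "space Mw = UNIV" by simp
    show "sets (pot_measure V) = sets Mw" by (simp add: pot_measure_def)
    show "gcode k \<in> Mw \<rightarrow>\<^sub>M count_space UNIV" for k
      using gcode_measurable measurable_cong_sets[OF sets_Mw refl] by blast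
    show "gcode 0 x = gcode 0 y" for x y by (simp add: gcode_def)
    show "gcode (Suc k) x = gcode (Suc k) y \<Longrightarrow> gcode k x = gcode k y" for k x y by (rule gcode_refine)
    show "A \<in> null_sets (pot_measure V)" if "A \<in> null_sets Mw" for A
    proof -
      have "A \<in> null_sets lebesgue"
      proof -
        have "A \<in> sets lebesgue" "AE x in lebesgue. x \<in> A \<longrightarrow> wt x = 0"
          using that by (simp_all add: Mw_def null_sets_density_iff)
        moreover have "wt x \<noteq> 0" for x by (simp add: wt_def)
        ultimately show ?thesis using AE_iff_null_sets by auto
      qed
      then show ?thesis unfolding pot_measure_def
        by (subst null_sets_density_iff) (auto dest: AE_not_in elim: eventually_mono)
    qed
    fix k x
    show "ennreal (1 / 4 ^ k) \<le> emeasure Mw {y. gcode k y = gcode k x}"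
      "emeasure Mw {y. gcode k y = gcode k x} \<le> 5 * ennreal (1 / 4 ^ k)"
    proof -
      have "ennreal (1 / 4 ^ k) \<le> 5 * ennreal (1 / 4 ^ k)"
        using mult_right_mono[of 1 "5::ennreal"] by simp
      then show "ennreal (1 / 4 ^ k) \<le> emeasure Mw {y. gcode k y = gcode k x}"
      "emeasure Mw {y. gcode k y = gcode k x} \<le> 5 * ennreal (1 / 4 ^ k)"
        using Mw_interior[of x k] Mw_exterior_bounds[of k] gcode_node_exterior[of k x] by (cases "lev x < k"; simp)+
    qed
    show "4 * emeasure Mw {y. gcode (Suc k) y = gcode (Suc k) x} \<le> emeasure Mw {y. gcode k y = gcode k x}"
    proof (cases "lev x < Suc k")
      case True
      have "4 * ennreal (1 / 4 ^ Suc k) = ennreal (1 / 4 ^ k)"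
        by (simp flip: ennreal_mult ennreal_numeral)
      then show ?thesis
        using True Mw_interior[of x "Suc k"] Mw_interior[of x k] Mw_exterior_bounds(1)[of k] gcode_node_exterior[of k x]
        by (cases "lev x < k") auto
    next
      case False
      then show ?thesis
        using Mw_exterior_bounds(3)[of k] gcode_node_exterior[of k x] gcode_node_exterior[of "Suc k" x] by simp
    qed
    show "\<exists>S. finite S \<and> card S \<le> 17 \<and> (\<forall>y. gcode k y = gcode k x \<longrightarrow> gcode (Suc k) y \<in> S)"
      by (rule gcode_children)
  qed
qed

subsection \<open>Averages over neighbouring nodes\<close>

definition pt :: "real \<Rightarrow> real \<Rightarrow> real^2" where
  "pt p q = (\<chi> i. if i = 1 then p else q)"

lemma pt_nth[simp]: "pt p q $ 1 = p" "pt p q $ 2 = q"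
  by (simp_all add: pt_def)

lemma vec2_eq_iff: "x = y \<longleftrightarrow> x $ 1 = y $ 1 \<and> x $ 2 = (y::real^2) $ 2"
  by (simp add: vec_eq_iff forall_2)

lemma axis_nth_2[simp]: "axis 1 h $ 1 = (h::real)" "axis (1::2) h $ 2 = 0" "axis (2::2) h $ 1 = 0" "axis 2 h $ (2::2) = h"
  by (simp_all add: axis_def)

text \<open>Only squares of one side length \<open>s\<close> are compared, so the normalization by
  \<open>s ^ 2\<close> is postponed.\<close>

definition sqdist :: "l2 \<Rightarrow> real \<Rightarrow> real^2 \<Rightarrow> real^2 \<Rightarrow> ennreal" where
  "sqdist u s b c = ennreal (cmod (sqint u b s - sqint u c s))"

lemma sqdist_triangle: "sqdist u s b d \<le> sqdist u s b c + sqdist u s c d"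
proof -
  have "cmod (sqint u b s - sqint u d s) \<le> cmod (sqint u b s - sqint u c s) + cmod (sqint u c s - sqint u d s)"
    using norm_triangle_ineq[of "sqint u b s - sqint u c s" "sqint u c s - sqint u d s"] by simp
  then show ?thesis unfolding sqdist_def
    by (subst ennreal_plus[symmetric]) (simp_all add: ennreal_leI del: ennreal_plus)
qed

lemma sqdist_commute: "sqdist u s b c = sqdist u s c b"
  by (simp add: sqdist_def norm_minus_commute)

context
  fixes u :: l2 and A :: "(real^2) set" and s :: real
  assumes u: "u \<in> W12" and A[measurable]: "A \<in> sets lebesgue"
begin

text \<open>The translation estimate goes in the positive direction; a move backwards is the
  reversed move from the other square. The hypothesis on \<open>A\<close> says that it contains
  everything the square sweeps.\<close>

lemma sqdist_move:
  assumes eq: "\<And>j. j \<noteq> i \<Longrightarrow> b $ j = c $ j" and d: "\<bar>b $ i - c $ i\<bar> \<le> d"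
    and hull: "\<And>y. (\<And>j. min (b $ j) (c $ j) \<le> y $ j \<and> y $ j \<le> max (b $ j) (c $ j) + s) \<Longrightarrow> y \<in> A"
  shows "sqdist u s b c \<le> ennreal d * (\<integral>\<^sup>+x\<in>A. gradient u x \<partial>lebesgue)"
proof -
  have *: "sqdist u s b (b + axis i h) \<le> ennreal d * (\<integral>\<^sup>+x\<in>A. gradient u x \<partial>lebesgue)"
    if h: "0 \<le> h" "h \<le> d" and sub: "cbox b (b + vec s + axis i h) \<subseteq> A" for b h
  proof -
    have "sqdist u s b (b + axis i h) \<le> ennreal h * (\<integral>\<^sup>+x\<in>A. gradient u x \<partial>lebesgue)"
      unfolding sqdist_def by (rule sqint_translate[OF u h(1) sub A])
    also have "\<dots> \<le> ennreal d * (\<integral>\<^sup>+x\<in>A. gradient u x \<partial>lebesgue)"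
      using h by (intro mult_right_mono ennreal_leI) auto
    finally show ?thesis .
  qed
  show ?thesis
  proof (cases "b $ i \<le> c $ i")
    case True
    have c: "c = b + axis i (c $ i - b $ i)"
      using eq by (auto simp: vec_eq_iff axis_def)
    have "cbox b (b + vec s + axis i (c $ i - b $ i)) \<subseteq> A"
    proof
      fix y assume y: "y \<in> cbox b (b + vec s + axis i (c $ i - b $ i))"
      show "y \<in> A"
      proof (rule hull)
        fix j show "min (b $ j) (c $ j) \<le> y $ j \<and> y $ j \<le> max (b $ j) (c $ j) + s"
          using y eq[of j] True by (cases "j = i") (auto simp: mem_box_cart axis_def dest!: spec[of _ j] split: if_splits)
      qed
    qed
    from *[OF _ _ this] show ?thesis using True d c by simp
  next
    case False
    have b: "b = c + axis i (b $ i - c $ i)"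
      using eq by (auto simp: vec_eq_iff axis_def)
    have "cbox c (c + vec s + axis i (b $ i - c $ i)) \<subseteq> A"
    proof
      fix y assume y: "y \<in> cbox c (c + vec s + axis i (b $ i - c $ i))"
      show "y \<in> A"
      proof (rule hull)
        fix j show "min (b $ j) (c $ j) \<le> y $ j \<and> y $ j \<le> max (b $ j) (c $ j) + s"
          using y eq[of j] False by (cases "j = i") (auto simp: mem_box_cart axis_def dest!: spec[of _ j] split: if_splits)
      qed
    qed
    from *[OF _ _ this] show ?thesis using False d b by (simp add: sqdist_commute[of u s b])
  qed
qed

lemma sqdist_diagonal:
  assumes d: "\<bar>b $ 1 - c $ 1\<bar> \<le> d" "\<bar>b $ 2 - c $ 2\<bar> \<le> d"
    and hull: "\<And>y. (\<And>j. min (b $ j) (c $ j) \<le> y $ j \<and> y $ j \<le> max (b $ j) (c $ j) + s) \<Longrightarrow> y \<in> A"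
  shows "sqdist u s b c \<le> 2 * (ennreal d * (\<integral>\<^sup>+x\<in>A. gradient u x \<partial>lebesgue))"
proof -
  let ?e = "pt (c $ 1) (b $ 2)"
  have "sqdist u s b ?e \<le> ennreal d * (\<integral>\<^sup>+x\<in>A. gradient u x \<partial>lebesgue)"
  proof (rule sqdist_move[where i = 1])
    show "\<bar>b $ 1 - ?e $ 1\<bar> \<le> d" using d by simp
    show "b $ j = ?e $ j" if "j \<noteq> 1" for j using that exhaust_2[of j] by auto
    show "y \<in> A" if H: "\<And>j. min (b $ j) (?e $ j) \<le> y $ j \<and> y $ j \<le> max (b $ j) (?e $ j) + s" for y
    proof (rule hull)
      show "min (b $ j) (c $ j) \<le> y $ j \<and> y $ j \<le> max (b $ j) (c $ j) + s" for j
        using H[of j] exhaust_2[of j] by auto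
    qed
  qed
  moreover have "sqdist u s ?e c \<le> ennreal d * (\<integral>\<^sup>+x\<in>A. gradient u x \<partial>lebesgue)"
  proof (rule sqdist_move[where i = 2])
    show "\<bar>?e $ 2 - c $ 2\<bar> \<le> d" using d by simp
    show "?e $ j = c $ j" if "j \<noteq> 2" for j using that exhaust_2[of j] by auto
    show "y \<in> A" if H: "\<And>j. min (?e $ j) (c $ j) \<le> y $ j \<and> y $ j \<le> max (?e $ j) (c $ j) + s" for y
    proof (rule hull)
      show "min (b $ j) (c $ j) \<le> y $ j \<and> y $ j \<le> max (b $ j) (c $ j) + s" for j
        using H[of j] exhaust_2[of j] by auto
    qed
  qed
  ultimately show ?thesis
    using order_trans[OF sqdist_triangle[of u s b c ?e] add_mono] by (simp only: mult_2)
qed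

text \<open>The squares lie in the ring between the squares of half side \<open>s\<close> and
  \<open>2 * s\<close>. A direct path may cross the hole, where the gradient must not be used
  because it lies outside the exterior node. Walking around the ring takes at most three
  axis-parallel moves of length at most \<open>3 * s\<close>.\<close>

lemma sqdist_ring:
  assumes s: "0 < s" and A': "\<And>y. (\<And>i. \<bar>y $ i\<bar> \<le> 2 * s) \<Longrightarrow> s \<le> \<bar>y $ 1\<bar> \<or> s \<le> \<bar>y $ 2\<bar> \<Longrightarrow> y \<in> A"
    and pq: "p \<in> {-2..1}" "q \<in> {-2..1}" "p \<notin> {-1..0} \<or> q \<notin> {-1..(0::int)}"
  shows "sqdist u s (pt s 0) (pt (s * of_int p) (s * of_int q)) \<le> 3 * (ennreal (3 * s) * (\<integral>\<^sup>+x\<in>A. gradient u x \<partial>lebesgue))"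
    (is "_ \<le> 3 * ?e")
proof -
  have p: "p = -2 \<or> p = -1 \<or> p = 0 \<or> p = 1" and q: "q = -2 \<or> q = -1 \<or> q = 0 \<or> q = 1" using pq by auto
  have vert: "sqdist u s (pt x y) (pt x y') \<le> ?e" if "x = s \<or> x = - 2 * s" "- 2 * s \<le> y" "y \<le> s" "- 2 * s \<le> y'" "y' \<le> s" for x y y'
  proof (rule sqdist_move[where i = 2])
    show "\<bar>pt x y $ 2 - pt x y' $ 2\<bar> \<le> 3 * s" using that by auto
    fix j :: 2 assume "j \<noteq> 2" then show "pt x y $ j = pt x y' $ j" using exhaust_2[of j] by auto
  next
    fix w :: "real^2" assume w: "\<And>j. min (pt x y $ j) (pt x y' $ j) \<le> w $ j \<and> w $ j \<le> max (pt x y $ j) (pt x y' $ j) + s"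
    have 1: "x \<le> w $ 1" "w $ 1 \<le> x + s" using w[of 1] by simp_all
    have 2: "min y y' \<le> w $ 2" "w $ 2 \<le> max y y' + s" using w[of 2] by simp_all
    have "\<bar>w $ 1\<bar> \<le> 2 * s" "\<bar>w $ 2\<bar> \<le> 2 * s" "s \<le> \<bar>w $ 1\<bar>" using 1 2 that s by linarith+
    then show "w \<in> A" using exhaust_2 by (intro A') (metis, simp)
  qed
  have horiz: "sqdist u s (pt x y) (pt x' y) \<le> ?e" if "y = s \<or> y = - 2 * s" "- 2 * s \<le> x" "x \<le> s" "- 2 * s \<le> x'" "x' \<le> s" for x x' y
  proof (rule sqdist_move[where i = 1])
    show "\<bar>pt x y $ 1 - pt x' y $ 1\<bar> \<le> 3 * s" using that by auto
    fix j :: 2 assume "j \<noteq> 1" then show "pt x y $ j = pt x' y $ j" using exhaust_2[of j] by auto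
  next
    fix w :: "real^2" assume w: "\<And>j. min (pt x y $ j) (pt x' y $ j) \<le> w $ j \<and> w $ j \<le> max (pt x y $ j) (pt x' y $ j) + s"
    have 1: "y \<le> w $ 2" "w $ 2 \<le> y + s" using w[of 2] by simp_all
    have 2: "min x x' \<le> w $ 1" "w $ 1 \<le> max x x' + s" using w[of 1] by simp_all
    have "\<bar>w $ 1\<bar> \<le> 2 * s" "\<bar>w $ 2\<bar> \<le> 2 * s" "s \<le> \<bar>w $ 2\<bar>" using 1 2 that s by linarith+
    then show "w \<in> A" using exhaust_2 by (intro A') (metis, simp)
  qed
  have three: "?e + ?e + ?e = 3 * ?e"
  proof -
    have "3 * ?e = (1 + 1 + 1) * ?e" by simp
    also have "\<dots> = ?e + ?e + ?e" by (simp only: distrib_right mult_1)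
    finally show ?thesis ..
  qed
  let ?P = "pt (s * of_int p) (s * of_int q)"
  \<comment> \<open>The target lies in the bottom or top row, in the column of the starting square,
    or in the middle of the opposite column.\<close>
  consider "q = -2 \<or> q = 1" | "p = 1" | "p = -2" "q = -1 \<or> q = 0" using p q pq(3) by auto
  then show ?thesis
  proof cases
    case 1
    have "sqdist u s (pt s 0) ?P \<le> sqdist u s (pt s 0) (pt s (s * of_int q)) + sqdist u s (pt s (s * of_int q)) ?P"
      by (rule sqdist_triangle)
    also have "\<dots> \<le> ?e + ?e"
      using 1 p s by (intro add_mono vert horiz) auto
    also have "\<dots> \<le> ?e + ?e + ?e" by simp
    finally show ?thesis unfolding three .
  next
    case 2
    have "sqdist u s (pt s 0) ?P \<le> ?e" using 2 q s by (auto intro!: vert)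
    also have "?e \<le> ?e + ?e + ?e" by (simp add: add.assoc)
    finally show ?thesis unfolding three .
  next
    case 3
    have "sqdist u s (pt s 0) ?P \<le> sqdist u s (pt s 0) (pt s s) + (sqdist u s (pt s s) (pt (-2 * s) s) + sqdist u s (pt (-2 * s) s) ?P)"
      by (rule order_trans[OF sqdist_triangle[of _ _ _ _ "pt s s"]], rule add_left_mono, rule sqdist_triangle)
    also have "\<dots> \<le> ?e + (?e + ?e)"
    proof -
      have P: "?P = pt (- 2 * s) (s * of_int q)" using 3(1) by (simp add: mult.commute)
      show ?thesis unfolding P using 3(2) s by (intro add_mono vert horiz) auto
    qed
    finally show ?thesis unfolding three[symmetric] by (simp add: add.assoc)
  qed
qed

end

lemma sqint_hsq: "sqint u a s = (LINT x:hsq a s|lebesgue. rep_l2 u x)"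
  unfolding sqint_def set_lebesgue_integral_def
proof (rule integral_cong_AE)
  show "AE x in lebesgue. indicat_real (box a (a + vec s)) x *\<^sub>R rep_l2 u x = indicat_real (hsq a s) x *\<^sub>R rep_l2 u x"
    using AE_not_in[OF box_cbox_negligible[of a "a + vec s"]]
    by eventually_elim (use box_subset_hsq[of a s] hsq_subset_cbox[of a s] in \<open>auto simp: indicator_def\<close>)
  show "(\<lambda>x. indicat_real (box a (a + vec s)) x *\<^sub>R rep_l2 u x) \<in> borel_measurable lebesgue"
    "(\<lambda>x. indicat_real (hsq a s) x *\<^sub>R rep_l2 u x) \<in> borel_measurable lebesgue"
    by (intro borel_measurable_scaleR borel_measurable_indicator rep_measurable; simp)+
qed

lemma hsq_integrable: "integrable lebesgue (\<lambda>x. indicat_real (hsq a s) x *\<^sub>R rep_l2 u x)"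
proof -
  have "bounded (hsq a s)" using hsq_subset_cbox bounded_cbox bounded_subset by blast
  from rep_integrable[OF this hsq_sets] show ?thesis by (simp add: set_integrable_def)
qed

lemma sqint_split:
  assumes "0 < s"
  shows "sqint u a (2 * s) = sqint u a s + sqint u (a + axis 1 s) s + sqint u (a + axis 2 s) s + sqint u (a + axis 1 s + axis 2 s) s"
proof -
  have ind: "indicat_real (hsq a (2 * s)) x = indicator (hsq a s) x + indicator (hsq (a + axis 1 s) s) x
     + indicator (hsq (a + axis 2 s) s) x + indicator (hsq (a + axis 1 s + axis 2 s) s) x" for x
    using assms by (simp add: indicator_def hsq_def forall_2) linarith
  show ?thesis
    unfolding sqint_hsq set_lebesgue_integral_def ind scaleR_add_left
    by (simp add: hsq_integrable)
qed

text \<open>The average over the large square is the mean of the averages over its four quarters,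
  and each of these is compared with the square at \<open>c\<close>.\<close>

lemma average_split_le:
  assumes s: "0 < s"
    and le: "\<And>b. b \<in> {a, a + axis 1 s, a + axis 2 s, a + axis 1 s + axis 2 s} \<Longrightarrow> sqdist u s b c \<le> E"
  shows "ennreal (cmod (sqint u a (2 * s) /\<^sub>R (2 * s)\<^sup>2 - sqint u c s /\<^sub>R s\<^sup>2)) \<le> ennreal (1 / s\<^sup>2) * E"
proof (cases "E = \<infinity>")
  case True
  then show ?thesis using s by (simp add: ennreal_mult_top)
next
  case False
  then obtain e where e: "E = ennreal e" "0 \<le> e" by (metis ennreal_cases infinity_ennreal_def)
  have le': "cmod (sqint u b s - sqint u c s) \<le> e" if "b \<in> {a, a + axis 1 s, a + axis 2 s, a + axis 1 s + axis 2 s}" for b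
    using le[OF that] e by (simp add: sqdist_def)
  let ?b1 = "a + axis 1 s" and ?b2 = "a + axis 2 s" and ?b3 = "a + axis 1 s + axis 2 s"
  let ?c = "sqint u c s"
  have "sqint u a (2 * s) - 4 * ?c = ((sqint u a s - ?c) + (sqint u ?b1 s - ?c)) + ((sqint u ?b2 s - ?c) + (sqint u ?b3 s - ?c))"
    by (simp add: sqint_split[OF s])
  also have "cmod \<dots> \<le> (e + e) + (e + e)"
    by (intro norm_triangle_mono le') auto
  finally have n: "cmod (sqint u a (2 * s) - 4 * ?c) \<le> 4 * e" by simp
  have "sqint u a (2 * s) /\<^sub>R (2 * s)\<^sup>2 - ?c /\<^sub>R s\<^sup>2 = (sqint u a (2 * s) - 4 * ?c) /\<^sub>R (4 * s\<^sup>2)"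
    using s by (simp add: scaleR_conv_of_real field_simps power2_eq_square)
  moreover have "\<bar>inverse (4 * s\<^sup>2)\<bar> = inverse (4 * s\<^sup>2)" by simp
  ultimately have "cmod (sqint u a (2 * s) /\<^sub>R (2 * s)\<^sup>2 - ?c /\<^sub>R s\<^sup>2) = cmod (sqint u a (2 * s) - 4 * ?c) / (4 * s\<^sup>2)"
    by (simp only: norm_scaleR divide_inverse mult.commute)
  also have "\<dots> \<le> 4 * e / (4 * s\<^sup>2)" using n by (rule divide_right_mono) simp
  finally have "cmod (sqint u a (2 * s) /\<^sub>R (2 * s)\<^sup>2 - ?c /\<^sub>R s\<^sup>2) \<le> 1 / s\<^sup>2 * e" by simp
  then show ?thesis using e by (simp add: ennreal_leI flip: ennreal_mult)
qed

text \<open>Averages over the exterior node of level \<open>k\<close> are replaced by those over a square that touches its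
  inner boundary.\<close>

definition rcorner :: "nat \<Rightarrow> real^2 \<Rightarrow> real^2" where
  "rcorner k x = (if lev x < k then corner k x else pt (2 ^ k / 2) 0)"

definition rside :: "nat \<Rightarrow> real^2 \<Rightarrow> real" where
  "rside k x = (if lev x < k then side k (lev x) else 2 ^ k / 2)"

definition avg :: "l2 \<Rightarrow> nat \<Rightarrow> real^2 \<Rightarrow> complex" where
  "avg u k x = sqint u (rcorner k x) (rside k x) /\<^sub>R (rside k x)\<^sup>2"

text \<open>The factor \<open>4 ^ lev y\<close> compensates the square root of the weight, so that the square integral of
  \<open>gfun u\<close> with respect to \<open>Mw\<close> is a multiple of the Dirichlet integral.\<close>

definition gfun :: "l2 \<Rightarrow> real^2 \<Rightarrow> ennreal" where
  "gfun u y = 32 * (gradient u y * ennreal (4 ^ lev y))"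

lemma gfun_measurable[measurable]: "gfun u \<in> borel_measurable lebesgue"
proof -
  have "(\<lambda>y. ennreal (4 ^ lev y)) \<in> borel_measurable lebesgue"
    by (rule measurable_compose[OF lev_measurable]) simp
  then show ?thesis unfolding gfun_def[abs_def]
    by (intro borel_measurable_times_ennreal gradient_measurable) auto
qed

text \<open>On levels up to \<open>m\<close> the density \<open>wt * gfun\<close> is at least
  \<open>32 / 4 ^ m\<close> times the gradient. The inclusion is required almost everywhere only,
  since the swept closed sets exceed the half-open nodes by null sets.\<close>

lemma gfun_lower:
  assumes [measurable]: "A \<in> sets lebesgue" "B \<in> sets lebesgue"
    and AE: "AE y in lebesgue. y \<in> A \<longrightarrow> y \<in> B \<and> lev y \<le> m"
    and D: "D \<le> ennreal r * (\<integral>\<^sup>+y\<in>A. gradient u y \<partial>lebesgue)" and r: "r \<le> 32 * 2 ^ k / 4 ^ m"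
  shows "D \<le> 2 ^ k * (\<integral>\<^sup>+y\<in>B. gfun u y \<partial>Mw)"
proof -
  have B: "(\<integral>\<^sup>+y\<in>B. gfun u y \<partial>Mw) = (\<integral>\<^sup>+y. wt y * (gfun u y * indicator B y) \<partial>lebesgue)"
    unfolding Mw_def by (rule nn_integral_density) (auto intro!: borel_measurable_times_ennreal)
  have wt: "wt y * (gfun u y * indicator B y) = ennreal (32 / 4 ^ lev y) * (gradient u y * indicator B y)" for y
  proof -
    have "wt y * (32 * ennreal (4 ^ lev y)) = ennreal (32 / 4 ^ lev y)"
    proof -
      have "(16::real) ^ lev y = 4 ^ lev y * 4 ^ lev y" by (simp flip: power_mult_distrib)
      then have "ennreal (1 / 16 ^ lev y * (32 * 4 ^ lev y)) = ennreal (32 / 4 ^ lev y)" by simp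
      then show ?thesis by (simp add: wt_def ennreal_mult del: times_divide_eq_left)
    qed
    moreover have "wt y * (gfun u y * indicator B y) = (wt y * (32 * ennreal (4 ^ lev y))) * (gradient u y * indicator B y)"
      by (simp only: gfun_def ac_simps)
    ultimately show ?thesis by simp
  qed
  have "D \<le> ennreal r * (\<integral>\<^sup>+y\<in>A. gradient u y \<partial>lebesgue)" by fact
  also have "\<dots> \<le> ennreal (2 ^ k * (32 / 4 ^ m)) * (\<integral>\<^sup>+y\<in>A. gradient u y \<partial>lebesgue)"
    using r by (intro mult_right_mono ennreal_leI) (auto simp: mult.commute)
  also have "\<dots> = 2 ^ k * (\<integral>\<^sup>+y. ennreal (32 / 4 ^ m) * (gradient u y * indicator A y) \<partial>lebesgue)"
  proof -
    have "ennreal (2 ^ k * (32 / 4 ^ m)) = 2 ^ k * ennreal (32 / 4 ^ m)"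
      by (subst ennreal_mult) (simp_all add: ennreal_power[symmetric])
    then show ?thesis by (subst nn_integral_cmult) (auto simp: mult.assoc intro!: borel_measurable_times_ennreal)
  qed
  also have "\<dots> \<le> 2 ^ k * (\<integral>\<^sup>+y\<in>B. gfun u y \<partial>Mw)"
    unfolding B wt
  proof (intro mult_left_mono nn_integral_mono_AE)
    show "AE y in lebesgue. ennreal (32 / 4 ^ m) * (gradient u y * indicator A y) \<le> ennreal (32 / 4 ^ lev y) * (gradient u y * indicator B y)"
      using AE
    proof eventually_elim
      fix y assume *: "y \<in> A \<longrightarrow> y \<in> B \<and> lev y \<le> m"
      show "ennreal (32 / 4 ^ m) * (gradient u y * indicator A y) \<le> ennreal (32 / 4 ^ lev y) * (gradient u y * indicator B y)"
      proof (cases "y \<in> A")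
        case True
        then have "(4::real) ^ lev y \<le> 4 ^ m" using * by (intro power_increasing) auto
        then have "32 / (4::real) ^ m \<le> 32 / 4 ^ lev y" by (intro divide_left_mono) auto
        then show ?thesis using True * by (auto intro!: mult_right_mono ennreal_leI)
      qed simp
    qed
  qed simp
  finally show ?thesis .
qed

lemma gfun_square_integral: "(\<integral>\<^sup>+y. (gfun u y)\<^sup>2 \<partial>Mw) = 1024 * (\<integral>\<^sup>+y. (gradient u y)\<^sup>2 \<partial>lebesgue)"
proof -
  have "(\<integral>\<^sup>+y. (gfun u y)\<^sup>2 \<partial>Mw) = (\<integral>\<^sup>+y. wt y * (gfun u y)\<^sup>2 \<partial>lebesgue)"
    unfolding Mw_def by (rule nn_integral_density) auto
  also have "\<dots> = (\<integral>\<^sup>+y. 1024 * (gradient u y)\<^sup>2 \<partial>lebesgue)"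
  proof (rule nn_integral_cong)
    fix y :: "real^2"
    have "wt y * (ennreal (4 ^ lev y))\<^sup>2 = 1"
    proof -
      have "(16::real) ^ lev y = (4 ^ lev y)\<^sup>2" by (simp add: power2_eq_square flip: power_mult_distrib)
      then have "1 / 16 ^ lev y * (4 ^ lev y)\<^sup>2 = (1::real)" by simp
      then show ?thesis by (simp add: wt_def ennreal_power flip: ennreal_mult)
    qed
    moreover have "wt y * (gfun u y)\<^sup>2 = (wt y * (ennreal (4 ^ lev y))\<^sup>2) * (1024 * (gradient u y)\<^sup>2)"
      unfolding gfun_def power_mult_distrib by (simp add: ac_simps)
    ultimately show "wt y * (gfun u y)\<^sup>2 = 1024 * (gradient u y)\<^sup>2" by simp
  qed
  also have "\<dots> = 1024 * (\<integral>\<^sup>+y. (gradient u y)\<^sup>2 \<partial>lebesgue)"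
    by (rule nn_integral_cmult) auto
  finally show ?thesis .
qed

lemma AE_coordinate_neq: "AE y in lebesgue. (y::real^2) $ i \<noteq> c"
proof -
  have "negligible {y::real^2. axis i 1 \<bullet> y = c}" by (rule negligible_hyperplane) simp
  then have "negligible {y::real^2. y $ i = c}" by (simp add: inner_axis')
  then have "{y::real^2. y $ i = c} \<in> null_sets lebesgue" by (simp add: negligible_iff_null_sets)
  from AE_not_in[OF this] show ?thesis by simp
qed

lemma AE_coordinates_neq: "finite C \<Longrightarrow> AE y in lebesgue. \<forall>c\<in>C. \<forall>i. (y::real^2) $ i \<noteq> c"
  by (simp add: AE_finite_all AE_all_countable AE_coordinate_neq)

lemma ring_sets[measurable]:
  "{y::real^2. (\<forall>i. \<bar>y $ i\<bar> \<le> r) \<and> (P \<or> s \<le> \<bar>y $ 1\<bar> \<or> s \<le> \<bar>y $ 2\<bar>)} \<in> sets lebesgue"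
proof -
  have "{y \<in> space lebesgue. (\<bar>(y::real^2) $ 1\<bar> \<le> r \<and> \<bar>y $ 2\<bar> \<le> r) \<and> (P \<or> s \<le> \<bar>y $ 1\<bar> \<or> s \<le> \<bar>y $ 2\<bar>)} \<in> sets lebesgue"
    by measurable
  then show ?thesis by (simp add: forall_2)
qed

text \<open>The child is one of the four quarters of its parent square, and diagonal moves between
  quarters stay inside the parent.\<close>

lemma avg_step_interior:
  assumes u: "u \<in> W12" and lt: "lev x < k"
  shows "ennreal (cmod (avg u k x - avg u (Suc k) x)) \<le> 2 ^ k * (\<integral>\<^sup>+y\<in>{y. gcode k y = gcode k x}. gfun u y \<partial>Mw)"
proof -
  define m where "m = lev x"
  define s where "s = side (Suc k) m"
  define a where "a = corner k x"
  define c where "c = corner (Suc k) x"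
  have s: "0 < s" "side k m = 2 * s" by (simp_all add: s_def side_Suc)
  have c: "c $ i = a $ i \<or> c $ i = a $ i + s" for i
  proof -
    have "\<lfloor>x $ i / side k m\<rfloor> = \<lfloor>x $ i / s\<rfloor> div 2"
      using floor_divide_real_eq_div[of 2 "x $ i / s"] by (simp add: s mult.commute)
    then have "\<lfloor>x $ i / s\<rfloor> = 2 * \<lfloor>x $ i / side k m\<rfloor> \<or> \<lfloor>x $ i / s\<rfloor> = 2 * \<lfloor>x $ i / side k m\<rfloor> + 1" by presburger
    then have "real_of_int \<lfloor>x $ i / s\<rfloor> = 2 * real_of_int \<lfloor>x $ i / side k m\<rfloor> \<or> real_of_int \<lfloor>x $ i / s\<rfloor> = 2 * real_of_int \<lfloor>x $ i / side k m\<rfloor> + 1"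
      by linarith
    moreover have "a $ i = 2 * s * real_of_int \<lfloor>x $ i / side k m\<rfloor>" "c $ i = s * real_of_int \<lfloor>x $ i / s\<rfloor>"
      by (simp_all add: a_def c_def corner_def m_def[symmetric] s_def[symmetric] s(2))
    ultimately show ?thesis by (auto simp: algebra_simps)
  qed
  let ?A = "cbox a (a + vec (2 * s))"
  let ?I = "\<integral>\<^sup>+y\<in>?A. gradient u y \<partial>lebesgue"
  have "sqdist u s b c \<le> 2 * (ennreal s * ?I)" if b: "b \<in> {a, a + axis 1 s, a + axis 2 s, a + axis 1 s + axis 2 s}" for b
  proof (rule sqdist_diagonal[OF u])
    have b': "b $ i = a $ i \<or> b $ i = a $ i + s" for i using b exhaust_2[of i] by auto
    show "\<bar>b $ 1 - c $ 1\<bar> \<le> s" "\<bar>b $ 2 - c $ 2\<bar> \<le> s" using b'[of 1] b'[of 2] c[of 1] c[of 2] s by auto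
    fix y assume y: "\<And>j. min (b $ j) (c $ j) \<le> y $ j \<and> y $ j \<le> max (b $ j) (c $ j) + s"
    have "a $ j \<le> y $ j \<and> y $ j \<le> a $ j + 2 * s" for j using y[of j] b'[of j] c[of j] s(1) by auto
    then show "y \<in> ?A" by (auto simp: mem_box_cart)
  qed simp
  from average_split_le[OF s(1) this]
  have "ennreal (cmod (avg u k x - avg u (Suc k) x)) \<le> ennreal (1 / s\<^sup>2) * (2 * (ennreal s * ?I))"
    using lt by (simp add: avg_def rcorner_def rside_def m_def[symmetric] s(2) a_def[symmetric] c_def[symmetric] s_def[symmetric])
  also have "\<dots> = ennreal (2 / s) * ?I"
  proof -
    have "ennreal (1 / s\<^sup>2) * (2 * ennreal s) = ennreal (1 / s\<^sup>2 * (2 * s))"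
      using s(1) by (simp add: ennreal_mult del: times_divide_eq_left)
    also have "1 / s\<^sup>2 * (2 * s) = 2 / s" using s(1) by (simp add: power2_eq_square)
    finally show ?thesis by (simp add: mult.assoc[symmetric])
  qed
  finally show ?thesis
  proof (rule gfun_lower[rotated 3])
    show "2 / s \<le> 32 * 2 ^ k / 4 ^ m" by (simp add: s_def side_def divide_right_mono)
    show "AE y in lebesgue. y \<in> ?A \<longrightarrow> y \<in> {y. gcode k y = gcode k x} \<and> lev y \<le> m"
      using AE_hsq_iff[of a "2 * s"]
    proof eventually_elim
      fix y assume "y \<in> hsq a (2 * s) \<longleftrightarrow> y \<in> ?A"
      moreover have "{y. gcode k y = gcode k x} = hsq a (2 * s)"
        using gcode_node_interior[OF lt] by (simp add: a_def m_def[symmetric] s(2))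
      moreover have "gcode k y = gcode k x \<Longrightarrow> lev y = m" using lt by (auto simp: gcode_def m_def split: if_splits)
      ultimately show "y \<in> ?A \<longrightarrow> y \<in> {y. gcode k y = gcode k x} \<and> lev y \<le> m" by auto
    qed
    show "{y. gcode k y = gcode k x} \<in> sets lebesgue"
      unfolding gcode_node_interior[OF lt] by (rule hsq_sets)
  qed simp
qed

lemma gcode_exterior_sets: "k \<le> lev x \<Longrightarrow> {y. gcode k y = gcode k x} \<in> sets lebesgue"
  by (simp add: gcode_node_exterior)

lemma abs_less_if_mem_sqr:
  assumes "y \<in> sqr n" "y $ i \<noteq> - (2 ^ n)"
  shows "\<bar>y $ i\<bar> < 2 ^ n"
proof -
  have "- (2 ^ n) \<le> y $ i" "y $ i < 2 ^ n" using assms(1) by (simp_all add: mem_sqr)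
  then show ?thesis using assms(2) by linarith
qed

lemma mem_sqr_if_abs_le:
  assumes "\<And>i. \<bar>y $ i\<bar> \<le> 2 ^ n" "\<And>i. y $ i \<noteq> 2 ^ n"
  shows "y \<in> sqr n"
  unfolding mem_sqr
proof
  fix i
  show "- (2 ^ n) \<le> y $ i \<and> y $ i < 2 ^ n" using assms(1)[of i] assms(2)[of i] by linarith
qed

text \<open>Here \<open>x\<close> lies in the innermost ring of the exterior node. Its next node is
  a square of side \<open>s\<close> in that ring, as is the representative square
  \<open>[s, 2 s] \<times> [0, s]\<close>. For \<open>k = 0\<close> the ring is a full square, and a
  diagonal move replaces the walk around the hole.\<close>

lemma avg_step_boundary:
  assumes u: "u \<in> W12" and eq: "lev x = k"
  shows "ennreal (cmod (avg u k x - avg u (Suc k) x)) \<le> 2 ^ k * (\<integral>\<^sup>+y\<in>{y. gcode k y = gcode k x}. gfun u y \<partial>Mw)"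
proof -
  define s :: real where "s = 2 ^ k / 2"
  have s: "0 < s" by (simp add: s_def)
  have ss: "side (Suc k) k = s"
  proof -
    have "(4::real) ^ k = 2 ^ k * 2 ^ k" by (simp flip: power_mult_distrib)
    then show ?thesis by (simp add: side_def s_def)
  qed
  define p where "p = \<lfloor>x $ 1 / s\<rfloor>"
  define q where "q = \<lfloor>x $ 2 / s\<rfloor>"
  define A where "A = {y::real^2. (\<forall>i. \<bar>y $ i\<bar> \<le> 2 * s) \<and> (k = 0 \<or> s \<le> \<bar>y $ 1\<bar> \<or> s \<le> \<bar>y $ 2\<bar>)}"
  have A[measurable]: "A \<in> sets lebesgue" unfolding A_def by (rule ring_sets)
  let ?I = "\<integral>\<^sup>+y\<in>A. gradient u y \<partial>lebesgue"
  have c: "corner (Suc k) x = pt (s * of_int p) (s * of_int q)"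
    by (simp add: vec2_eq_iff corner_def eq ss p_def q_def)
  have "x \<in> sqr k" using eq lev_eq_iff[of x k] by simp
  then have pq: "p \<in> {-2..1}" "q \<in> {-2..1}"
    using sqr_floor[of k "Suc k" k x] by (auto simp: forall_2 ss p_def q_def)
  have dist: "sqdist u s (pt s 0) (pt (s * of_int p) (s * of_int q)) \<le> 3 * (ennreal (3 * s) * ?I)"
  proof (cases "k = 0")
    case True
    have "sqdist u s (pt s 0) (pt (s * of_int p) (s * of_int q)) \<le> 2 * (ennreal (3 * s) * ?I)"
    proof (rule sqdist_diagonal[OF u A])
      have b: "- 2 * s \<le> s * of_int p" "s * of_int p \<le> s" "- 2 * s \<le> s * of_int q" "s * of_int q \<le> s"
        using pq s mult_left_mono[of "-2" "real_of_int p" s] mult_left_mono[of "real_of_int p" 1 s]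
          mult_left_mono[of "-2" "real_of_int q" s] mult_left_mono[of "real_of_int q" 1 s] by auto
      then show "\<bar>pt s 0 $ 1 - pt (s * of_int p) (s * of_int q) $ 1\<bar> \<le> 3 * s"
        "\<bar>pt s 0 $ 2 - pt (s * of_int p) (s * of_int q) $ 2\<bar> \<le> 3 * s"
        using s unfolding pt_nth by linarith+
      fix y assume y: "\<And>j. min (pt s 0 $ j) (pt (s * of_int p) (s * of_int q) $ j) \<le> y $ j
        \<and> y $ j \<le> max (pt s 0 $ j) (pt (s * of_int p) (s * of_int q) $ j) + s"
      have "\<bar>y $ 1\<bar> \<le> 2 * s" "\<bar>y $ 2\<bar> \<le> 2 * s" using y[of 1] y[of 2] b s unfolding pt_nth by linarith+
      then show "y \<in> A" using True by (simp add: A_def forall_2)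
    qed
    also have "\<dots> \<le> 3 * (ennreal (3 * s) * ?I)" by (rule mult_right_mono) auto
    finally show ?thesis .
  next
    case False
    then have "x \<notin> sqr (k - 1)" using eq lev_eq_iff[of x k] by simp
    then have "p \<notin> {-1..0} \<or> q \<notin> {-1..0}"
      using sqr_floor[of k "Suc k" "k - 1" x] False by (auto simp: forall_2 ss p_def q_def)
    then show ?thesis using pq by (intro sqdist_ring[OF u A s]) (auto simp: A_def)
  qed
  have "avg u k x - avg u (Suc k) x = (sqint u (pt s 0) s - sqint u (pt (s * of_int p) (s * of_int q)) s) /\<^sub>R s\<^sup>2"
    using eq by (simp add: avg_def rcorner_def rside_def s_def[symmetric] ss c scaleR_diff_right)
  then have "ennreal (cmod (avg u k x - avg u (Suc k) x)) = ennreal (1 / s\<^sup>2) * sqdist u s (pt s 0) (pt (s * of_int p) (s * of_int q))"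
    by (simp add: sqdist_def ennreal_mult divide_inverse)
  also have "\<dots> \<le> ennreal (1 / s\<^sup>2) * (3 * (ennreal (3 * s) * ?I))"
    by (intro mult_left_mono dist) simp
  also have "\<dots> = ennreal (9 / s) * ?I"
  proof -
    have "ennreal (1 / s\<^sup>2) * (3 * ennreal (3 * s)) = ennreal (1 / s\<^sup>2 * (3 * (3 * s)))"
      using s by (simp add: ennreal_mult del: times_divide_eq_left)
    also have "1 / s\<^sup>2 * (3 * (3 * s)) = 9 / s" using s by (simp add: power2_eq_square)
    finally show ?thesis by (simp add: mult.assoc[symmetric])
  qed
  finally show ?thesis
  proof (rule gfun_lower[rotated 3])
    show "9 / s \<le> 32 * 2 ^ k / 4 ^ k"
    proof -
      have "(4::real) ^ k = 2 ^ k * 2 ^ k" by (simp flip: power_mult_distrib)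
      then show ?thesis by (simp add: s_def divide_right_mono)
    qed
    show "AE y in lebesgue. y \<in> A \<longrightarrow> y \<in> {y. gcode k y = gcode k x} \<and> lev y \<le> k"
      using AE_coordinates_neq[of "{2 * s, - s}", OF finite.insertI[OF finite.insertI[OF finite.emptyI]]]
    proof eventually_elim
      fix y :: "real^2" assume ne: "\<forall>c\<in>{2 * s, - s}. \<forall>i. y $ i \<noteq> c"
      show "y \<in> A \<longrightarrow> y \<in> {y. gcode k y = gcode k x} \<and> lev y \<le> k"
      proof
        assume y: "y \<in> A"
        then have "lev y \<le> k" using ne unfolding lev_le_iff by (intro mem_sqr_if_abs_le) (auto simp: A_def s_def)
        moreover have "k \<le> lev y"
        proof (rule ccontr)
          assume "\<not> k \<le> lev y"
          then have k: "k \<noteq> 0" "y \<in> sqr (k - 1)" unfolding lev_le_iff[symmetric] by auto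
          moreover have "(2::real) ^ (k - 1) = s" using k(1) by (cases k) (auto simp: s_def)
          ultimately have "\<bar>y $ i\<bar> < s" for i using abs_less_if_mem_sqr[of y "k - 1" i] ne by simp
          then have "\<not> s \<le> \<bar>y $ 1\<bar>" "\<not> s \<le> \<bar>y $ 2\<bar>" by (simp_all add: not_le)
          then show False using y k(1) by (simp add: A_def)
        qed
        ultimately show "y \<in> {y. gcode k y = gcode k x} \<and> lev y \<le> k" using eq by (simp add: gcode_def)
      qed
    qed
    show "{y. gcode k y = gcode k x} \<in> sets lebesgue" using eq by (intro gcode_exterior_sets) simp
  qed simp
qed

text \<open>Both nodes are exterior, with representative squares
  \<open>[s, 2 s] \<times> [0, s]\<close> and \<open>[2 s, 4 s] \<times> [0, 2 s]\<close>; the moves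
  between them stay in the levels \<open>k\<close> and \<open>k + 1\<close>.\<close>

lemma avg_step_exterior:
  assumes u: "u \<in> W12" and lt: "k < lev x"
  shows "ennreal (cmod (avg u k x - avg u (Suc k) x)) \<le> 2 ^ k * (\<integral>\<^sup>+y\<in>{y. gcode k y = gcode k x}. gfun u y \<partial>Mw)"
proof -
  define s :: real where "s = 2 ^ k / 2"
  have s: "0 < s" by (simp add: s_def)
  define A where "A = {y::real^2. (\<forall>i. \<bar>y $ i\<bar> \<le> 4 * s) \<and> (False \<or> s \<le> \<bar>y $ 1\<bar> \<or> s \<le> \<bar>y $ 2\<bar>)}"
  have A[measurable]: "A \<in> sets lebesgue" unfolding A_def by (rule ring_sets)
  let ?I = "\<integral>\<^sup>+y\<in>A. gradient u y \<partial>lebesgue" and ?a = "pt (2 * s) 0"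
  have "sqdist u s b (pt s 0) \<le> 2 * (ennreal (2 * s) * ?I)"
    if b: "b \<in> {?a, ?a + axis 1 s, ?a + axis 2 s, ?a + axis 1 s + axis 2 s}" for b
  proof (rule sqdist_diagonal[OF u A])
    have b': "2 * s \<le> b $ 1" "b $ 1 \<le> 3 * s" "0 \<le> b $ 2" "b $ 2 \<le> s" using b s by auto
    then show "\<bar>b $ 1 - pt s 0 $ 1\<bar> \<le> 2 * s" "\<bar>b $ 2 - pt s 0 $ 2\<bar> \<le> 2 * s" using s by auto
    fix y assume y: "\<And>j. min (b $ j) (pt s 0 $ j) \<le> y $ j \<and> y $ j \<le> max (b $ j) (pt s 0 $ j) + s"
    have "s \<le> y $ 1" "y $ 1 \<le> 4 * s" "0 \<le> y $ 2" "y $ 2 \<le> 2 * s" using y[of 1] y[of 2] b' s by auto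
    then show "y \<in> A" using s by (simp add: A_def forall_2)
  qed
  from average_split_le[OF s this]
  have "ennreal (cmod (avg u k x - avg u (Suc k) x)) \<le> ennreal (1 / s\<^sup>2) * (2 * (ennreal (2 * s) * ?I))"
    using lt by (subst norm_minus_commute) (simp add: avg_def rcorner_def rside_def s_def)
  also have "\<dots> = ennreal (4 / s) * ?I"
  proof -
    have "ennreal (1 / s\<^sup>2) * (2 * ennreal (2 * s)) = ennreal (1 / s\<^sup>2 * (2 * (2 * s)))"
      using s by (simp add: ennreal_mult del: times_divide_eq_left)
    also have "1 / s\<^sup>2 * (2 * (2 * s)) = 4 / s" using s by (simp add: power2_eq_square)
    finally show ?thesis by (simp add: mult.assoc[symmetric])
  qed
  finally show ?thesis
  proof (rule gfun_lower[rotated 3])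
    \<comment> \<open>This fixes the factor 32 in \<open>gfun\<close>: both sides equal
      \<open>8 / 2 ^ k\<close>, since the moves reach the level \<open>Suc k\<close>.\<close>
    show "4 / s \<le> 32 * 2 ^ k / 4 ^ Suc k"
    proof -
      have "(4::real) ^ k = 2 ^ k * 2 ^ k" by (simp flip: power_mult_distrib)
      then show ?thesis by (simp add: s_def)
    qed
    show "AE y in lebesgue. y \<in> A \<longrightarrow> y \<in> {y. gcode k y = gcode k x} \<and> lev y \<le> Suc k"
      using AE_coordinates_neq[of "{4 * s, - s}", OF finite.insertI[OF finite.insertI[OF finite.emptyI]]]
    proof eventually_elim
      fix y :: "real^2" assume ne: "\<forall>c\<in>{4 * s, - s}. \<forall>i. y $ i \<noteq> c"
      show "y \<in> A \<longrightarrow> y \<in> {y. gcode k y = gcode k x} \<and> lev y \<le> Suc k"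
      proof
        assume y: "y \<in> A"
        then have "lev y \<le> Suc k" using ne unfolding lev_le_iff by (intro mem_sqr_if_abs_le) (auto simp: A_def s_def)
        moreover have "k \<le> lev y"
        proof (rule ccontr)
          assume "\<not> k \<le> lev y"
          then have k: "k \<noteq> 0" "y \<in> sqr (k - 1)" unfolding lev_le_iff[symmetric] by auto
          moreover have "(2::real) ^ (k - 1) = s" using k(1) by (cases k) (auto simp: s_def)
          ultimately have "\<bar>y $ i\<bar> < s" for i using abs_less_if_mem_sqr[of y "k - 1" i] ne by simp
          then have "\<not> s \<le> \<bar>y $ 1\<bar>" "\<not> s \<le> \<bar>y $ 2\<bar>" by (simp_all add: not_le)
          then show False using y k(1) by (simp add: A_def)
        qed
        ultimately show "y \<in> {y. gcode k y = gcode k x} \<and> lev y \<le> Suc k" using lt by (simp add: gcode_def)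
      qed
    qed
    show "{y. gcode k y = gcode k x} \<in> sets lebesgue" using lt by (intro gcode_exterior_sets) simp
  qed simp
qed

lemma avg_step:
  "u \<in> W12 \<Longrightarrow> ennreal (cmod (avg u k x - avg u (Suc k) x)) \<le> 2 ^ k * (\<integral>\<^sup>+y\<in>{y. gcode k y = gcode k x}. gfun u y \<partial>Mw)"
  using avg_step_interior[of u x k] avg_step_boundary[of u x k] avg_step_exterior[of u k x]
  by (cases "lev x" k rule: linorder_cases) auto

lemma avg_cong:
  assumes "gcode k x = gcode k y"
  shows "avg u k x = avg u k y"
proof (cases "lev x < k")
  case True
  then have "lev y = lev x" "\<lfloor>y $ 1 / side k (lev x)\<rfloor> = \<lfloor>x $ 1 / side k (lev x)\<rfloor>" "\<lfloor>y $ 2 / side k (lev x)\<rfloor> = \<lfloor>x $ 2 / side k (lev x)\<rfloor>"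
    using assms by (auto simp: gcode_def split: if_splits)
  moreover from this have "corner k y = corner k x" by (simp add: vec2_eq_iff corner_def)
  ultimately show ?thesis using True by (simp add: avg_def rcorner_def rside_def)
next
  case False
  then have "\<not> lev y < k" using assms by (auto simp: gcode_def split: if_splits)
  then show ?thesis using False by (simp add: avg_def rcorner_def rside_def)
qed

text \<open>From level \<open>lev x + 1\<close> on the node of \<open>x\<close> is a square that
  contains it, with side tending to 0.\<close>

lemma avg_tendsto:
  assumes u: "u \<in> W12"
  shows "AE x in lebesgue. (\<lambda>n. avg u n x) \<longlonglongrightarrow> rep_l2 u x"
  using averages_tendsto[OF u]
proof eventually_elim
  fix x
  assume *: "\<forall>a s. (\<forall>n. 0 < s n) \<longrightarrow> s \<longlonglongrightarrow> 0 \<longrightarrow> (\<forall>n i. a n $ i \<le> x $ i \<and> x $ i \<le> a n $ i + s n) \<longrightarrow>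
    (\<lambda>n. sqint u (a n) (s n) /\<^sub>R (s n)\<^sup>2) \<longlonglongrightarrow> rep_l2 u x"
  let ?k = "\<lambda>n. n + Suc (lev x)"
  let ?a = "\<lambda>n. corner (?k n) x" and ?s = "\<lambda>n. side (?k n) (lev x)"
  have "?s \<longlonglongrightarrow> 0"
  proof -
    have "(\<lambda>n. 4 ^ lev x / 2 ^ Suc (lev x) * (1 / 2 :: real) ^ n) \<longlonglongrightarrow> 4 ^ lev x / 2 ^ Suc (lev x) * 0"
      by (intro tendsto_mult tendsto_const LIMSEQ_power_zero) simp
    then show ?thesis by (simp add: side_def power_add power_one_over ac_simps)
  qed
  moreover have "?a n $ i \<le> x $ i \<and> x $ i \<le> ?a n $ i + ?s n" for n i
    using floor_eq_iff_interval[OF side_pos, of "x $ i" "?k n" "lev x" "\<lfloor>x $ i / ?s n\<rfloor>"] by (simp add: corner_def)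
  ultimately have "(\<lambda>n. sqint u (?a n) (?s n) /\<^sub>R (?s n)\<^sup>2) \<longlonglongrightarrow> rep_l2 u x"
    using *[THEN spec[of _ ?a], THEN spec[of _ ?s]] by simp
  then have "(\<lambda>n. avg u (n + Suc (lev x)) x) \<longlonglongrightarrow> rep_l2 u x"
    by (simp add: avg_def rcorner_def rside_def)
  then show "(\<lambda>n. avg u n x) \<longlonglongrightarrow> rep_l2 u x" by (rule LIMSEQ_offset)
qed

lemma (in dyadic_tree) pot_partial_sum_le: "(\<Sum>j=k..<n. 2 ^ j * (\<integral>\<^sup>+y\<in>node j x. g y \<partial>M)) \<le> pot k g x"
proof -
  have "(\<Sum>j=k..<n. 2 ^ j * (\<integral>\<^sup>+y\<in>node j x. g y \<partial>M)) = (\<Sum>j<n. if k \<le> j then 2 ^ j * (\<integral>\<^sup>+y\<in>node j x. g y \<partial>M) else 0)"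
    by (rule sum.mono_neutral_cong_left) auto
  also have "\<dots> \<le> pot k g x" unfolding pot_def by (rule sum_le_suminf) auto
  finally show ?thesis .
qed

text \<open>The averages over the nodes of \<open>x\<close> start from 0 at level \<open>k\<close>
  and tend to the value at \<open>x\<close>. Telescoping them and bounding each difference by
  \<open>avg_step\<close> produces the partial sums of \<open>pot\<close>.\<close>

lemma rep_le_pot:
  assumes V: "locally_integrable V" and u: "u \<in> W12" and z: "avg u k z = 0"
  shows "AE x in lebesgue. x \<in> dyadic_tree.node gcode k z \<longrightarrow>
    ennreal (cmod (rep_l2 u x)) \<le> dyadic_tree.pot Mw gcode k (gfun u) x"
proof -
  interpret dyadic_tree Mw "pot_measure V" gcode by (rule dyadic_tree_plane[OF V])
  have le: "ennreal (cmod (rep_l2 u x)) \<le> pot k (gfun u) x"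
    if lim: "(\<lambda>n. avg u n x) \<longlonglongrightarrow> rep_l2 u x" and x: "x \<in> node k z" for x
  proof -
  have "avg u k x = 0" using z x avg_cong[of k x z u] by (simp add: node_def)
  then have bound: "ennreal (cmod (avg u n x)) \<le> pot k (gfun u) x" if "k \<le> n" for n
  proof -
    have "ennreal (cmod (avg u n x)) \<le> (\<Sum>j=k..<n. 2 ^ j * (\<integral>\<^sup>+y\<in>node j x. gfun u y \<partial>Mw))"
      using that
    proof (induction n rule: dec_induct)
      case base
      then show ?case using \<open>avg u k x = 0\<close> by simp
    next
      case (step n)
      have "cmod (avg u (Suc n) x) \<le> cmod (avg u n x) + cmod (avg u n x - avg u (Suc n) x)"
        using norm_triangle_ineq4[of "avg u n x" "avg u n x - avg u (Suc n) x"] by simp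
      then have "ennreal (cmod (avg u (Suc n) x)) \<le> ennreal (cmod (avg u n x)) + ennreal (cmod (avg u n x - avg u (Suc n) x))"
        by (subst ennreal_plus[symmetric]) (simp_all add: ennreal_leI del: ennreal_plus)
      also have "\<dots> \<le> (\<Sum>j=k..<n. 2 ^ j * (\<integral>\<^sup>+y\<in>node j x. gfun u y \<partial>Mw)) + 2 ^ n * (\<integral>\<^sup>+y\<in>node n x. gfun u y \<partial>Mw)"
        using step.IH avg_step[OF u, of n x] by (intro add_mono) (auto simp: node_def)
      finally show ?case using step.hyps by simp
    qed
    also have "\<dots> \<le> pot k (gfun u) x" by (rule pot_partial_sum_le)
    finally show ?thesis .
  qed
  have "(\<lambda>n. ennreal (cmod (avg u n x))) \<longlonglongrightarrow> ennreal (cmod (rep_l2 u x))"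
    by (intro tendsto_ennrealI tendsto_norm lim)
  then show "ennreal (cmod (rep_l2 u x)) \<le> pot k (gfun u) x"
    by (rule LIMSEQ_le_const2) (use bound in blast)
  qed
  show ?thesis using avg_tendsto[OF u] by eventually_elim (use le in blast)
qed

subsection \<open>Finitely many linear constraints\<close>

context vector_space
begin

text \<open>Induction on the functionals: the kernel of one of them on \<open>L\<close> has
  codimension at most 1, so one vector outside it completes the spanning set. That \<open>L\<close>
  has finite dimension is part of the conclusion, which \<open>edim\<close> depends on.\<close>

lemma ex_small_spanning_set:
  assumes "finite I" "subspace L"
    and "\<And>i x y. i \<in> I \<Longrightarrow> x \<in> L \<Longrightarrow> y \<in> L \<Longrightarrow> f i (x + y) = f i x + f i y"
    and "\<And>i a x. i \<in> I \<Longrightarrow> x \<in> L \<Longrightarrow> f i (scale a x) = a * f i x"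
    and "\<And>x. x \<in> L \<Longrightarrow> (\<And>i. i \<in> I \<Longrightarrow> f i x = 0) \<Longrightarrow> x = 0"
  shows "\<exists>B. finite B \<and> card B \<le> card I \<and> L \<subseteq> span B"
  using assms
proof (induction I arbitrary: L rule: finite_induct)
  case empty
  then have "L \<subseteq> span {}" by auto
  then show ?case by (intro exI[of _ "{}"]) auto
next
  case (insert i I)
  note add = insert.prems(2) and scale = insert.prems(3) and ker = insert.prems(4)
  define L' where "L' = {x \<in> L. f i x = 0}"
  have "subspace L'"
  proof (rule subspaceI)
    have "f i (scale 0 0) = 0 * f i 0" by (rule scale) (use insert.prems(1) subspace_0 in auto)
    then show "0 \<in> L'" using subspace_0[OF insert.prems(1)] by (simp add: L'_def)
    show "x + y \<in> L'" if "x \<in> L'" "y \<in> L'" for x y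
      using that subspace_add[OF insert.prems(1), of x y] add[of i x y] by (simp add: L'_def)
    show "scale c x \<in> L'" if "x \<in> L'" for c x
      using that subspace_scale[OF insert.prems(1), of x c] scale[of i x c] by (simp add: L'_def)
  qed
  moreover have "x = 0" if "x \<in> L'" "\<And>j. j \<in> I \<Longrightarrow> f j x = 0" for x
    using that ker[of x] by (auto simp: L'_def)
  ultimately have "\<exists>B. finite B \<and> card B \<le> card I \<and> L' \<subseteq> span B"
    using add scale by (intro insert.IH) (auto simp: L'_def)
  then obtain B where B: "finite B" "card B \<le> card I" "L' \<subseteq> span B" by blast
  show ?case
  proof (cases "L \<subseteq> L'")
    case True
    then show ?thesis using B insert.hyps by (intro exI[of _ B]) auto
  next
    case False
    then obtain b where b: "b \<in> L" "f i b \<noteq> 0" by (auto simp: L'_def)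
    have "L \<subseteq> span (insert b B)"
    proof
      fix x assume x: "x \<in> L"
      define t where "t = f i x / f i b"
      have sb: "scale (- t) b \<in> L" using subspace_scale[OF insert.prems(1) b(1)] .
      have "f i (x + scale (- t) b) = f i x + (- t) * f i b"
        using add[of i x "scale (- t) b"] scale[of i b "- t"] x sb b by simp
      then have "x + scale (- t) b \<in> L'"
        using subspace_add[OF insert.prems(1) x sb] b by (simp add: L'_def t_def)
      then have "x + scale (- t) b \<in> span (insert b B)" using B(3) span_mono[of B "insert b B"] by auto
      moreover have "scale t b \<in> span (insert b B)" by (intro span_scale span_base) simp
      ultimately have "x + scale (- t) b + scale t b \<in> span (insert b B)" by (rule span_add)
      then show "x \<in> span (insert b B)" by simp
    qed
    moreover have "card (insert b B) \<le> card (insert i I)"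
      using B insert.hyps by (simp add: card_insert_if)
    ultimately show ?thesis using B(1) by (intro exI[of _ "insert b B"]) auto
  qed
qed

lemma edim_le_spanning: "finite B \<Longrightarrow> L \<subseteq> span B \<Longrightarrow> local.edim L \<le> enat (card B)"
  using dim_le_card[of L B] by (auto simp: local.edim_def)

end

section \<open>Linearity of the averages on classes of functions\<close>

lemma l2_rel_rep: "square_integrable f \<Longrightarrow> AE x in lebesgue. rep_l2 (abs_l2 f) x = f x"
  using Quotient_rep_abs[OF Quotient_l2, of f] by (simp add: l2_rel_def)

lemma rep_l2_add: "AE x in lebesgue. rep_l2 (u + v) x = rep_l2 u x + rep_l2 v x"
proof -
  have "l2_rel (rep_l2 w) (rep_l2 w)" for w by (simp add: l2_rel_def square_integrable_rep)
  then have "u + v = abs_l2 (\<lambda>x. rep_l2 u x + rep_l2 v x)"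
    using plus_l2.abs_eq[of "rep_l2 u" "rep_l2 v"] Quotient_abs_rep[OF Quotient_l2] by simp
  then show ?thesis using l2_rel_rep[OF square_integrable_add[OF square_integrable_rep square_integrable_rep]] by simp
qed

lemma rep_l2_scale: "AE x in lebesgue. rep_l2 (l2_scale c u) x = c * rep_l2 u x"
proof -
  have "l2_rel (rep_l2 u) (rep_l2 u)" by (simp add: l2_rel_def square_integrable_rep)
  then have "l2_scale c u = abs_l2 (\<lambda>x. c * rep_l2 u x)"
    using l2_scale.abs_eq[of "rep_l2 u" c] Quotient_abs_rep[OF Quotient_l2] by simp
  then show ?thesis using l2_rel_rep[OF square_integrable_scale[OF square_integrable_rep]] by simp
qed

lemma sqint_add: "sqint (u + v) a s = sqint u a s + sqint v a s"
proof -
  have "(\<integral>x. indicat_real (hsq a s) x *\<^sub>R rep_l2 (u + v) x \<partial>lebesgue)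
      = (\<integral>x. indicat_real (hsq a s) x *\<^sub>R rep_l2 u x + indicat_real (hsq a s) x *\<^sub>R rep_l2 v x \<partial>lebesgue)"
  proof (rule integral_cong_AE)
    show "AE x in lebesgue. indicat_real (hsq a s) x *\<^sub>R rep_l2 (u + v) x
        = indicat_real (hsq a s) x *\<^sub>R rep_l2 u x + indicat_real (hsq a s) x *\<^sub>R rep_l2 v x"
      using rep_l2_add[of u v] by eventually_elim (simp add: scaleR_add_right)
  qed (intro borel_measurable_add borel_measurable_integrable[OF hsq_integrable])+
  then show ?thesis by (simp add: sqint_hsq set_lebesgue_integral_def hsq_integrable)
qed

lemma sqint_scale: "sqint (l2_scale c u) a s = c * sqint u a s"
proof -
  have "(\<integral>x. indicat_real (hsq a s) x *\<^sub>R rep_l2 (l2_scale c u) x \<partial>lebesgue)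
      = (\<integral>x. c * (indicat_real (hsq a s) x *\<^sub>R rep_l2 u x) \<partial>lebesgue)"
  proof (rule integral_cong_AE)
    show "AE x in lebesgue. indicat_real (hsq a s) x *\<^sub>R rep_l2 (l2_scale c u) x = c * (indicat_real (hsq a s) x *\<^sub>R rep_l2 u x)"
      using rep_l2_scale[of c u] by eventually_elim simp
  qed (intro borel_measurable_times borel_measurable_const borel_measurable_integrable[OF hsq_integrable])+
  also have "\<dots> = c * (\<integral>x. indicat_real (hsq a s) x *\<^sub>R rep_l2 u x \<partial>lebesgue)"
    by (rule integral_mult_right_zero)
  finally show ?thesis by (simp only: sqint_hsq set_lebesgue_integral_def)
qed

lemma avg_add: "avg (u + v) k z = avg u k z + avg v k z"
  by (simp add: avg_def sqint_add scaleR_add_right)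

lemma avg_scale: "avg (l2_scale c u) k z = c * avg u k z"
  by (simp add: avg_def sqint_scale)

section \<open>The Orlicz norm and the number of heavy cells\<close>

text \<open>If \<open>lev x = m + 1\<close>, then \<open>norm x\<close> is at least
  \<open>2 ^ m\<close>; the factor 2 makes up for the lost unit, also for
  \<open>m = 0\<close>.\<close>

lemma lev_le_ln: "real (lev x) * ln 2 \<le> 2 * ln (1 + norm x)"
proof (cases "lev x")
  case 0
  then show ?thesis by simp
next
  case (Suc m)
  then have "x \<notin> sqr m" using lev_le_iff[of x m] by simp
  then obtain i where "\<not> (- (2 ^ m) \<le> x $ i \<and> x $ i < 2 ^ m)" by (auto simp: mem_sqr)
  then have "2 ^ m \<le> \<bar>x $ i\<bar>" by linarith
  then have n: "2 ^ m \<le> norm x" using component_le_norm_cart[of x i] by linarith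
  have "real (Suc m) * ln 2 \<le> 2 * ln (1 + 2 ^ m)"
  proof (cases "m = 0")
    case False
    then have "real (Suc m) * ln 2 \<le> (2 * real m) * ln 2" by (intro mult_right_mono) auto
    also have "\<dots> = 2 * ln (2 ^ m)" by (simp add: ln_realpow)
    also have "\<dots> \<le> 2 * ln (1 + 2 ^ m)" by (intro mult_left_mono ln_mono) simp_all
    finally show ?thesis .
  qed simp
  also have "\<dots> \<le> 2 * ln (1 + norm x)" using n by (intro mult_left_mono ln_mono) (simp_all add: add_pos_pos)
  finally show ?thesis using Suc by simp
qed

lemma N_fun_A_le_exp: "0 \<le> s \<Longrightarrow> N_fun_A s \<le> exp s"
  by (simp add: N_fun_A_def)

text \<open>Convexity and vanishing at 0, here in the form of Bernoulli's inequality for a 200th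
  power. The number 200 is the bound on the exponential integral of the test function, which is
  thereby normalized to 1.\<close>

lemma N_fun_A_scale:
  assumes "0 \<le> s"
  shows "N_fun_A (s / 200) \<le> N_fun_A s / 200"
proof -
  have "1 + real 200 * (exp (s / 200) - 1) \<le> (1 + (exp (s / 200) - 1)) ^ 200"
    by (rule Bernoulli_inequality) (simp add: less_imp_le)
  also have "\<dots> = exp s" by (simp flip: exp_of_nat_mult)
  finally show ?thesis using assms by (simp add: N_fun_A_def field_simps)
qed

text \<open>The Orlicz norm is a supremum over test functions, so one function built from
  \<open>h\<close> bounds it from below. If \<open>V\<close> is not in the Orlicz space, the
  right-hand side is infinite.\<close>

lemma packing_count:
  assumes V: "locally_integrable V" "AE x in lebesgue. V x \<ge> 0"
    and P: "dyadic_tree.packing (pot_measure V) gcode c UNIV \<C>"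
  shows "of_nat (card \<C>) * c \<le> 400 * (orlicz_norm_B V + (\<integral>\<^sup>+x. ennreal (V x * ln (1 + norm x)) \<partial>lebesgue))"
proof (cases "V \<in> orlicz_space N_fun_B")
  case False
  then show ?thesis by (simp add: orlicz_norm_B_def ennreal_mult_top)
next
  case True
  interpret dyadic_tree Mw "pot_measure V" gcode by (rule dyadic_tree_plane[OF V(1)])
  have Vm[measurable]: "V \<in> borel_measurable lebesgue" by (rule locally_integrable_measurable[OF V(1)])
  obtain h :: "real^2 \<Rightarrow> nat" and b where h: "h \<in> Mw \<rightarrow>\<^sub>M count_space UNIV" "\<And>x. h x \<le> b"
    and card: "of_nat (card \<C>) * c \<le> (\<integral>\<^sup>+x. of_nat (h x) \<partial>pot_measure V)"
    and exp_h: "(\<integral>\<^sup>+x. (if h x = 0 then 0 else 2 ^ h x) \<partial>Mw) \<le> 200"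
    by (rule packing_test_function[OF P]) blast
  have hm[measurable]: "h \<in> lebesgue \<rightarrow>\<^sub>M count_space UNIV"
    using h(1) unfolding measurable_cong_sets[OF sets_Mw refl] .
  \<comment> \<open>Subtracting the logarithm of the weight passes from exponential integrability with respect to
    \<open>Mw\<close> to Lebesgue measure; the difference is paid for by the logarithmic moment of \<open>V\<close>.\<close>
  define g where "g x = max 0 (real (h x) * ln 2 - real (lev x) * ln 16)" for x
  have gm[measurable]: "g \<in> borel_measurable lebesgue"
    unfolding g_def[abs_def] by measurable
  have g0: "0 \<le> g x" for x by (simp add: g_def)
  have A_le: "ennreal (N_fun_A (g x)) \<le> wt x * (if h x = 0 then 0 else 2 ^ h x)" for x
  proof (cases "g x = 0")
    case True
    then show ?thesis by (simp add: N_fun_A_def)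
  next
    case False
    then have gx: "g x = real (h x) * ln 2 - real (lev x) * ln 16"
      by (auto simp: g_def max_def split: if_splits)
    have hx: "h x \<noteq> 0"
    proof
      assume "h x = 0"
      moreover have "0 \<le> real (lev x) * ln 16" by simp
      ultimately have "g x = 0" unfolding g_def by simp
      then show False using False by simp
    qed
    have "N_fun_A (g x) \<le> exp (g x)" by (rule N_fun_A_le_exp[OF g0])
    also have "\<dots> = 1 / 16 ^ lev x * 2 ^ h x"
      unfolding gx by (simp add: exp_diff exp_of_nat_mult)
    finally have "ennreal (N_fun_A (g x)) \<le> ennreal (1 / 16 ^ lev x * 2 ^ h x)" by (rule ennreal_leI)
    then show ?thesis using hx by (simp add: wt_def ennreal_mult two_power_ennreal del: times_divide_eq_left)
  qed
  have "(\<integral>\<^sup>+x. ennreal (N_fun_A (g x / 200)) \<partial>lebesgue) \<le> (\<integral>\<^sup>+x. ennreal (1 / 200) * (wt x * (if h x = 0 then 0 else 2 ^ h x)) \<partial>lebesgue)"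
  proof (rule nn_integral_mono)
    fix x
    have "ennreal (N_fun_A (g x / 200)) \<le> ennreal (1 / 200 * N_fun_A (g x))"
      using N_fun_A_scale[OF g0[of x]] by (intro ennreal_leI) simp
    also have "\<dots> = ennreal (1 / 200) * ennreal (N_fun_A (g x))" by (rule ennreal_mult') simp
    also have "\<dots> \<le> ennreal (1 / 200) * (wt x * (if h x = 0 then 0 else 2 ^ h x))"
      by (intro mult_left_mono A_le) simp
    finally show "ennreal (N_fun_A (g x / 200)) \<le> ennreal (1 / 200) * (wt x * (if h x = 0 then 0 else 2 ^ h x))" .
  qed
  also have "\<dots> = ennreal (1 / 200) * (\<integral>\<^sup>+x. (if h x = 0 then 0 else 2 ^ h x) \<partial>Mw)"
    unfolding Mw_def by (subst nn_integral_density) (auto simp: nn_integral_cmult)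
  also have "\<dots> \<le> ennreal (1 / 200) * 200" by (intro mult_left_mono exp_h) simp
  also have "\<dots> = 1" by (simp flip: ennreal_mult ennreal_numeral)
  finally have gA: "(\<integral>\<^sup>+x. ennreal (N_fun_A (g x / 200)) \<partial>lebesgue) \<le> 1" .
  \<comment> \<open>The norm is defined by Bochner integrals, which default to 0, so integrability
    has to be secured: \<open>g\<close> is bounded and vanishes where \<open>lev x\<close> exceeds
    \<open>b\<close>, and \<open>V\<close> is locally integrable.\<close>
  have "integrable lebesgue (\<lambda>x. V x * (g x / 200))"
  proof (rule Bochner_Integration.integrable_bound)
    have "compact (cbox (- vec (2 ^ b)) (- vec (2 ^ b) + vec (2 * 2 ^ b)) :: (real^2) set)" by simp
    then have "set_integrable lebesgue (cbox (- vec (2 ^ b)) (- vec (2 ^ b) + vec (2 * 2 ^ b))) V"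
      using V(1) by (simp add: locally_integrable_def)
    then show "integrable lebesgue (\<lambda>x. real b * (indicat_real (cbox (- vec (2 ^ b)) (- vec (2 ^ b) + vec (2 * 2 ^ b))) x *\<^sub>R V x))"
      by (auto simp: set_integrable_def)
    show "AE x in lebesgue. norm (V x * (g x / 200)) \<le> norm (real b * (indicat_real (cbox (- vec (2 ^ b)) (- vec (2 ^ b) + vec (2 * 2 ^ b))) x *\<^sub>R V x))"
    proof (rule AE_I2)
      fix x
      show "norm (V x * (g x / 200)) \<le> norm (real b * (indicat_real (cbox (- vec (2 ^ b)) (- vec (2 ^ b) + vec (2 * 2 ^ b))) x *\<^sub>R V x))"
      proof (cases "g x = 0")
        case False
        then have gx: "g x = real (h x) * ln 2 - real (lev x) * ln 16" "real (lev x) * ln 16 < real (h x) * ln 2"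
          by (auto simp: g_def max_def split: if_splits)
        have "ln (16::real) = 4 * ln 2" using ln_realpow[of 2 4] by simp
        then have "(4 * real (lev x)) * ln 2 < real (h x) * ln 2" using gx(2) by simp
        then have "4 * real (lev x) < real (h x)" by simp
        then have "lev x \<le> b" using h(2)[of x] by linarith
        then have "x \<in> cbox (- vec (2 ^ b)) (- vec (2 ^ b) + vec (2 * 2 ^ b))"
          using hsq_subset_cbox unfolding lev_le_iff sqr_def by blast
        moreover have "g x / 200 \<le> real b"
        proof -
          have "g x \<le> real (h x) * ln 2" using gx by simp
          also have "\<dots> \<le> real (h x) * 1" using ln_2_less_1 by (intro mult_left_mono) auto
          also have "\<dots> \<le> real b" using h(2)[of x] by simp
          finally show ?thesis using g0[of x] by simp
        qed
        moreover have "\<bar>V x\<bar> * (g x / 200) \<le> \<bar>V x\<bar> * real b"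
          using calculation(2) by (intro mult_left_mono) auto
        ultimately show ?thesis using g0[of x] by (simp add: abs_mult mult.commute)
      qed simp
    qed
  qed measurable
  then have "(\<integral>\<^sup>+x. ennreal (V x * (g x / 200)) \<partial>lebesgue) = ennreal (LINT x|lebesgue. V x * (g x / 200))"
    using V(2) g0 by (intro nn_integral_eq_integral) (auto elim!: eventually_mono)
  also have "\<dots> \<le> ennreal \<bar>LINT x|lebesgue. V x * (g x / 200)\<bar>" by (intro ennreal_leI) simp
  also have "\<dots> \<le> orlicz_norm_B V"
  proof -
    have "(\<lambda>x. g x / 200) \<in> borel_measurable lebesgue" by measurable
    then show ?thesis unfolding orlicz_norm_B_def using True gA
      by (simp, intro Sup_upper) (auto intro!: exI[of _ "\<lambda>x. g x / 200"])
  qed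
  finally have Vg: "(\<integral>\<^sup>+x. ennreal (V x * (g x / 200)) \<partial>lebesgue) \<le> orlicz_norm_B V" .
  let ?J = "\<integral>\<^sup>+x. ennreal (V x * ln (1 + norm x)) \<partial>lebesgue"
  have "(\<integral>\<^sup>+x. of_nat (h x) \<partial>pot_measure V) = (\<integral>\<^sup>+x. ennreal (V x) * of_nat (h x) \<partial>lebesgue)"
    unfolding pot_measure_def by (rule nn_integral_density) measurable
  \<comment> \<open>From \<open>h * ln 2 \<le> g + lev * ln 16\<close>, where
    \<open>ln 16 = 4 * ln 2\<close> and \<open>lev_le_ln\<close> bound the last term by
    \<open>8 * ln (1 + norm x)\<close>. Dividing by \<open>ln 2 \<ge> 1 / 2\<close> doubles both
    coefficients, and 200 undoes the normalization of \<open>g\<close>.\<close>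
  also have "\<dots> \<le> (\<integral>\<^sup>+x. 400 * ennreal (V x * (g x / 200)) + 16 * ennreal (V x * ln (1 + norm x)) \<partial>lebesgue)"
  proof (rule nn_integral_mono_AE, use V(2) in eventually_elim)
    fix x assume Vx: "0 \<le> V x"
    have "real (h x) * ln 2 \<le> g x + real (lev x) * ln 16" by (simp add: g_def)
    moreover have "ln (16::real) = 4 * ln 2" using ln_realpow[of 2 4] by simp
    ultimately have "real (h x) * ln 2 \<le> g x + 8 * ln (1 + norm x)" using lev_le_ln[of x] by simp
    moreover have "real (h x) * (1 / 2) \<le> real (h x) * ln 2" using ln2_ge_two_thirds by (intro mult_left_mono) auto
    ultimately have "real (h x) \<le> 400 * (g x / 200) + 16 * ln (1 + norm x)" by simp
    then have "V x * real (h x) \<le> V x * (400 * (g x / 200) + 16 * ln (1 + norm x))" using Vx by (rule mult_left_mono)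
    then have "ennreal (V x * real (h x)) \<le> ennreal (400 * (V x * (g x / 200)) + 16 * (V x * ln (1 + norm x)))"
      by (intro ennreal_leI) (simp add: algebra_simps)
    also have "\<dots> = 400 * ennreal (V x * (g x / 200)) + 16 * ennreal (V x * ln (1 + norm x))"
      using Vx g0[of x] by (simp add: ennreal_plus ennreal_mult' del: times_divide_eq_right)
    finally show "ennreal (V x) * of_nat (h x) \<le> 400 * ennreal (V x * (g x / 200)) + 16 * ennreal (V x * ln (1 + norm x))"
      using Vx by (simp add: ennreal_mult ennreal_of_nat_eq_real_of_nat)
  qed
  also have "\<dots> = 400 * (\<integral>\<^sup>+x. ennreal (V x * (g x / 200)) \<partial>lebesgue) + 16 * ?J"
  proof -
    have [measurable]: "(\<lambda>x::real^2. ln (1 + norm x)) \<in> borel_measurable lebesgue"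
      by (intro measurable_completion) measurable
    show ?thesis by (subst nn_integral_add) (simp_all add: nn_integral_cmult)
  qed
  also have "\<dots> \<le> 400 * orlicz_norm_B V + 400 * ?J"
    by (intro add_mono mult_left_mono Vg mult_right_mono) auto
  finally show ?thesis using card by (simp add: distrib_left)
qed

section \<open>Nonnegativity of the form under the constraints\<close>

text \<open>In \<open>2048 = 1024 * 2\<close> the first factor is the square of the 32 in
  \<open>gfun\<close>, and the second one comes from the sum of moduli in
  \<open>gradient\<close>.\<close>

lemma form_nonneg:
  assumes V: "locally_integrable V" "AE x in lebesgue. V x \<ge> 0" and w: "w \<in> Dom_E V"
    and le: "(\<integral>\<^sup>+x. (ennreal (cmod (rep_l2 w x)))\<^sup>2 \<partial>pot_measure V) \<le> ennreal (1 / 2048) * (\<integral>\<^sup>+x. (gfun w x)\<^sup>2 \<partial>Mw)"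
  shows "0 \<le> form_E V w"
proof -
  have [measurable]: "V \<in> borel_measurable lebesgue" by (rule locally_integrable_measurable[OF V(1)])
  let ?S = "\<lambda>x. \<Sum>i\<in>UNIV. (cmod (rep_l2 (weak_deriv i w) x))\<^sup>2"
  have intS: "integrable lebesgue ?S" using square_integrable_rep by (auto simp: square_integrable_def)
  have intV: "integrable lebesgue (\<lambda>x. V x * (cmod (rep_l2 w x))\<^sup>2)" using w by (simp add: Dom_E_def)
  have "ennreal (LINT x|lebesgue. V x * (cmod (rep_l2 w x))\<^sup>2) = (\<integral>\<^sup>+x. ennreal (V x * (cmod (rep_l2 w x))\<^sup>2) \<partial>lebesgue)"
    using V(2) by (intro nn_integral_eq_integral[symmetric] intV) (auto elim!: eventually_mono)
  also have "\<dots> = (\<integral>\<^sup>+x. ennreal (V x) * (ennreal (cmod (rep_l2 w x)))\<^sup>2 \<partial>lebesgue)"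
    by (intro nn_integral_cong_AE, use V(2) in eventually_elim) (simp add: ennreal_mult ennreal_power)
  also have "\<dots> = (\<integral>\<^sup>+x. (ennreal (cmod (rep_l2 w x)))\<^sup>2 \<partial>pot_measure V)"
  proof -
    have [measurable]: "(\<lambda>x. ennreal (cmod (rep_l2 w x))) \<in> borel_measurable lebesgue"
      by (rule measurable_compose[OF measurable_compose[OF rep_measurable borel_measurable_norm] measurable_ennreal])
    have "(\<lambda>x. (ennreal (cmod (rep_l2 w x)))\<^sup>2) \<in> borel_measurable lebesgue" by measurable
    then show ?thesis unfolding pot_measure_def by (intro nn_integral_density[symmetric]) auto
  qed
  also have "\<dots> \<le> ennreal (1 / 2048) * (1024 * (\<integral>\<^sup>+x. (gradient w x)\<^sup>2 \<partial>lebesgue))"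
    using le by (simp add: gfun_square_integral)
  also have "\<dots> \<le> ennreal (1 / 2048) * (1024 * (\<integral>\<^sup>+x. ennreal (2 * ?S x) \<partial>lebesgue))"
    by (intro mult_left_mono nn_integral_mono gradient_square_le) auto
  also have "(\<integral>\<^sup>+x. ennreal (2 * ?S x) \<partial>lebesgue) = ennreal (2 * (LINT x|lebesgue. ?S x))"
    using intS by (subst nn_integral_eq_integral) (auto intro!: sum_nonneg)
  also have "ennreal (1 / 2048) * (1024 * ennreal (2 * (LINT x|lebesgue. ?S x))) = ennreal (LINT x|lebesgue. ?S x)"
  proof -
    have "0 \<le> (LINT x|lebesgue. ?S x)" by (intro integral_nonneg_AE AE_I2 sum_nonneg) simp
    then have "ennreal (1 / 2048) * (1024 * ennreal (2 * (LINT x|lebesgue. ?S x))) = ennreal (1 / 2048 * (1024 * (2 * (LINT x|lebesgue. ?S x))))"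
      by (simp only: ennreal_mult ennreal_numeral[symmetric] zero_le_numeral mult_nonneg_nonneg zero_le_divide_1_iff)
    then show ?thesis by simp
  qed
  finally have "(LINT x|lebesgue. V x * (cmod (rep_l2 w x))\<^sup>2) \<le> (LINT x|lebesgue. ?S x)"
    by (subst (asm) ennreal_le_iff) (intro integral_nonneg_AE AE_I2 sum_nonneg, simp)
  then show ?thesis by (simp add: form_E_def)
qed

theorem theorem3p1:
  "\<exists>C::real. C > 0 \<and>
     (\<forall>V :: real^2 \<Rightarrow> real.
        locally_integrable V \<and> (AE x in lebesgue. V x \<ge> 0) \<longrightarrow>
        ennreal_of_enat (l2.N_minus (Dom_E V) (form_E V))
          \<le> ennreal C * (orlicz_norm_B V + (\<integral>\<^sup>+x. ennreal (V x * ln (1 + norm x)) \<partial>lebesgue)) + 1)"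
proof (intro exI[of _ "34 * 81920000 :: real"] conjI allI impI)
  fix V :: "real^2 \<Rightarrow> real"
  assume "locally_integrable V \<and> (AE x in lebesgue. V x \<ge> 0)"
  then have V: "locally_integrable V" "AE x in lebesgue. V x \<ge> 0" by auto
  define X where "X = orlicz_norm_B V + (\<integral>\<^sup>+x. ennreal (V x * ln (1 + norm x)) \<partial>lebesgue)"
  show "ennreal_of_enat (l2.N_minus (Dom_E V) (form_E V)) \<le> ennreal (34 * 81920000) * (orlicz_norm_B V + (\<integral>\<^sup>+x. ennreal (V x * ln (1 + norm x)) \<partial>lebesgue)) + 1"
    unfolding X_def[symmetric]
  proof (cases "X = \<infinity>")
    case True
    then show "ennreal_of_enat (l2.N_minus (Dom_E V) (form_E V)) \<le> ennreal (34 * 81920000) * X + 1"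
      by (simp add: ennreal_mult_top)
  next
    case False
    then obtain r where r: "X = ennreal r" "0 \<le> r" by (metis ennreal_cases infinity_ennreal_def)
    \<comment> \<open>Chosen so that \<open>100 * c\<close> is the \<open>1 / 2048\<close> required
      by \<open>form_nonneg\<close>. Then \<open>81920000 = 400 * 204800\<close>, and
      \<open>K\<close> is the integer part of the bound on packings.\<close>
    define c where "c = ennreal (1 / 204800)"
    define K where "K = nat \<lfloor>81920000 * r\<rfloor>"
    have K: "real K \<le> 81920000 * r" using r by (simp add: K_def)
    interpret dyadic_tree Mw "pot_measure V" gcode by (rule dyadic_tree_plane[OF V(1)])
    interpret bounded_packing Mw "pot_measure V" gcode c K
    proof
      show "0 < c" "c < \<infinity>" by (simp_all add: c_def)
      fix \<C> assume "packing c UNIV \<C>"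
      from packing_count[OF V this] have "of_nat (card \<C>) * c \<le> 400 * X" by (simp add: X_def)
      then have "ennreal (real (card \<C>) * (1 / 204800)) \<le> ennreal (400 * r)"
        using r by (simp add: c_def ennreal_of_nat_eq_real_of_nat ennreal_mult del: times_divide_eq_right)
      then have "real (card \<C>) * (1 / 204800) \<le> 400 * r" using r by (subst (asm) ennreal_le_iff) auto
      then have "real (card \<C>) \<le> 81920000 * r" by simp
      then show "card \<C> \<le> K" by (simp add: K_def le_nat_floor)
    qed
    obtain F where F: "finite F" "card F \<le> 1 + 34 * K"
      and est: "\<And>U g. U \<in> borel_measurable Mw \<Longrightarrow> g \<in> borel_measurable Mw \<Longrightarrow>
        (\<And>k z. (k, z) \<in> F \<Longrightarrow> AE y in pot_measure V. y \<in> node k z \<longrightarrow> U y \<le> pot k g y) \<Longrightarrow>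
        (\<integral>\<^sup>+y. (U y)\<^sup>2 \<partial>pot_measure V) \<le> 100 * c * (\<integral>\<^sup>+y. (g y)\<^sup>2 \<partial>Mw)"
      by (rule ex_constraints) blast
    have nonneg: "0 \<le> form_E V w" if w: "w \<in> Dom_E V" and 0: "\<And>k z. (k, z) \<in> F \<Longrightarrow> avg w k z = 0" for w
    proof (rule form_nonneg[OF V w])
      have W: "w \<in> W12" using w by (simp add: Dom_E_def)
      have "(\<integral>\<^sup>+x. (ennreal (cmod (rep_l2 w x)))\<^sup>2 \<partial>pot_measure V) \<le> 100 * c * (\<integral>\<^sup>+x. (gfun w x)\<^sup>2 \<partial>Mw)"
      proof (rule est)
        have "(\<lambda>x. ennreal (cmod (rep_l2 w x))) \<in> borel_measurable lebesgue"
          by (rule measurable_compose[OF measurable_compose[OF rep_measurable borel_measurable_norm] measurable_ennreal])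
        then show "(\<lambda>x. ennreal (cmod (rep_l2 w x))) \<in> borel_measurable Mw"
          unfolding measurable_cong_sets[OF sets_Mw refl] .
        show "gfun w \<in> borel_measurable Mw"
          unfolding measurable_cong_sets[OF sets_Mw refl] by (rule gfun_measurable)
        fix k z assume "(k, z) \<in> F"
        then have "AE x in lebesgue. x \<in> node k z \<longrightarrow> ennreal (cmod (rep_l2 w x)) \<le> pot k (gfun w) x"
          using 0 by (intro rep_le_pot[OF V(1) W]) simp
        then show "AE x in pot_measure V. x \<in> node k z \<longrightarrow> ennreal (cmod (rep_l2 w x)) \<le> pot k (gfun w) x"
          unfolding pot_measure_def using locally_integrable_measurable[OF V(1)]
          by (subst AE_density) (auto elim: eventually_mono)
      qed
      also have "100 * c = ennreal (1 / 2048)"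
        by (simp add: c_def flip: ennreal_mult ennreal_numeral)
      finally show "(\<integral>\<^sup>+x. (ennreal (cmod (rep_l2 w x)))\<^sup>2 \<partial>pot_measure V) \<le> ennreal (1 / 2048) * (\<integral>\<^sup>+x. (gfun w x)\<^sup>2 \<partial>Mw)" .
    qed
    have "l2.N_minus (Dom_E V) (form_E V) \<le> enat (1 + 34 * K)"
      unfolding l2.N_minus_def
    proof (rule Sup_least, clarify)
      fix L assume L: "l2.subspace L" "L \<subseteq> Dom_E V" "\<forall>u\<in>L - {0}. form_E V u < 0"
      \<comment> \<open>The averages over the selected nodes are linear functionals. A common zero
        in \<open>L\<close> has a nonnegative value of the form and is therefore 0.\<close>
      have "\<exists>B. finite B \<and> card B \<le> card F \<and> L \<subseteq> l2.span B"
      proof (rule l2.ex_small_spanning_set[where f = "\<lambda>(k, z) u. avg u k z"])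
        fix u assume u: "u \<in> L" "\<And>i. i \<in> F \<Longrightarrow> (case i of (k, z) \<Rightarrow> \<lambda>u. avg u k z) u = 0"
        then have "0 \<le> form_E V u" using L(2) by (intro nonneg) auto
        then have "\<not> form_E V u < 0" by simp
        then show "u = 0" using L(3) u(1) by blast
      qed (auto simp: F L avg_add avg_scale)
      then obtain B where B: "finite B" "card B \<le> card F" "L \<subseteq> l2.span B" by blast
      have "l2.edim L \<le> enat (card B)" by (rule l2.edim_le_spanning[OF B(1,3)])
      also have "\<dots> \<le> enat (1 + 34 * K)" using B(2) F(2) by simp
      finally show "l2.edim L \<le> enat (1 + 34 * K)" .
    qed
    then have "ennreal_of_enat (l2.N_minus (Dom_E V) (form_E V)) \<le> ennreal_of_enat (enat (1 + 34 * K))"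
      by (simp only: ennreal_of_enat_le_iff)
    also have "\<dots> = ennreal (1 + 34 * real K)" by (simp add: ennreal_of_nat_eq_real_of_nat)
    also have "\<dots> \<le> ennreal (34 * 81920000 * r + 1)" using K by (intro ennreal_leI) simp
    also have "\<dots> = ennreal (34 * 81920000) * X + 1" using r by (simp add: ennreal_plus ennreal_mult' r(1))
    finally show "ennreal_of_enat (l2.N_minus (Dom_E V) (form_E V)) \<le> ennreal (34 * 81920000) * X + 1" .
  qed
qed simp

end
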